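(* There exist a sofic group $G$, a sofic approximation sequence $\Sigma$ to $G$, and an essentially free ergodic probability measure preserving action $G\curvearrowright(X,\mu)$ such that the sofic entropy satisfies $h^\Sigma_G(X,\mu)=-\infty$ but $\Delta^*_G(X,\mu)=\Delta_G(X,\mu)=+\infty$.
   Context: Groups are countable. Partitions of $X$ are partitions into measurable sets. For a partition $\alpha$ of $X$, $G\cdot\alpha$ denotes the smallest $\sigma$-algebra containing all the sets $g\cdot A$ for $g\in G$ and $A\in\alpha$. The partition $\alpha$ is generating if for every measurable set $B\subseteq X$ there is some $B'\in G\cdot\alpha$ with $\mu(B\triangle B')=0$. The Shannon entropy of a partition $\alpha$ is $\mathrm{H}(\alpha)=\sum_{A\in\alpha^*}-\mu(A)\log(\mu(A))$ (with $0\log 0=0$) if there is a countable subcollection $\alpha^*\subseteq\alpha$ with $\mu(\bigcup\alpha^* )=1$, and $\mathrm{H}(\alpha)=\infty$ otherwise. $\Delta^*_G(X,\mu)$ denotes the infimum of the Shannon entropies of the generating partitions of $G\curvearrowright(X,\mu)$ ($+\infty$ if there are none). $\Delta_G(X,\mu)$ denotes the smallest number of classes of a finite generating partition ($+\infty$ if there are none). An action is essentially free if for almost every $x\in X$ the stabilizer of $x$ in $G$ is trivial. A sofic approximation sequence to $G$ is a sequence $\Sigma=\{\sigma_i:G\to\mathrm{Sym}(d_i)\}_{i\in\mathbb{N}}$ of maps (not necessarily homomorphisms) into finite symmetric groups, with $d_i\to\infty$, such that for all $s,t\in G$, $\frac{1}{d_i}|\{k:\sigma_i(st)(k)=\sigma_i(s)\sigma_i(t)(k)\}|\to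 1$, and for all distinct $s,t\in G$, $\frac{1}{d_i}|\{k:\sigma_i(s)(k)\neq\sigma_i(t)(k)\}|\to 1$. $G$ is sofic if it has a sofic approximation sequence. Sofic entropy (in Kerr's formulation): let $G\curvearrowright(X,\mu)$ be a probability measure preserving action. For a finite partition $\alpha$ of $X$, a finite set $F\subseteq G$ containing the identity, $\delta>0$ and a map $\sigma:G\to\mathrm{Sym}(d)$, let $\alpha_F=\bigvee_{s\in F}s\cdot\alpha$ (common refinement) and let $\mathrm{Hom}_\mu(\alpha,F,\delta,\sigma)$ be the set of all Boolean algebra homomorphisms $\varphi$ from the (finite) algebra generated by $\alpha_F$ to the algebra of all subsets of $\{1,\dots,d\}$ such that (1) $\sum_{A\in\alpha}\frac1d|\sigma(s)(\varphi(A))\triangle\varphi(s\cdot A)|<\delta$ for all $s\in F$, and (2) $\sum_{A\in\alpha_F}\left|\frac1d|\varphi(A)|-\mu(A)\right|<\delta$. For a finite partition $\xi$ coarser than or equal to $\alpha$, let $|\mathrm{Hom}_\mu(\alpha,F,\delta,\sigma)|_\xi$ be the number of distinct restrictions to $\xi$ of elements of $\mathrm{Hom}_\mu(\alpha,F,\delta,\sigma)$. Then $$h^\Sigma_G(X,\mu)=\sup_{\xi}\ \inf_{\alpha\ge\xi}\ \inf_{F}\ \inf_{\delta>0}\ \limsup_{i\to\infty}\frac{1}{d_i}\log|\mathrm{Hom}_\mu(\alpha,F,\delta,\sigma_i)|_\xi,$$ with $\log 0=-\infty$, where $\xi$ ranges over all finite partitions of $X$, $\alpha$ over all finite partitions refining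 $\xi$, and $F$ over all finite subsets of $G$ containing the identity. It takes values in $\{-\infty\}\cup[0,+\infty]$. *)

theory Defs
  imports
    "HOL-Analysis.Analysis"
    "HOL-Probability.Probability_Measure"
    "HOL-Algebra.Group_Action"
    "HOL-Algebra.Sym_Groups"
begin

section \<open>Actions on probability spaces\<close>

definition standard_borel :: "'a measure \<Rightarrow> bool" where
  "standard_borel M \<longleftrightarrow>
     (\<exists>T. completely_metrizable_space T \<and> second_countable T \<and> topspace T = space M \<and>
          sets M = sigma_sets (space M) {U. openin T U})"

text \<open>
  No joint measurability condition is needed, since only countable groups are considered.
\<close>

definition pmp_action :: "('g, 'c) monoid_scheme \<Rightarrow> 'a measure \<Rightarrow> ('g \<Rightarrow> 'a \<Rightarrow> 'a) \<Rightarrow> bool" where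
  "pmp_action G M \<phi> \<longleftrightarrow>
     prob_space M \<and> group_action G (space M) \<phi> \<and>
     (\<forall>g\<in>carrier G. \<phi> g \<in> measurable M M \<and> distr M M (\<phi> g) = M)"

definition essentially_free ::
    "('g, 'c) monoid_scheme \<Rightarrow> 'a measure \<Rightarrow> ('g \<Rightarrow> 'a \<Rightarrow> 'a) \<Rightarrow> bool" where
  "essentially_free G M \<phi> \<longleftrightarrow> (AE x in M. stabilizer G \<phi> x = {\<one>\<^bsub>G\<^esub>})"

definition ergodic_action ::
    "('g, 'c) monoid_scheme \<Rightarrow> 'a measure \<Rightarrow> ('g \<Rightarrow> 'a \<Rightarrow> 'a) \<Rightarrow> bool" where
  "ergodic_action G M \<phi> \<longleftrightarrow>
     (\<forall>A\<in>sets M. (\<forall>g\<in>carrier G. \<phi> g ` A = A) \<longrightarrow> measure M A = 0 \<or> measure M A = 1)"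


section \<open>Generating partitions\<close>

text \<open>
  As in \<^const>\<open>partition_on\<close>, the classes of a partition are nonempty.
\<close>

definition measurable_partition :: "'a measure \<Rightarrow> 'a set set \<Rightarrow> bool" where
  "measurable_partition M \<alpha> \<longleftrightarrow> partition_on (space M) \<alpha> \<and> \<alpha> \<subseteq> sets M"

definition translates_sigma ::
    "('g, 'c) monoid_scheme \<Rightarrow> 'a measure \<Rightarrow> ('g \<Rightarrow> 'a \<Rightarrow> 'a) \<Rightarrow> 'a set set \<Rightarrow> 'a set set" where
  "translates_sigma G M \<phi> \<alpha> = sigma_sets (space M) {\<phi> g ` A | g A. g \<in> carrier G \<and> A \<in> \<alpha>}"

definition generating_partition ::
    "('g, 'c) monoid_scheme \<Rightarrow> 'a measure \<Rightarrow> ('g \<Rightarrow> 'a \<Rightarrow> 'a) \<Rightarrow> 'a set set \<Rightarrow> bool" where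
  "generating_partition G M \<phi> \<alpha> \<longleftrightarrow>
     measurable_partition M \<alpha> \<and>
     (\<forall>B\<in>sets M. \<exists>B'\<in>translates_sigma G M \<phi> \<alpha>. measure M (sym_diff B B') = 0)"

text \<open>
  The sum does not depend on the choice of \<open>\<alpha>'\<close> (any two choices differ by null classes), so the
  infimum below is just the value for any such \<open>\<alpha>'\<close>, and it is \<open>\<infinity>\<close> if there is none.
  The convention \<open>0 log 0 = 0\<close> is built into multiplication by \<open>0\<close>.
\<close>

definition shannon_entropy :: "'a measure \<Rightarrow> 'a set set \<Rightarrow> ennreal" where
  "shannon_entropy M \<alpha> =
     (INF \<alpha>'\<in>{\<alpha>'. countable \<alpha>' \<and> \<alpha>' \<subseteq> \<alpha> \<and> measure M (\<Union>\<alpha>') = 1}.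
        \<Sum>\<^sub>\<infinity>A\<in>\<alpha>'. ennreal (- (measure M A * ln (measure M A))))"

definition Delta_star ::
    "('g, 'c) monoid_scheme \<Rightarrow> 'a measure \<Rightarrow> ('g \<Rightarrow> 'a \<Rightarrow> 'a) \<Rightarrow> ennreal" where
  "Delta_star G M \<phi> = (INF \<alpha>\<in>{\<alpha>. generating_partition G M \<phi> \<alpha>}. shannon_entropy M \<alpha>)"

definition Delta ::
    "('g, 'c) monoid_scheme \<Rightarrow> 'a measure \<Rightarrow> ('g \<Rightarrow> 'a \<Rightarrow> 'a) \<Rightarrow> enat" where
  "Delta G M \<phi> = (INF \<alpha>\<in>{\<alpha>. generating_partition G M \<phi> \<alpha> \<and> finite \<alpha>}. enat (card \<alpha>))"


section \<open>Sofic groups\<close>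

definition sofic_approximation ::
    "('g, 'c) monoid_scheme \<Rightarrow> (nat \<Rightarrow> nat) \<Rightarrow> (nat \<Rightarrow> 'g \<Rightarrow> nat \<Rightarrow> nat) \<Rightarrow> bool" where
  "sofic_approximation G d \<sigma> \<longleftrightarrow>
     filterlim d at_top sequentially \<and>
     (\<forall>i. \<sigma> i \<in> carrier G \<rightarrow> carrier (sym_group (d i))) \<and>
     (\<forall>s\<in>carrier G. \<forall>t\<in>carrier G.
        (\<lambda>i. real (card {k\<in>{1..d i}. \<sigma> i (s \<otimes>\<^bsub>G\<^esub> t) k = \<sigma> i s (\<sigma> i t k)}) / real (d i))
          \<longlonglongrightarrow> 1) \<and>
     (\<forall>s\<in>carrier G. \<forall>t\<in>carrier G. s \<noteq> t \<longrightarrow>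
        (\<lambda>i. real (card {k\<in>{1..d i}. \<sigma> i s k \<noteq> \<sigma> i t k}) / real (d i)) \<longlonglongrightarrow> 1)"

definition sofic_group :: "('g, 'c) monoid_scheme \<Rightarrow> bool" where
  "sofic_group G \<longleftrightarrow> group G \<and> countable (carrier G) \<and> (\<exists>d \<sigma>. sofic_approximation G d \<sigma>)"


section \<open>Sofic entropy\<close>

definition join_translates :: "('g \<Rightarrow> 'a \<Rightarrow> 'a) \<Rightarrow> 'a set set \<Rightarrow> 'g set \<Rightarrow> 'a set set" where
  "join_translates \<phi> \<alpha> F = common_refinement ((\<lambda>s. (\<lambda>A. \<phi> s ` A) ` \<alpha>) ` F)"

definition generated_algebra :: "'a set \<Rightarrow> 'a set set \<Rightarrow> 'a set set" where
  "generated_algebra \<Omega> \<A> = (Sigma_Algebra.algebra \<Omega>) hull \<A>"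

text \<open>Homomorphisms are extensional, so that they are determined by their values on \<open>\<A>\<close>.\<close>

definition boolean_homs :: "'a set \<Rightarrow> 'a set set \<Rightarrow> 'b set \<Rightarrow> ('a set \<Rightarrow> 'b set) set" where
  "boolean_homs \<Omega> \<A> D =
     {h \<in> \<A> \<rightarrow>\<^sub>E Pow D.
        h {} = {} \<and> h \<Omega> = D \<and>
        (\<forall>A\<in>\<A>. h (\<Omega> - A) = D - h A) \<and>
        (\<forall>A\<in>\<A>. \<forall>B\<in>\<A>. h (A \<union> B) = h A \<union> h B \<and> h (A \<inter> B) = h A \<inter> h B)}"

definition Hom_mu ::
    "'a measure \<Rightarrow> ('g \<Rightarrow> 'a \<Rightarrow> 'a) \<Rightarrow> 'a set set \<Rightarrow> 'g set \<Rightarrow> real \<Rightarrow> nat \<Rightarrow>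
     ('g \<Rightarrow> nat \<Rightarrow> nat) \<Rightarrow> ('a set \<Rightarrow> nat set) set" where
  "Hom_mu M \<phi> \<alpha> F \<delta> d \<sigma> =
     {h \<in> boolean_homs (space M) (generated_algebra (space M) (join_translates \<phi> \<alpha> F)) {1..d}.
        (\<forall>s\<in>F. (\<Sum>A\<in>\<alpha>. real (card (sym_diff (\<sigma> s ` h A) (h (\<phi> s ` A)))) / real d) < \<delta>) \<and>
        (\<Sum>A\<in>join_translates \<phi> \<alpha> F. \<bar>real (card (h A)) / real d - measure M A\<bar>) < \<delta>}"

definition num_restrictions :: "('a set \<Rightarrow> 'b set) set \<Rightarrow> 'a set set \<Rightarrow> nat" where
  "num_restrictions H \<xi> = card ((\<lambda>h. restrict h \<xi>) ` H)"

definition log_count :: "nat \<Rightarrow> ereal" where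
  "log_count n = (if n = 0 then - \<infinity> else ereal (ln (real n)))"

definition sofic_entropy ::
    "('g, 'c) monoid_scheme \<Rightarrow> 'a measure \<Rightarrow> ('g \<Rightarrow> 'a \<Rightarrow> 'a) \<Rightarrow> (nat \<Rightarrow> nat) \<Rightarrow>
     (nat \<Rightarrow> 'g \<Rightarrow> nat \<Rightarrow> nat) \<Rightarrow> ereal" where
  "sofic_entropy G M \<phi> d \<sigma> =
     (SUP \<xi>\<in>{\<xi>. measurable_partition M \<xi> \<and> finite \<xi>}.
      INF \<alpha>\<in>{\<alpha>. measurable_partition M \<alpha> \<and> finite \<alpha> \<and> refines (space M) \<alpha> \<xi>}.
      INF F\<in>{F. finite F \<and> F \<subseteq> carrier G \<and> \<one>\<^bsub>G\<^esub> \<in> F}.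
      INF \<delta>\<in>{0<..}.
        limsup (\<lambda>i. ereal (1 / real (d i)) *
                  log_count (num_restrictions (Hom_mu M \<phi> \<alpha> F \<delta> (d i) (\<sigma> i)) \<xi>)))"

end

theory Submission
  imports Defs "HOL-Probability.Infinite_Product_Measure"
begin

text \<open>
  The group is \<open>\<int>\<^sup>2 \<rtimes> \<Gamma>(2)\<close>, and \<open>\<Sigma>\<close> consists of its congruence quotients modulo odd \<open>m\<close>. The parity of
  the first coordinate of the translation part is a homomorphism onto \<open>\<int>/2\<close>; the space is the
  product of the resulting action on two points with the Bernoulli shift over \<open>{0,1}\<^sup>\<nat>\<close>.

  For even \<open>m\<close> the parity descends to the quotient modulo \<open>m\<close>, which therefore carries exact finite
  models of the action. On a model with \<open>N\<close> vertices, a generating partition of entropy \<open>H\<close> would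
  encode the \<open>n\<close> independent bits at every vertex, up to few errors, by a name of cost about \<open>N H\<close>.
  Comparison with the \<open>2\<^sup>n\<^sup>N\<close> configurations gives \<open>n ln 2 \<le> H + 4\<close> for every \<open>n\<close>.

  For odd \<open>m\<close> not even the two-point factor has approximate models. These would be \<open>\<plusminus>1\<close>-valued functions
  that almost change sign under one unit translation and are almost invariant under the other one and
  under the two elementary shears. In the Fourier transform along the translations, the mass of such a
  function concentrates near \<open>(m/2, 0)\<close>, which is not itself a frequency because \<open>m\<close> is odd, and it is
  almost invariant under the dual shears; a ping-pong argument around \<open>(m/2, 0)\<close> excludes this.
\<close>

text \<open>In general the entropy of a generating partition is at least the sofic entropy with
  respect to every sofic approximation sequence. The example therefore rests on a group with two
  approximations that disagree about one action: one sees infinite entropy and the other no models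
  at all. The first enters only through the direct count in \<open>model_bound\<close>, which takes
  the place of the general inequality.

  The disagreement survives small errors because of relative property (T) of the translation
  subgroup: mass that is concentrated near a common fixed point of the dual shears and almost
  invariant under them must charge that point. The explicit form is Burger's sector argument. The
  second approximation is arranged so that the point which would have to be charged is missing.

  The linear part is \<open>\<Gamma>(2)\<close> because the first entry of a composition is
  \<open>x + a x' + b y'\<close>, which is additive modulo 2 exactly when \<open>a\<close> is odd
  and \<open>b\<close> is even for all elements. The shears by 2 in \<open>\<Gamma>(2)\<close> are
  strong enough for the sector argument. Infinitely many bits per vertex make every entropy bound
  fail at once.\<close>

lemma sigma_sets_approx:
  assumes "finite_measure M" and S: "S \<subseteq> sets M" and C: "C \<subseteq> sets M"
    and C_compl: "\<And>A. A \<in> C \<Longrightarrow> space M - A \<in> C"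
    and C_empty: "{} \<in> C"
    and C_Un: "\<And>A B. A \<in> C \<Longrightarrow> B \<in> C \<Longrightarrow> A \<union> B \<in> C"
    and gen: "\<And>A e. A \<in> S \<Longrightarrow> e > 0 \<Longrightarrow> \<exists>D\<in>C. measure M (sym_diff A D) < e"
    and A: "A \<in> sigma_sets (space M) S" and e: "(e::real) > 0"
  shows "\<exists>D\<in>C. measure M (sym_diff A D) < e"
  using A e
proof (induction arbitrary: e rule: sigma_sets.induct)
  \<comment> \<open>The generators need not lie in \<open>C\<close>, only be approximable by it.
    This lets null classes of a partition be replaced by \<open>{}\<close> later on.\<close>
  case (Basic a)
  then show ?case using gen by blast
next
  case Empty
  then show ?case using C_empty by (intro bexI[of _ "{}"]) auto
next
  case (Compl a)
  have aM: "a \<in> sets M"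
    using Compl.hyps S sets.sigma_sets_subset by blast
  obtain D where D: "D \<in> C" "measure M (sym_diff a D) < e"
    using Compl by blast
  have "sym_diff (space M - a) (space M - D) = sym_diff a D"
    using D(1) C aM sets.sets_into_space by blast
  then show ?case using D C_compl by (intro bexI[of _ "space M - D"]) simp_all
next
  case (Union a)
  interpret finite_measure M by fact
  have aM: "a i \<in> sets M" for i
    using Union.hyps S sets.sigma_sets_subset by blast
  let ?U = "\<Union>i. a i"
  let ?P = "\<lambda>n. \<Union>i<n. a i"
  have "(\<lambda>n. measure M (?P n)) \<longlonglongrightarrow> measure M (\<Union>n. ?P n)"
    by (rule finite_Lim_measure_incseq) (use aM in \<open>auto simp: incseq_def\<close>, force)
  moreover have "(\<Union>n. ?P n) = ?U" by auto
  ultimately have "(\<lambda>n. measure M (?P n)) \<longlonglongrightarrow> measure M ?U" by simp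
  from LIMSEQ_D[OF this, of "e/2"] Union.prems
  obtain n where n: "\<bar>measure M (?P n) - measure M ?U\<bar> < e/2" by auto
  \<comment> \<open>Half of the error goes to cutting the union off at \<open>n\<close>, half to the
    \<open>n\<close> approximations; the \<open>+ 1\<close> keeps the quotient meaningful for
    \<open>n = 0\<close>.\<close>
  have "\<forall>i. \<exists>D\<in>C. measure M (sym_diff (a i) D) < e / (2 * (real n + 1))"
    using Union.IH Union.prems by (auto intro!: divide_pos_pos)
  then obtain D where D: "\<And>i. D i \<in> C" "\<And>i. measure M (sym_diff (a i) (D i)) < e / (2 * (real n + 1))"
    by metis
  have DM: "D i \<in> sets M" for i using D C by auto
  have DC: "(\<Union>i<k. D i) \<in> C" for k
    by (induction k) (auto simp: C_empty lessThan_Suc intro!: C_Un D)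
  have "sym_diff ?U (\<Union>i<n. D i) \<subseteq> (?U - ?P n) \<union> (\<Union>i<n. sym_diff (a i) (D i))"
    by auto
  then have "measure M (sym_diff ?U (\<Union>i<n. D i)) \<le> measure M ((?U - ?P n) \<union> (\<Union>i<n. sym_diff (a i) (D i)))"
    using aM DM by (intro finite_measure_mono) auto
  also have "\<dots> \<le> measure M (?U - ?P n) + measure M (\<Union>i<n. sym_diff (a i) (D i))"
    using aM DM by (intro measure_Un_le) auto
  also have "measure M (?U - ?P n) = measure M ?U - measure M (?P n)"
    using aM by (intro finite_measure_Diff) auto
  also have "measure M (\<Union>i<n. sym_diff (a i) (D i)) \<le> (\<Sum>i<n. measure M (sym_diff (a i) (D i)))"
    using aM DM by (intro measure_UNION_le) auto
  also have "\<dots> \<le> (\<Sum>i<n. e / (2 * (real n + 1)))"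
    using D by (intro sum_mono) (auto intro: less_imp_le)
  also have "\<dots> \<le> e/2" using Union.prems by (simp add: field_simps)
  finally have "measure M (sym_diff ?U (\<Union>i<n. D i)) < e" using n by linarith
  then show ?case using DC by blast
qed

section \<open>Fair coins\<close>

definition coins :: "('i \<Rightarrow> bool) measure" where
  "coins = (\<Pi>\<^sub>M i\<in>UNIV. uniform_count_measure UNIV)"

text \<open>One implication suffices because \<open>x\<close> and \<open>y\<close> can be exchanged;
  \<open>determined_byD\<close> gives the equivalence.\<close>

definition determined_by :: "'i set \<Rightarrow> ('i \<Rightarrow> bool) set \<Rightarrow> bool" where
  "determined_by J A \<longleftrightarrow> (\<forall>x y. (\<forall>i\<in>J. x i = y i) \<longrightarrow> x \<in> A \<longrightarrow> y \<in> A)"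

lemma determined_byD:
  "determined_by J A \<Longrightarrow> (\<And>i. i \<in> J \<Longrightarrow> x i = y i) \<Longrightarrow> x \<in> A \<longleftrightarrow> y \<in> A"
  unfolding determined_by_def by metis

lemma determined_by_mono: "determined_by J A \<Longrightarrow> J \<subseteq> K \<Longrightarrow> determined_by K A"
  unfolding determined_by_def by blast

lemma determined_by_compl: "determined_by J A \<Longrightarrow> determined_by J (- A)"
  unfolding determined_by_def by (metis ComplD ComplI)

lemma determined_by_Un: "determined_by J A \<Longrightarrow> determined_by J B \<Longrightarrow> determined_by J (A \<union> B)"
  unfolding determined_by_def by blast

lemma determined_by_Int: "determined_by J A \<Longrightarrow> determined_by J B \<Longrightarrow> determined_by J (A \<inter> B)"
  unfolding determined_by_def by blast

lemma space_coins [simp]: "space coins = UNIV"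
  by (auto simp: coins_def space_PiM space_uniform_count_measure)

lemma prob_space_coins: "prob_space coins"
  unfolding coins_def by (intro prob_space_PiM prob_space_uniform_count_measure) auto

lemma cylinder_prod_emb:
  "{x. \<forall>i\<in>J. x i \<in> X i} = prod_emb UNIV (\<lambda>_. uniform_count_measure UNIV) J (Pi\<^sub>E J X)"
  by (auto simp: prod_emb_def space_uniform_count_measure PiE_iff)

lemma cylinder_in_sets [measurable]:
  "finite J \<Longrightarrow> {x. \<forall>i\<in>J. x i = y i} \<in> sets coins"
  using cylinder_prod_emb[of J "\<lambda>i. {y i}"]
    sets_PiM_I[of J UNIV "\<lambda>i. {y i}" "\<lambda>_. uniform_count_measure UNIV"]
  by (simp add: coins_def sets_uniform_count_measure)

lemma measure_cylinder:
  assumes "finite J"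
  shows "measure coins {x. \<forall>i\<in>J. x i = y i} = (1/2) ^ card J"
proof -
  interpret product_prob_space "\<lambda>_. uniform_count_measure (UNIV::bool set)" UNIV
    by (intro product_prob_spaceI prob_space_uniform_count_measure) auto
  have "measure coins {x. \<forall>i\<in>J. x i = y i} = (\<Prod>i\<in>J. measure (uniform_count_measure UNIV) {y i})"
    using measure_PiM_emb[of J "\<lambda>i. {y i}"] assms cylinder_prod_emb[of J "\<lambda>i. {y i}"] 
    by (simp add: coins_def sets_uniform_count_measure)
  also have "\<dots> = (\<Prod>i\<in>J. 1/2)"
    by (intro prod.cong) (auto simp: measure_uniform_count_measure)
  finally show ?thesis by simp
qed

lemma determined_by_eq_UN:
  assumes "determined_by J A"
  shows "A = (\<Union>S\<in>{S. S \<subseteq> J \<and> (\<lambda>i. i \<in> S) \<in> A}. {x. \<forall>i\<in>J. x i = (i \<in> S)})"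
proof (intro equalityI subsetI)
  fix x assume x: "x \<in> A"
  then have "(\<lambda>i. i \<in> {i\<in>J. x i}) \<in> A"
    using determined_byD[OF assms, of x "\<lambda>i. i \<in> {i\<in>J. x i}"] by auto
  then show "x \<in> (\<Union>S\<in>{S. S \<subseteq> J \<and> (\<lambda>i. i \<in> S) \<in> A}. {x. \<forall>i\<in>J. x i = (i \<in> S)})"
    by (intro UN_I[of "{i\<in>J. x i}"]) auto
next
  fix x assume "x \<in> (\<Union>S\<in>{S. S \<subseteq> J \<and> (\<lambda>i. i \<in> S) \<in> A}. {x. \<forall>i\<in>J. x i = (i \<in> S)})"
  then obtain S where "(\<lambda>i. i \<in> S) \<in> A" "\<forall>i\<in>J. x i = (i \<in> S)" by auto
  then show "x \<in> A" using determined_byD[OF assms, of x "\<lambda>i. i \<in> S"] by auto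
qed

lemma determined_by_in_sets:
  assumes "finite J" "determined_by J A"
  shows "A \<in> sets coins"
proof -
  have "finite {S. S \<subseteq> J \<and> (\<lambda>i. i \<in> S) \<in> A}"
    using assms(1) by (auto intro: finite_subset[of _ "Pow J"])
  then have "(\<Union>S\<in>{S. S \<subseteq> J \<and> (\<lambda>i. i \<in> S) \<in> A}. {x. \<forall>i\<in>J. x i = (i \<in> S)}) \<in> sets coins"
    using assms(1) by (intro sets.finite_UN cylinder_in_sets)
  then show ?thesis using determined_by_eq_UN[OF assms(2)] by simp
qed

text \<open>A pattern on \<open>J\<close> is encoded as the subset \<open>S\<close> of
  \<open>J\<close> where it is true, and represented by the configuration that is false off
  \<open>J\<close>. Measures of finitely determined sets become counts of subsets, and later measure
  identities become bijections of finite sets.\<close>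

lemma measure_determined_by:
  assumes "finite J" "determined_by J A"
  shows "measure coins A = card {S. S \<subseteq> J \<and> (\<lambda>i. i \<in> S) \<in> A} / 2 ^ card J"
proof -
  interpret prob_space coins by (rule prob_space_coins)
  let ?I = "{S. S \<subseteq> J \<and> (\<lambda>i. i \<in> S) \<in> A}"
  have fin: "finite ?I" using assms(1) by (auto intro: finite_subset[of _ "Pow J"])
  have "measure coins A = measure coins (\<Union>S\<in>?I. {x. \<forall>i\<in>J. x i = (i \<in> S)})"
    using determined_by_eq_UN[OF assms(2)] by simp
  also have "\<dots> = (\<Sum>S\<in>?I. measure coins {x. \<forall>i\<in>J. x i = (i \<in> S)})"
    using fin assms(1)
    by (intro finite_measure_finite_Union) (auto simp: disjoint_family_on_def intro!: cylinder_in_sets)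
  also have "\<dots> = card ?I / 2 ^ card J"
    using assms(1) by (simp add: measure_cylinder power_one_over divide_simps)
  finally show ?thesis .
qed

text \<open>Reading fair coins through an injective relabelling and flipping some of them gives fair
  coins again. This is used twice: for the action, where the flip is that of the two-point factor,
  and for the view of a coloured finite model from one vertex.\<close>

lemma measure_coins_pull:
  fixes \<iota> :: "'i \<Rightarrow> 'j" and s :: "'i \<Rightarrow> bool"
  assumes "finite J" "inj_on \<iota> J" "determined_by J A"
  defines "B \<equiv> {x. (\<lambda>i. x (\<iota> i) \<noteq> s i) \<in> A}"
  shows "determined_by (\<iota> ` J) B" "measure coins B = measure coins A"
proof -
  show B: "determined_by (\<iota> ` J) B"
    unfolding determined_by_def B_def
  proof clarify
    fix x y assume *: "\<forall>i\<in>\<iota> ` J. x i = y i" "(\<lambda>i. x (\<iota> i) \<noteq> s i) \<in> A"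
    show "(\<lambda>i. y (\<iota> i) \<noteq> s i) \<in> A"
      using determined_byD[OF assms(3), of "\<lambda>i. y (\<iota> i) \<noteq> s i" "\<lambda>i. x (\<iota> i) \<noteq> s i"] * by auto
  qed
  let ?f = "\<lambda>S. \<iota> ` {i\<in>J. (i \<in> S) \<noteq> s i}"
  let ?g = "\<lambda>S'. {i\<in>J. (\<iota> i \<in> S') \<noteq> s i}"
  have "bij_betw ?f {S. S \<subseteq> J \<and> (\<lambda>i. i \<in> S) \<in> A} {S. S \<subseteq> \<iota> ` J \<and> (\<lambda>i. i \<in> S) \<in> B}"
  proof (rule bij_betw_byWitness[where f' = ?g])
    have 1: "\<iota> i \<in> ?f S \<longleftrightarrow> (i \<in> S) \<noteq> s i" if "i \<in> J" for i S
      using assms(2) that by (auto dest: inj_onD)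
    show "\<forall>S\<in>{S. S \<subseteq> J \<and> (\<lambda>i. i \<in> S) \<in> A}. ?g (?f S) = S"
    proof (intro ballI, elim CollectE conjE)
      fix S assume "S \<subseteq> J"
      then show "?g (?f S) = S" by (simp only: 1 cong: conj_cong) auto
    qed
    show "\<forall>S'\<in>{S. S \<subseteq> \<iota> ` J \<and> (\<lambda>i. i \<in> S) \<in> B}. ?f (?g S') = S'"
      by (intro ballI, elim CollectE conjE) auto
    show "?f ` {S. S \<subseteq> J \<and> (\<lambda>i. i \<in> S) \<in> A} \<subseteq> {S. S \<subseteq> \<iota> ` J \<and> (\<lambda>i. i \<in> S) \<in> B}"
    proof (intro image_subsetI CollectI, elim CollectE conjE)
      fix S assume S: "S \<subseteq> J" "(\<lambda>i. i \<in> S) \<in> A"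
      have "(\<lambda>i. (\<iota> i \<in> ?f S) \<noteq> s i) \<in> A \<longleftrightarrow> (\<lambda>i. i \<in> S) \<in> A"
        by (intro determined_byD[OF assms(3)]) (simp only: 1, blast)
      then show "?f S \<subseteq> \<iota> ` J \<and> (\<lambda>i. i \<in> ?f S) \<in> B" unfolding B_def using S(2) by blast
    qed
    show "?g ` {S. S \<subseteq> \<iota> ` J \<and> (\<lambda>i. i \<in> S) \<in> B} \<subseteq> {S. S \<subseteq> J \<and> (\<lambda>i. i \<in> S) \<in> A}"
    proof clarsimp
      fix S assume S: "S \<subseteq> \<iota> ` J" "(\<lambda>i. i \<in> S) \<in> B"
      then have "(\<lambda>i. (\<iota> i \<in> S) \<noteq> s i) \<in> A" by (simp add: B_def)
      then show "(\<lambda>i. i \<in> J \<and> (\<iota> i \<in> S) = (\<not> s i)) \<in> A"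
        using determined_byD[OF assms(3), of "\<lambda>i. (\<iota> i \<in> S) \<noteq> s i" "\<lambda>i. i \<in> J \<and> (\<iota> i \<in> S) = (\<not> s i)"] by auto
    qed
  qed
  then have "card {S. S \<subseteq> J \<and> (\<lambda>i. i \<in> S) \<in> A} = card {S. S \<subseteq> \<iota> ` J \<and> (\<lambda>i. i \<in> S) \<in> B}"
    by (rule bij_betw_same_card)
  then show "measure coins B = measure coins A"
    using measure_determined_by[OF assms(1,3)] measure_determined_by[OF _ B] assms(1,2)
    by (simp add: card_image)
qed

text \<open>Independence of disjoint blocks: a pattern on \<open>J \<union> K\<close> is a pair of
  patterns on the two blocks.\<close>

lemma measure_coins_Int:
  assumes J: "finite J" "finite K" "J \<inter> K = {}" and A: "determined_by J A" and B: "determined_by K B"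
  shows "measure coins (A \<inter> B) = measure coins A * measure coins B"
proof -
  have AB: "determined_by (J \<union> K) (A \<inter> B)"
    using A B by (intro determined_by_Int) (auto intro: determined_by_mono)
  let ?P = "\<lambda>J A. {S. S \<subseteq> J \<and> (\<lambda>i. i \<in> S) \<in> A}"
  have "bij_betw (\<lambda>(S, T). S \<union> T) (?P J A \<times> ?P K B) (?P (J \<union> K) (A \<inter> B))"
  proof (rule bij_betw_byWitness[where f' = "\<lambda>S. (S \<inter> J, S \<inter> K)"])
    show "(\<lambda>(S, T). S \<union> T) ` (?P J A \<times> ?P K B) \<subseteq> ?P (J \<union> K) (A \<inter> B)"
    proof clarsimp
      fix S T assume *: "S \<subseteq> J" "(\<lambda>i. i \<in> S) \<in> A" "T \<subseteq> K" "(\<lambda>i. i \<in> T) \<in> B"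
      have "(\<lambda>i. i \<in> S \<or> i \<in> T) \<in> A"
        using determined_byD[OF A, of "\<lambda>i. i \<in> S" "\<lambda>i. i \<in> S \<or> i \<in> T"] * J(3) by blast
      moreover have "(\<lambda>i. i \<in> S \<or> i \<in> T) \<in> B"
        using determined_byD[OF B, of "\<lambda>i. i \<in> T" "\<lambda>i. i \<in> S \<or> i \<in> T"] * J(3) by blast
      ultimately show "S \<subseteq> J \<union> K \<and> T \<subseteq> J \<union> K \<and> (\<lambda>i. i \<in> S \<or> i \<in> T) \<in> A \<and> (\<lambda>i. i \<in> S \<or> i \<in> T) \<in> B"
        using * by auto
    qed
    show "(\<lambda>S. (S \<inter> J, S \<inter> K)) ` ?P (J \<union> K) (A \<inter> B) \<subseteq> ?P J A \<times> ?P K B"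
    proof clarsimp
      fix S assume *: "(\<lambda>i. i \<in> S) \<in> A" "(\<lambda>i. i \<in> S) \<in> B"
      show "(\<lambda>i. i \<in> S \<and> i \<in> J) \<in> A \<and> (\<lambda>i. i \<in> S \<and> i \<in> K) \<in> B"
        using determined_byD[OF A, of "\<lambda>i. i \<in> S" "\<lambda>i. i \<in> S \<and> i \<in> J"]
          determined_byD[OF B, of "\<lambda>i. i \<in> S" "\<lambda>i. i \<in> S \<and> i \<in> K"] * by auto
    qed
  qed (use J in auto)
  from bij_betw_same_card[OF this]
  have "card (?P (J \<union> K) (A \<inter> B)) = card (?P J A) * card (?P K B)"
    by (simp only: card_cartesian_product)
  moreover have "card (J \<union> K) = card J + card K" using J by (simp add: card_Un_disjoint)
  ultimately show ?thesis
    using measure_determined_by[OF J(1) A] measure_determined_by[OF J(2) B]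
      measure_determined_by[OF _ AB] J by (simp add: power_add)
qed

lemma sets_coins: "sets (coins :: ('i \<Rightarrow> bool) measure) = sigma_sets UNIV {{x. x i} |i. True}"
proof (rule equalityI)
  let ?S = "sigma_sets UNIV {{x. x i} |i::'i. True}"
  interpret sigma_algebra UNIV ?S
    by (intro sigma_algebra_sigma_sets) auto
  have "sets coins = sigma_sets UNIV {{x \<in> UNIV. x i \<in> A} |(i::'i) A. A \<in> UNIV}"
    unfolding coins_def sets_PiM_single
    by (simp add: space_uniform_count_measure sets_uniform_count_measure)
  also have "\<dots> \<subseteq> sigma_sets UNIV {{x. x i} |i. True}"
  proof (rule sigma_sets_mono, safe)
    fix i :: 'i and A :: "bool set"
    have 1: "{x. x i} \<in> sigma_sets UNIV {{x. x i} |i::'i. True}" by auto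
    have 2: "{x. \<not> x i} \<in> sigma_sets UNIV {{x. x i} |i. True}"
      using compl_sets[OF 1] by (simp add: Compl_eq_Diff_UNIV[symmetric] Collect_neg_eq)
    have "{x \<in> UNIV. x i \<in> A} = (if True \<in> A then {x. x i} else {}) \<union> (if False \<in> A then {x. \<not> x i} else {})"
    proof (rule equalityI; rule subsetI)
      fix x show "x \<in> {x \<in> UNIV. x i \<in> A} \<Longrightarrow> x \<in> (if True \<in> A then {x. x i} else {}) \<union> (if False \<in> A then {x. \<not> x i} else {})"
        by (cases "x i") auto
      show "x \<in> (if True \<in> A then {x. x i} else {}) \<union> (if False \<in> A then {x. \<not> x i} else {}) \<Longrightarrow> x \<in> {x \<in> UNIV. x i \<in> A}"
        by (cases "x i") (auto split: if_splits)
    qed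
    also have "\<dots> \<in> sigma_sets UNIV {{x. x i} |i. True}"
      using 1 2 empty_sets by (intro Un) auto
    finally show "{x \<in> UNIV. x i \<in> A} \<in> sigma_sets UNIV {{x. x i} |i. True}" .
  qed
  finally show "sets (coins :: ('i \<Rightarrow> bool) measure) \<subseteq> ?S" .
  have "{{x. x i} |i::'i. True} \<subseteq> sets coins"
    using cylinder_in_sets[of "{i}" "\<lambda>_. True" for i] by auto
  from sets.sigma_sets_subset[OF this]
  show "?S \<subseteq> sets coins" by simp
qed

lemma coins_approx:
  assumes "A \<in> sets coins" "e > 0"
  obtains J C where "finite J" "determined_by J C" "measure coins (sym_diff A C) < e"
proof -
  interpret prob_space coins by (rule prob_space_coins)
  let ?C = "{C. \<exists>J. finite J \<and> determined_by J C}"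
  have "\<exists>D\<in>?C. measure coins (sym_diff A D) < e"
  proof (rule sigma_sets_approx[where S = "{{x. x i} |i. True}"])
    show "?C \<subseteq> sets coins" by (auto intro: determined_by_in_sets)
    show "space coins - A \<in> ?C" if "A \<in> ?C" for A
      using that determined_by_compl by (auto simp: Compl_eq_Diff_UNIV[symmetric])
    show "A \<union> B \<in> ?C" if "A \<in> ?C" "B \<in> ?C" for A B
    proof -
      obtain J K where "finite J" "determined_by J A" "finite K" "determined_by K B"
        using \<open>A \<in> ?C\<close> \<open>B \<in> ?C\<close> by blast
      then have "finite (J \<union> K)" "determined_by (J \<union> K) (A \<union> B)"
        by (auto intro!: determined_by_Un elim: determined_by_mono)
      then show ?thesis by blast
    qed
    show "\<exists>D\<in>?C. measure coins (sym_diff A D) < e"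
      if A: "A \<in> {{x. x i} |i. True}" and "e > 0" for A and e :: real
    proof -
      obtain i where "A = {x. x i}" using A by auto
      then have "determined_by {i} A" by (simp add: determined_by_def)
      then show ?thesis using \<open>e > 0\<close> by (intro bexI[of _ A]) auto
    qed
    show "{{x. x i} |i. True} \<subseteq> sets coins"
      unfolding sets_coins by (rule sigma_sets_superset_generator)
    show "{} \<in> ?C" by (auto simp: determined_by_def)
    show "A \<in> sigma_sets (space coins) {{x. x i} |i. True}"
      using assms(1) unfolding sets_coins by simp
  qed (use assms finite_measure_axioms in auto)
  then show ?thesis using that by blast
qed

section \<open>The twisted Bernoulli shift\<close>

text \<open>Coordinate \<open>None\<close> is the point of the two-point factor and
  \<open>Some (g, k)\<close> is the \<open>k\<close>-th bit at \<open>g\<close>. With one index type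
  for both factors the product measure is again \<open>coins\<close>.\<close>

type_synonym 'g config = "('g \<times> nat) option \<Rightarrow> bool"

locale twisted_shift =
  fixes par :: "'g::{group_add,countable} \<Rightarrow> bool"
  assumes par_add: "par (g + h) \<longleftrightarrow> par g \<noteq> par h"
begin

definition src :: "'g \<Rightarrow> ('g \<times> nat) option \<Rightarrow> ('g \<times> nat) option" where
  "src g i = map_option (apfst ((+) (- g))) i"

definition act :: "'g \<Rightarrow> 'g config \<Rightarrow> 'g config" where
  "act g x i \<longleftrightarrow> x (src g i) \<noteq> (i = None \<and> par g)"

lemma act_None: "act g x None \<longleftrightarrow> x None \<noteq> par g"
  by (simp add: act_def src_def)

lemma act_Some: "act g x (Some (h, k)) \<longleftrightarrow> x (Some (- g + h, k))"
  by (simp add: act_def src_def)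

lemma par_0: "\<not> par 0"
  using par_add[of 0 0] by simp

lemma par_minus: "par (- g) = par g"
  using par_add[of "- g" g] par_0 by simp

lemma act_0 [simp]: "act 0 x = x"
proof
  fix i show "act 0 x i = x i"
    by (cases i) (auto simp: act_None act_Some par_0)
qed

lemma act_add: "act (g + h) x = act g (act h x)"
proof
  fix i show "act (g + h) x i = act g (act h x) i"
    by (cases i) (auto simp: act_None act_Some par_add minus_add add.assoc simp del: add_uminus_conv_diff)
qed

lemma act_minus [simp]: "act (- g) (act g x) = x" "act g (act (- g) x) = x"
  by (simp_all flip: act_add)

lemma act_image: "act g ` A = act (- g) -` A"
proof (intro equalityI subsetI)
  fix x assume "x \<in> act (- g) -` A"
  then show "x \<in> act g ` A" by (intro image_eqI[of _ _ "act (- g) x"]) auto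
qed auto

lemma inj_src: "inj (src g)"
  unfolding src_def
  by (intro option.inj_map) (auto simp: inj_on_def)

lemma determined_by_act:
  assumes "finite J" "determined_by J A"
  shows "determined_by (src g ` J) (act g -` A)" "measure coins (act g -` A) = measure coins A"
proof -
  have eq: "act g -` A = {x. (\<lambda>i. x (src g i) \<noteq> (i = None \<and> par g)) \<in> A}"
    by (simp add: act_def[abs_def] vimage_def)
  have inj: "inj_on (src g) J" using inj_src by (rule inj_on_subset) simp
  show "determined_by (src g ` J) (act g -` A)" "measure coins (act g -` A) = measure coins A"
    unfolding eq by (rule measure_coins_pull[OF assms(1) inj assms(2)])+
qed

lemma measurable_act [measurable]: "act g \<in> coins \<rightarrow>\<^sub>M coins"
proof (rule measurable_sigma_sets[OF sets_coins])
  fix A :: "'g config set" assume "A \<in> {{x. x i} |i. True}"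
  then obtain i where A: "A = {x. x i}" by blast
  then have "determined_by {i} A" by (simp add: determined_by_def)
  from determined_by_act(1)[OF _ this, of g] show "act g -` A \<inter> space coins \<in> sets coins"
    using determined_by_in_sets[of "{src g i}" "act g -` A"] by simp
qed auto

lemma distr_act: "distr coins coins (act g) = coins"
proof (rule measure_eqI_PiM_infinite[where I = UNIV and M = "\<lambda>_. uniform_count_measure UNIV"])
  interpret prob_space "coins :: 'g config measure" by (rule prob_space_coins)
  interpret D: prob_space "distr coins coins (act g)" by (rule prob_space_distr) simp
  show "finite_measure (distr coins coins (act g))" by unfold_locales
  fix J :: "('g \<times> nat) option set" and A :: "('g \<times> nat) option \<Rightarrow> bool set"
  assume J: "finite J"
  let ?C = "prod_emb UNIV (\<lambda>_. uniform_count_measure UNIV) J (Pi\<^sub>E J A)"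
  have C: "determined_by J ?C"
    unfolding cylinder_prod_emb[symmetric] determined_by_def by auto
  have "measure (distr coins coins (act g)) ?C = measure coins ?C"
    using determined_by_in_sets[OF J C] determined_by_act(2)[OF J C]
    by (simp add: measure_distr)
  then show "emeasure (distr coins coins (act g)) ?C = emeasure coins ?C"
    by (simp add: emeasure_eq_measure D.emeasure_eq_measure)
qed (auto simp: coins_def)

lemma measure_act_vimage: 
  assumes "A \<in> sets coins" shows "measure coins (act g -` A) = measure coins A"
proof -
  have "measure coins (act g -` A) = measure (distr coins coins (act g)) A"
    using assms by (simp add: measure_distr)
  then show ?thesis by (simp add: distr_act)
qed

lemma act_vimage_sets [measurable (raw)]: "A \<in> sets coins \<Longrightarrow> act g -` A \<in> sets coins"
  using measurable_sets[OF measurable_act, of A g] by simp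

text \<open>A fixed point has equal \<open>k\<close>-th bits at \<open>0\<close> and at
  \<open>- g\<close> for every \<open>k\<close>. These are infinitely many independent coincidences
  of probability \<open>1/2\<close>, so freeness comes from the infinite alphabet at one
  vertex.\<close>

lemma act_fixed_null:
  assumes "g \<noteq> 0"
  shows "{x. act g x = x} \<in> null_sets coins"
proof -
  interpret prob_space "coins :: 'g config measure" by (rule prob_space_coins)
  let ?a = "\<lambda>k::nat. Some (0::'g, k)" and ?b = "\<lambda>k::nat. Some (- g, k)"
  let ?D = "\<lambda>n. {x :: 'g config. \<forall>k<n. x (?a k) = x (?b k)}"
  let ?J = "\<lambda>n::nat. ?a ` {..<n} \<union> ?b ` {..<n}"
  have det: "determined_by (?J n) (?D n)" for n
    by (auto simp: determined_by_def)
  have meas: "?D n \<in> sets coins" for n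
    using det by (rule determined_by_in_sets[rotated]) auto
  have m: "measure coins (?D n) \<le> (1/2) ^ n" for n
  proof -
    have "card (?J n) = card (?a ` {..<n}) + card (?b ` {..<n})"
      using assms by (intro card_Un_disjoint) auto
    also have "\<dots> = 2 * n" by (simp add: card_image inj_on_def)
    finally have cJ: "card (?J n) = 2 * n" .
    let ?P = "{S. S \<subseteq> ?J n \<and> (\<lambda>i. i \<in> S) \<in> ?D n}"
    \<comment> \<open>Under the coincidences the bits at \<open>0\<close> determine those at
      \<open>- g\<close>, so at most \<open>2 ^ n\<close> of the \<open>2 ^ (2 * n)\<close> patterns
      remain.\<close>
    have "card ?P \<le> card (Pow (?a ` {..<n}))"
    proof (rule card_inj_on_le[where f = "\<lambda>S. S \<inter> ?a ` {..<n}"])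
      show "inj_on (\<lambda>S. S \<inter> ?a ` {..<n}) ?P"
      proof (rule inj_onI)
        fix S T assume S: "S \<in> ?P" and T: "T \<in> ?P" and eq: "S \<inter> ?a ` {..<n} = T \<inter> ?a ` {..<n}"
        have a: "?a k \<in> S \<longleftrightarrow> ?a k \<in> T" if "k < n" for k using eq that by blast
        then have b: "?b k \<in> S \<longleftrightarrow> ?b k \<in> T" if "k < n" for k using S T that by auto
        show "S = T" using S T a b by blast
      qed
    qed auto
    also have "\<dots> = 2 ^ n" by (simp add: card_Pow card_image inj_on_def)
    finally have "real (card ?P) \<le> real (2 ^ n)" by (simp only: of_nat_le_iff)
    then have "real (card ?P) \<le> 2 ^ n" by simp
    then have "real (card ?P) / 2 ^ (2 * n) \<le> 2 ^ n / 2 ^ (2 * n)" by (intro divide_right_mono) auto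
    also have "\<dots> = (1/2) ^ n" by (simp add: mult_2 power_add power_divide)
    finally show ?thesis using measure_determined_by[OF _ det, of n] cJ by simp
  qed
  have sub: "{x. act g x = x} \<subseteq> ?D n" for n
  proof clarify
    fix x k assume "act g x = x"
    from fun_cong[OF this, of "?a k"] show "x (?a k) = x (?b k)" by (simp add: act_Some)
  qed
  have "(\<Inter>n. ?D n) \<in> null_sets coins"
  proof (rule null_setsI)
    show "(\<Inter>n. ?D n) \<in> sets coins" using meas by auto
    have "measure coins (\<Inter>n. ?D n) \<le> (1/2) ^ n" for n
      using finite_measure_mono[of "\<Inter>n. ?D n" "?D n"] meas[of n] m[of n] by (meson INT_lower UNIV_I order_trans)
    moreover have "(\<lambda>n. (1/2 :: real) ^ n) \<longlonglongrightarrow> 0" by (rule LIMSEQ_power_zero) simp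
    ultimately have "measure coins (\<Inter>n. ?D n) \<le> 0"
      by (intro tendsto_lowerbound[where F = sequentially]) auto
    then show "emeasure coins (\<Inter>n. ?D n) = 0"
      by (simp add: emeasure_eq_measure measure_le_0_iff)
  qed
  moreover have "{x. act g x = x} \<subseteq> (\<Inter>n. ?D n)" using sub by blast
  moreover have "{x. act g x = x} \<in> sets coins"
  proof -
    have "{x. act g x = x} = (\<Inter>i. {x. act g x i = x i})" by (auto simp: fun_eq_iff)
    moreover have "{x. act g x i = x i} \<in> sets coins" for i
      by (rule determined_by_in_sets[of "{i, src g i}"]) (auto simp: determined_by_def act_def)
    ultimately show ?thesis by auto
  qed
  ultimately show ?thesis using null_sets_subset by blast
qed

lemma act_free: "AE x in coins. \<forall>g. act g x = x \<longrightarrow> g = 0"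
proof -
  have "AE x in coins. act g x = x \<longrightarrow> g = 0" for g
  proof (cases "g = 0")
    case False
    then show ?thesis using AE_not_in[OF act_fixed_null] by auto
  qed simp
  then show ?thesis by (simp add: AE_all_countable)
qed

lemma act_ergodic:
  assumes odd: "\<exists>g. par g"
    and inf: "\<And>E. finite E \<Longrightarrow> \<exists>g. \<not> par g \<and> (\<forall>h\<in>E. g + h \<notin> E)"
    and A: "A \<in> sets coins" and inv: "\<And>g. act g ` A = A"
  shows "measure coins A = 0 \<or> measure coins A = 1"
proof -
  interpret prob_space "coins :: 'g config measure" by (rule prob_space_coins)
  have inv': "act g -` A = A" for g using inv[of "- g"] by (simp add: act_image)
  let ?b = "{x :: 'g config. x None}"
  have b_det: "determined_by {None} ?b" by (simp add: determined_by_def)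
  have b[measurable]: "?b \<in> sets coins" using b_det by (rule determined_by_in_sets[rotated]) simp
  have mb: "prob ?b = 1/2" using measure_cylinder[of "{None}" "\<lambda>_. True"] by simp
  let ?p = "prob (A \<inter> ?b)"
  obtain g1 where g1: "par g1" using odd by blast
  \<comment> \<open>An element with \<open>par\<close> true exchanges the two halves, so each of
    them carries half of \<open>A\<close>.\<close>
  have "act g1 -` (A \<inter> ?b) = A - ?b"
    using inv'[of g1] g1 by (auto simp: act_None)
  then have "prob (A - ?b) = ?p" using measure_act_vimage[of "A \<inter> ?b" g1] A by simp
  then have pA: "prob A = 2 * ?p"
    using A finite_measure_Diff'[of A ?b] by simp
  have approx: "\<bar>?p - 2 * ?p\<^sup>2\<bar> \<le> 8 * e" if "e > 0" for e
  proof -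
    obtain J C where J: "finite J" and C: "determined_by J C" and e: "prob (sym_diff A C) < e"
      using coins_approx[OF A \<open>e > 0\<close>] .
    have CM[measurable]: "C \<in> sets coins" using J C by (rule determined_by_in_sets)
    note A[measurable]
    \<comment> \<open>Elements with \<open>par\<close> false do not move the coordinate
      \<open>None\<close>, so displacement cannot make it independent of itself. Freezing it to
      \<open>True\<close> leaves a set that depends on displaceable coordinates only.\<close>
    define C' where "C' = {x. x(None := True) \<in> C}"
    define J' where "J' = J - {None}"
    have C': "determined_by J' C'"
      unfolding determined_by_def C'_def J'_def
    proof clarify
      fix x y assume "\<forall>i\<in>J - {None}. x i = y i" "x(None := True) \<in> C"
      then show "y(None := True) \<in> C"
        using determined_byD[OF C, of "x(None := True)" "y(None := True)"] by auto
    qed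
    have Cb: "C \<inter> ?b = C' \<inter> ?b"
    proof -
      have "x \<in> C \<inter> ?b \<longleftrightarrow> x \<in> C' \<inter> ?b" for x
      proof (cases "x None")
        case True
        then have "x(None := True) = x" by (simp add: fun_upd_idem_iff)
        then show ?thesis by (simp add: C'_def True)
      qed simp
      then show ?thesis by blast
    qed
    have J': "finite J'" "None \<notin> J'" using J by (auto simp: J'_def)
    have C'M[measurable]: "C' \<in> sets coins" using J'(1) C' by (rule determined_by_in_sets)
    obtain g where g: "\<not> par g" "\<forall>h\<in>{h. \<exists>k. Some (h, k) \<in> J'}. g + h \<notin> {h. \<exists>k. Some (h, k) \<in> J'}"
    proof -
      have "{h. \<exists>k. Some (h, k) \<in> J'} \<subseteq> (\<lambda>i. fst (the i)) ` J'" by force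
      then have "finite {h. \<exists>k. Some (h, k) \<in> J'}" using J' finite_surj by blast
      then show ?thesis using inf that by blast
    qed
    let ?D = "act (- g) -` C'"
    have D: "determined_by (src (- g) ` J') ?D" "prob ?D = prob C'"
      using determined_by_act[OF J'(1) C'] by auto
    have disj: "J' \<inter> src (- g) ` J' = {}" "None \<notin> src (- g) ` J'"
    proof -
      { fix i assume i: "i \<in> J'" "src (- g) i \<in> insert None J'"
        then obtain h k where hk: "i = Some (h, k)" using J'(2) by (cases i) auto
        then have "g + h \<in> {h. \<exists>k. Some (h, k) \<in> J'}" using i(2) by (auto simp: src_def)
        then have False using g(2) i(1) hk by blast }
      then show "J' \<inter> src (- g) ` J' = {}" "None \<notin> src (- g) ` J'" by (blast, metis imageE insertI1)
    qed
    have DM[measurable]: "?D \<in> sets coins" by (rule act_vimage_sets) simp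
    have 1: "prob (C \<inter> ?b) = prob C' / 2"
      unfolding Cb using measure_coins_Int[OF J'(1) _ _ C' b_det] J'(2) mb by simp
    have "act (- g) -` (C \<inter> ?b) = ?D \<inter> ?b"
      unfolding Cb using g(1) by (auto simp: act_None par_minus)
    then have gC: "(C \<inter> ?b) \<inter> act (- g) -` (C \<inter> ?b) = (C' \<inter> ?D) \<inter> ?b"
      unfolding Cb by auto
    have CD: "prob (C' \<inter> ?D) = prob C' * prob C'"
      using measure_coins_Int[OF J'(1) _ disj(1) C' D(1)] J'(1) D(2) by simp
    have "determined_by (J' \<union> src (- g) ` J') (C' \<inter> ?D)"
      using C' D(1) by (intro determined_by_Int) (auto elim: determined_by_mono)
    from measure_coins_Int[OF _ _ _ this b_det] J' disj(2)
    have 2: "prob ((C \<inter> ?b) \<inter> act (- g) -` (C \<inter> ?b)) = prob C' * prob C' / 2"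
      unfolding gC using CD mb by simp
    let ?S = "sym_diff A C"
    have close: "\<bar>prob X - prob Y\<bar> \<le> prob Z" if "sym_diff X Y \<subseteq> Z" "X \<in> sets coins" "Y \<in> sets coins" "Z \<in> sets coins" for X Y Z
    proof -
      have "prob X \<le> prob (Y \<union> Z)" "prob Y \<le> prob (X \<union> Z)"
        using that by (intro finite_measure_mono; auto)+
      moreover have "prob (Y \<union> Z) \<le> prob Y + prob Z" "prob (X \<union> Z) \<le> prob X + prob Z"
        using that by (intro measure_Un_le; auto)+
      ultimately show ?thesis by linarith
    qed
    have 3: "\<bar>prob (A \<inter> ?b) - prob (C \<inter> ?b)\<bar> \<le> prob ?S"
      by (rule close) auto
    have inv'': "act (- g) -` (A \<inter> ?b) = A \<inter> ?b"
      using inv'[of "- g"] g(1) by (auto simp: act_None par_minus)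
    have "\<bar>prob (A \<inter> ?b) - prob ((C \<inter> ?b) \<inter> act (- g) -` (C \<inter> ?b))\<bar> \<le> prob (?S \<union> act (- g) -` ?S)"
    proof (rule close)
      have "act (- g) x \<in> A \<inter> ?b" if "x \<in> A \<inter> ?b" for x using that inv'' by (metis vimageE)
      then show "sym_diff (A \<inter> ?b) ((C \<inter> ?b) \<inter> act (- g) -` (C \<inter> ?b)) \<subseteq> ?S \<union> act (- g) -` ?S"
        by blast
      show "(C \<inter> ?b) \<inter> act (- g) -` (C \<inter> ?b) \<in> sets coins"
        by (intro sets.Int act_vimage_sets CM b)
      show "?S \<union> act (- g) -` ?S \<in> sets coins"
        by (intro sets.Un sets.Diff act_vimage_sets CM A)
    qed (intro sets.Int A b)
    also have "\<dots> \<le> prob ?S + prob (act (- g) -` ?S)"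
      by (intro measure_Un_le sets.Un sets.Diff act_vimage_sets CM A)
    also have "prob (act (- g) -` ?S) = prob ?S"
      by (intro measure_act_vimage sets.Un sets.Diff CM A)
    finally have 4: "\<bar>?p - prob C' * prob C' / 2\<bar> \<le> 2 * prob ?S" unfolding 2 by simp
    have 5: "\<bar>?p - prob C' / 2\<bar> \<le> prob ?S" using 3 unfolding 1 .
    have "\<bar>c * c / 2 - 2 * p\<^sup>2\<bar> \<le> 4 * r"
      if "\<bar>p - c / 2\<bar> \<le> r" "0 \<le> c" "c \<le> 1" "0 \<le> p" "p \<le> 1" for p c r :: real
    proof -
      have "c * c / 2 - 2 * p\<^sup>2 = 2 * ((c / 2 - p) * (c / 2 + p))"
        by (simp add: algebra_simps power2_eq_square)
      moreover have "\<bar>(c / 2 - p) * (c / 2 + p)\<bar> \<le> r * 2"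
        unfolding abs_mult using that by (intro mult_mono) (auto simp: abs_minus_commute)
      ultimately show ?thesis by linarith
    qed
    from this[OF 5] have "\<bar>prob C' * prob C' / 2 - 2 * ?p\<^sup>2\<bar> \<le> 4 * prob ?S" by simp
    then show ?thesis using 4 e by linarith
  qed
  have "\<bar>?p - 2 * ?p\<^sup>2\<bar> \<le> 0"
  proof (rule field_le_epsilon)
    fix e :: real assume "0 < e"
    with approx[of "e / 8"] show "\<bar>?p - 2 * ?p\<^sup>2\<bar> \<le> 0 + e" by simp
  qed
  then have "?p * (1 - 2 * ?p) = 0" by (simp add: algebra_simps power2_eq_square)
  then have "?p = 0 \<or> 1 - 2 * ?p = 0" by (simp only: mult_eq_0_iff)
  then show ?thesis using pA by linarith
qed

end

section \<open>Finite models and generating partitions\<close>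

lemma sum_Pow_prod:
  fixes w :: "'a \<Rightarrow> real"
  assumes "finite X"
  shows "(\<Sum>S\<in>Pow X. \<Prod>x\<in>S. w x) = (\<Prod>x\<in>X. 1 + w x)"
  using prod_add[OF assms, of w "\<lambda>_. 1"] by (simp add: add.commute)

lemma prod_one_plus_le_exp:
  fixes w :: "'a \<Rightarrow> real"
  assumes "finite X" "\<And>x. x \<in> X \<Longrightarrow> 0 \<le> w x"
  shows "(\<Prod>x\<in>X. 1 + w x) \<le> exp (\<Sum>x\<in>X. w x)"
  unfolding exp_sum[OF assms(1)] using assms(2) by (intro prod_mono) auto

text \<open>Jensen's inequality for \<open>exp (- x)\<close>, obtained from the tangent line at
  \<open>m\<close>.\<close>

lemma sum_exp_minus_ge:
  fixes c :: "'a \<Rightarrow> real" and m :: real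
  assumes "finite S" "(\<Sum>z\<in>S. c z) \<le> card S * m"
  shows "card S * exp (- m) \<le> (\<Sum>z\<in>S. exp (- c z))"
proof -
  have "exp (- m) * (1 + m - c z) \<le> exp (- c z)" for z
  proof -
    have "exp (- m) * (1 + (m - c z)) \<le> exp (- m) * exp (m - c z)"
      by (intro mult_left_mono exp_ge_add_one_self) simp
    also have "\<dots> = exp (- c z)" by (simp flip: exp_add)
    finally show ?thesis by (simp add: algebra_simps)
  qed
  then have "(\<Sum>z\<in>S. exp (- m) * (1 + m - c z)) \<le> (\<Sum>z\<in>S. exp (- c z))"
    by (intro sum_mono)
  also have "(\<Sum>z\<in>S. exp (- m) * (1 + m - c z)) = exp (- m) * (card S + card S * m - (\<Sum>z\<in>S. c z))"
    by (simp add: sum_distrib_left[symmetric] sum.distrib sum_subtractf distrib_left)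
  finally have *: "exp (- m) * (card S + card S * m - (\<Sum>z\<in>S. c z)) \<le> (\<Sum>z\<in>S. exp (- c z))" .
  have "exp (- m) * card S \<le> exp (- m) * (card S + card S * m - (\<Sum>z\<in>S. c z))"
    using assms(2) by (intro mult_left_mono) auto
  also note *
  finally show ?thesis by (simp only: mult.commute)
qed

lemma sum_filter_swap:
  fixes w :: "'a \<Rightarrow> real"
  assumes "finite Z" "finite X"
  shows "(\<Sum>z\<in>Z. \<Sum>x\<in>{x\<in>X. R z x}. w x) = (\<Sum>x\<in>X. w x * card {z\<in>Z. R z x})"
proof -
  have "(\<Sum>z\<in>Z. \<Sum>x\<in>{x\<in>X. R z x}. w x) = (\<Sum>z\<in>Z. \<Sum>x\<in>X. if R z x then w x else 0)"
    using assms(2) by (intro sum.cong refl sum.inter_filter)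
  also have "\<dots> = (\<Sum>x\<in>X. \<Sum>z\<in>Z. if R z x then w x else 0)" by (rule sum.swap)
  also have "\<dots> = (\<Sum>x\<in>X. \<Sum>z\<in>{z\<in>Z. R z x}. w x)"
    using assms(1) by (intro sum.cong refl sum.inter_filter[symmetric])
  also have "\<dots> = (\<Sum>x\<in>X. w x * card {z\<in>Z. R z x})" by (simp add: mult.commute)
  finally show ?thesis .
qed

section \<open>Coloured finite models and finite names\<close>

context twisted_shift
begin

text \<open>The action \<open>a\<close> and the function \<open>p\<close> are exact; only freeness
  is limited to the finite set \<open>E\<close>. The function \<open>p\<close> is a model of the
  two-point factor.\<close>

definition free_model :: "'g set \<Rightarrow> 'v set \<Rightarrow> ('g \<Rightarrow> 'v \<Rightarrow> 'v) \<Rightarrow> ('v \<Rightarrow> bool) \<Rightarrow> bool" where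
  "free_model E V a p \<longleftrightarrow> finite V \<and> V \<noteq> {} \<and>
     (\<forall>v\<in>V. a 0 v = v \<and> inj_on (\<lambda>g. a g v) E \<and>
       (\<forall>g. a g v \<in> V \<and> (p (a g v) \<longleftrightarrow> p v \<noteq> par g) \<and> (\<forall>h. a (g + h) v = a g (a h v))))"

text \<open>The bit \<open>(h, k)\<close> seen from \<open>v\<close> is stored at the vertex
  \<open>a (- h) v\<close>; the inverse is what makes \<open>act_pull\<close> hold.
  \<open>None\<close> goes to a single global bit, which decides between \<open>p\<close> and its
  complement.\<close>

definition label :: "('g \<Rightarrow> 'v \<Rightarrow> 'v) \<Rightarrow> 'v \<Rightarrow> ('g \<times> nat) option \<Rightarrow> ('v \<times> nat) option" where
  "label a v = map_option (\<lambda>(h, k). (a (- h) v, k))"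

text \<open>
  \<open>pull a p v z\<close> is the point of the shift seen from the vertex \<open>v\<close> when the model is coloured by \<open>z\<close>.
\<close>

definition pull :: "('g \<Rightarrow> 'v \<Rightarrow> 'v) \<Rightarrow> ('v \<Rightarrow> bool) \<Rightarrow> 'v \<Rightarrow> ('v \<times> nat) option set \<Rightarrow> 'g config" where
  "pull a p v z i \<longleftrightarrow> (label a v i \<in> z) \<noteq> (i = None \<and> p v)"

lemma act_pull:
  assumes "free_model E V a p" "v \<in> V"
  shows "act g (pull a p v z) = pull a p (a g v) z"
proof
  fix i show "act g (pull a p v z) i = pull a p (a g v) z i"
  proof (cases i)
    case None
    then show ?thesis using assms by (auto simp: act_None pull_def label_def free_model_def)
  next
    case (Some hk)
    obtain h k where hk: "hk = (h, k)" by (cases hk)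
    have "- (- g + h) = - h + g" by (simp add: minus_add)
    then have "a (- (- g + h)) v = a (- h) (a g v)"
      using assms by (simp add: free_model_def del: add_uminus_conv_diff)
    then show ?thesis by (simp add: Some hk act_Some pull_def label_def)
  qed
qed

text \<open>Seen from a fixed vertex, a uniformly random colouring has exactly the law of
  \<open>coins\<close> on the window given by \<open>E\<close> and \<open>L\<close>: freeness on the
  negatives of \<open>E\<close> makes \<open>label\<close> injective there.\<close>

lemma card_pull:
  fixes V :: "'v set" and L :: nat
  defines "W \<equiv> insert None (Some ` (V \<times> {..<L}))"
  assumes model: "free_model (uminus ` E) V a p" and v: "v \<in> V" and E: "finite E"
    and Q: "determined_by (insert None (Some ` (E \<times> {..<L}))) Q"
  shows "real (card {z. z \<subseteq> W \<and> pull a p v z \<in> Q}) = 2 ^ card W * measure coins Q"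
proof -
  let ?J = "insert None (Some ` (E \<times> {..<L}))"
  have J: "finite ?J" using E by auto
  have W: "finite W" using model by (simp add: W_def free_model_def)
  have inj: "inj_on (label a v) ?J"
  proof (rule inj_onI)
    fix i j assume i: "i \<in> ?J" and j: "j \<in> ?J" and eq: "label a v i = label a v j"
    have inj': "inj_on (\<lambda>g. a g v) (uminus ` E)" using model v by (simp add: free_model_def)
    show "i = j"
    proof (cases i)
      case None
      then show ?thesis using eq by (cases j) (auto simp: label_def)
    next
      case (Some hk)
      obtain h k where hk: "hk = (h, k)" by (cases hk)
      obtain h' k' where j': "j = Some (h', k')" using eq Some by (cases j) (auto simp: label_def)
      have "a (- h) v = a (- h') v" "k = k'" using eq by (auto simp: Some hk j' label_def)
      moreover have "- h \<in> uminus ` E" "- h' \<in> uminus ` E" using i j by (auto simp: Some hk j')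
      ultimately have "- h = - h'" "k = k'" using inj_onD[OF inj', of "- h" "- h'"] by blast+
      then show ?thesis by (simp add: Some hk j')
    qed
  qed
  have sub: "label a v ` ?J \<subseteq> W"
    using model v by (auto simp: label_def W_def free_model_def)
  let ?B = "{x. (\<lambda>i. x (label a v i) \<noteq> (i = None \<and> p v)) \<in> Q}"
  have B: "determined_by W ?B" "measure coins ?B = measure coins Q"
    by (rule determined_by_mono[OF measure_coins_pull(1)[OF J inj Q] sub],
        rule measure_coins_pull(2)[OF J inj Q])
  have "{z. z \<subseteq> W \<and> pull a p v z \<in> Q} = {S. S \<subseteq> W \<and> (\<lambda>i. i \<in> S) \<in> ?B}"
    by (simp add: pull_def[abs_def])
  then have "measure coins Q = real (card {z. z \<subseteq> W \<and> pull a p v z \<in> Q}) / 2 ^ card W"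
    using measure_determined_by[OF W B(1)] B(2) by (simp only:)
  then show ?thesis by simp
qed

text \<open>A finite name of \<open>x\<close>. The sets \<open>C\<close> are a parameter so that one
  decoder can be applied both to the classes of a partition and to their finitely determined
  approximations.\<close>

definition itinerary :: "'g set \<Rightarrow> 't set \<Rightarrow> ('t \<Rightarrow> 'g config set) \<Rightarrow> 'g config \<Rightarrow> ('g \<times> 't) set" where
  "itinerary F T C x = {(g, t). g \<in> F \<and> t \<in> T \<and> act (- g) x \<in> C t}"

abbreviation bit :: "nat \<Rightarrow> 'g config set" where
  "bit j \<equiv> {x. x (Some (0, j))}"

text \<open>A Kraft inequality for colourings. The cost \<open>c z\<close> charges
  \<open>- ln (m t)\<close> for every vertex whose view lies in \<open>C t\<close> and
  \<open>ln n\<close> for every wrongly decoded bit. Its average is at most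
  \<open>card V * (K + 1)\<close>, so by Jensen the weights \<open>exp (- c z)\<close> sum to at
  least \<open>2 ^ card W * exp (- (card V * (K + 1)))\<close>. Injectivity of the encoding bounds
  the same sum by a product over all conceivable codes, at most
  \<open>exp (2 * card V) * 2 ^ card R\<close>. The \<open>3\<close> is one unit for the errors in
  the average and one for each of the two products. The sets \<open>C t\<close> may overlap, so a
  name is an arbitrary subset of \<open>V \<times> T\<close>, and the factors are
  \<open>1 + m t\<close> rather than \<open>m t\<close>.\<close>

lemma model_bound:
  fixes V :: "'v set" and F :: "'g set" and T :: "'t set" and m :: "'t \<Rightarrow> real" and C :: "'t \<Rightarrow> 'g config set"
    and P :: "nat \<Rightarrow> ('g \<times> 't) set set"
  defines "D \<equiv> \<lambda>j. {x. itinerary F T C x \<in> P j}"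
  assumes model: "free_model (uminus ` E) V a p" and E: "finite E" "0 \<in> E" and n: "n \<ge> 1" "n \<le> L"
    and T: "finite T" "\<And>t. t \<in> T \<Longrightarrow> 0 < m t" "(\<Sum>t\<in>T. m t) \<le> 1"
    and C: "\<And>t. t \<in> T \<Longrightarrow> determined_by (insert None (Some ` (E \<times> {..<L}))) (C t)"
    and D: "\<And>j. j < n \<Longrightarrow> determined_by (insert None (Some ` (E \<times> {..<L}))) (D j)"
    and K: "(\<Sum>t\<in>T. - ln (m t) * measure coins (C t)) \<le> K"
    and err: "ln n * (\<Sum>j<n. measure coins (sym_diff (bit j) (D j))) \<le> 1"
  shows "n * ln 2 \<le> K + 3"
proof -
  let ?J = "insert None (Some ` (E \<times> {..<L}))"
  let ?pi = "pull a p"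
  have V: "finite V" "V \<noteq> {}" using model by (auto simp: free_model_def)
  define W where "W = insert None (Some ` (V \<times> {..<L}))"
  define R where "R = W - Some ` (V \<times> {..<n})"
  have W: "finite W" using V by (simp add: W_def)
  have Wn: "Some ` (V \<times> {..<n}) \<subseteq> W" using n by (auto simp: W_def)
  have R: "finite R" "card W = card R + n * card V"
  proof -
    show "finite R" using W by (simp add: R_def)
    have "card (Some ` (V \<times> {..<n})) = n * card V"
      by (simp add: card_image card_cartesian_product)
    then show "card W = card R + n * card V"
      using card_Diff_subset[OF _ Wn] card_mono[OF W Wn] V by (simp add: R_def)
  qed
  define al where "al z = {x \<in> V \<times> T. ?pi (fst x) z \<in> C (snd x)}" for z
  define er where "er z = {x \<in> V \<times> {..<n}. (Some x \<in> z) \<noteq> (?pi (fst x) z \<in> D (snd x))}" for z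
  \<comment> \<open>The price \<open>ln n\<close> gives a wrong bit the weight \<open>1 / n\<close>,
    so the \<open>n\<close> bits at a vertex contribute a factor of at most
    \<open>(1 + 1 / n) ^ n\<close>, which is below \<open>exp 1\<close>.\<close>
  define c where "c z = (\<Sum>x\<in>al z. - ln (m (snd x))) + ln n * (\<Sum>x\<in>er z. 1)" for z
  have al: "al z \<subseteq> V \<times> T" and er: "er z \<subseteq> V \<times> {..<n}" for z
    by (auto simp: al_def er_def)
  have fin_al: "finite (al z)" and fin_er: "finite (er z)" for z
    using finite_subset[OF al] finite_subset[OF er] V T by auto

  have avg: "(\<Sum>z\<in>Pow W. c z) \<le> card (Pow W) * (card V * (K + 1))"
  proof -
    have bitD: "{z \<in> Pow W. (Some (v, j) \<in> z) \<noteq> (?pi v z \<in> D j)}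
      = {z. z \<subseteq> W \<and> ?pi v z \<in> sym_diff (bit j) (D j)}" if "v \<in> V" for v j
    proof -
      have "?pi v z (Some (0, j)) \<longleftrightarrow> Some (v, j) \<in> z" for z
        using model that by (simp add: pull_def label_def free_model_def)
      then show ?thesis by auto
    qed
    have det: "determined_by ?J (sym_diff (bit j) (D j))" if "j < n" for j
    proof -
      have bit: "determined_by ?J (bit j)" using E n that by (auto simp: determined_by_def)
      have *: "A - B = A \<inter> - B" for A B :: "'g config set" by blast
      show ?thesis unfolding *
        by (intro determined_by_Un determined_by_Int determined_by_compl bit D[OF that])
    qed
    have 1: "(\<Sum>z\<in>Pow W. \<Sum>x\<in>al z. - ln (m (snd x)))
      = 2 ^ card W * (card V * (\<Sum>t\<in>T. - ln (m t) * measure coins (C t)))"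
    proof -
      have "(\<Sum>z\<in>Pow W. \<Sum>x\<in>al z. - ln (m (snd x)))
        = (\<Sum>x\<in>V \<times> T. - ln (m (snd x)) * card {z \<in> Pow W. ?pi (fst x) z \<in> C (snd x)})"
        unfolding al_def using V T W by (intro sum_filter_swap) auto
      also have "\<dots> = (\<Sum>x\<in>V \<times> T. 2 ^ card W * (- ln (m (snd x)) * measure coins (C (snd x))))"
      proof (rule sum.cong[OF refl])
        fix x assume "x \<in> V \<times> T"
        then have "real (card {z \<in> Pow W. ?pi (fst x) z \<in> C (snd x)}) = 2 ^ card W * measure coins (C (snd x))"
          using card_pull[OF model _ E(1) C, of "fst x" "snd x"] by (auto simp: W_def)
        then show "- ln (m (snd x)) * card {z \<in> Pow W. ?pi (fst x) z \<in> C (snd x)}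
          = 2 ^ card W * (- ln (m (snd x)) * measure coins (C (snd x)))" by simp
      qed
      also have "\<dots> = 2 ^ card W * (\<Sum>v\<in>V. \<Sum>t\<in>T. - ln (m t) * measure coins (C t))"
        by (simp only: sum.cartesian_product sum_distrib_left[symmetric] case_prod_unfold)
      also have "(\<Sum>v\<in>V. \<Sum>t\<in>T. - ln (m t) * measure coins (C t)) = card V * (\<Sum>t\<in>T. - ln (m t) * measure coins (C t))"
        by (simp only: sum_constant)
      finally show ?thesis .
    qed
    have 2: "(\<Sum>z\<in>Pow W. \<Sum>x\<in>er z. 1)
      = 2 ^ card W * (card V * (\<Sum>j<n. measure coins (sym_diff (bit j) (D j))))"
    proof -
      have "(\<Sum>z\<in>Pow W. \<Sum>x\<in>er z. 1)
        = (\<Sum>x\<in>V \<times> {..<n}. 1 * real (card {z \<in> Pow W. (Some x \<in> z) \<noteq> (?pi (fst x) z \<in> D (snd x))}))"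
        unfolding er_def using V T W by (intro sum_filter_swap) auto
      also have "\<dots> = (\<Sum>x\<in>V \<times> {..<n}. 2 ^ card W * measure coins (sym_diff (bit (snd x)) (D (snd x))))"
      proof (rule sum.cong[OF refl])
        fix x assume x: "x \<in> V \<times> {..<n}"
        then have *: "fst x \<in> V" "snd x < n" by auto
        have "real (card {z. z \<subseteq> W \<and> ?pi (fst x) z \<in> sym_diff (bit (snd x)) (D (snd x))})
          = 2 ^ card W * measure coins (sym_diff (bit (snd x)) (D (snd x)))"
          unfolding W_def by (rule card_pull[OF model *(1) E(1) det[OF *(2)]])
        then show "1 * real (card {z \<in> Pow W. (Some x \<in> z) \<noteq> (?pi (fst x) z \<in> D (snd x))})
          = 2 ^ card W * measure coins (sym_diff (bit (snd x)) (D (snd x)))"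
          using bitD[OF *(1), of "snd x"] by simp
      qed
      also have "\<dots> = 2 ^ card W * (\<Sum>v\<in>V. \<Sum>j<n. measure coins (sym_diff (bit j) (D j)))"
        by (simp only: sum.cartesian_product sum_distrib_left[symmetric] case_prod_unfold)
      also have "(\<Sum>v\<in>V. \<Sum>j<n. measure coins (sym_diff (bit j) (D j))) = card V * (\<Sum>j<n. measure coins (sym_diff (bit j) (D j)))"
        by (simp only: sum_constant)
      finally show ?thesis .
    qed
    have "(\<Sum>z\<in>Pow W. c z) = 2 ^ card W * (card V * ((\<Sum>t\<in>T. - ln (m t) * measure coins (C t))
       + ln n * (\<Sum>j<n. measure coins (sym_diff (bit j) (D j)))))"
      unfolding c_def sum.distrib sum_distrib_left[symmetric] 1 2 by (simp only: algebra_simps)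
    also have "\<dots> \<le> 2 ^ card W * (card V * (K + 1))"
      using K err by (intro mult_left_mono add_mono) auto
    finally show ?thesis using W by (simp add: card_Pow)
  qed

  text \<open>
    The names \<open>al z\<close> of \<open>z\<close>, the set \<open>er z\<close> of the bits that are decoded wrongly from them, and the
    remaining bits of \<open>z\<close> determine \<open>z\<close>.
  \<close>
  have inj: "inj_on (\<lambda>z. (al z, er z, z \<inter> R)) (Pow W)"
  proof (rule inj_onI)
    fix y z assume yz: "y \<in> Pow W" "z \<in> Pow W" and eq: "(al y, er y, y \<inter> R) = (al z, er z, z \<inter> R)"
    \<comment> \<open>By equivariance the itinerary seen from \<open>v\<close> is read off
      \<open>al\<close> at the vertices \<open>a (- g) v\<close>.\<close>
    have it: "itinerary F T C (?pi v x) = {(g, t). g \<in> F \<and> (a (- g) v, t) \<in> al x}" if "v \<in> V" for v x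
    proof -
      have "a g v \<in> V" for g using model that by (simp add: free_model_def)
      then show ?thesis by (auto simp: itinerary_def al_def act_pull[OF model that])
    qed
    have "?pi v y \<in> D j \<longleftrightarrow> ?pi v z \<in> D j" if "v \<in> V" for v j
      using it[OF that, of y] it[OF that, of z] eq unfolding D_def by simp
    moreover have "(v, j) \<in> er y \<longleftrightarrow> (v, j) \<in> er z" for v j using eq by simp
    ultimately have "Some (v, j) \<in> y \<longleftrightarrow> Some (v, j) \<in> z" if "v \<in> V" "j < n" for v j
      using that by (auto simp: er_def)
    then have "i \<in> y \<longleftrightarrow> i \<in> z" if "i \<in> Some ` (V \<times> {..<n})" for i using that by auto
    moreover have "i \<in> y \<longleftrightarrow> i \<in> z" if "i \<in> R" for i using eq that by blast
    ultimately show "y = z" using yz unfolding R_def by blast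
  qed

  have upper: "(\<Sum>z\<in>Pow W. exp (- c z)) \<le> exp (2 * card V) * 2 ^ card R"
  proof -
    let ?f = "\<lambda>A. \<Prod>x\<in>A. m (snd x)" and ?h = "\<lambda>B. \<Prod>b\<in>B. 1 / real n"
    let ?S = "Pow (V \<times> T) \<times> Pow (V \<times> {..<n}) \<times> Pow R"
    have c: "exp (- c z) = ?f (al z) * ?h (er z)" for z
    proof -
      have "- c z = (\<Sum>x\<in>al z. ln (m (snd x))) + card (er z) * ln (1 / n)"
        using n by (simp add: c_def sum_negf ln_div)
      also have "exp \<dots> = (\<Prod>x\<in>al z. exp (ln (m (snd x)))) * exp (ln (1 / n)) ^ card (er z)"
        by (simp only: exp_add exp_sum[OF fin_al] exp_of_nat_mult)
      also have "(\<Prod>x\<in>al z. exp (ln (m (snd x)))) = ?f (al z)"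
        using al[of z] T(2) by (intro prod.cong refl) auto
      also have "exp (ln (1 / n)) ^ card (er z) = ?h (er z)" using n by simp
      finally show ?thesis .
    qed
    have "(\<Sum>z\<in>Pow W. exp (- c z)) = (\<Sum>z\<in>Pow W. (\<lambda>(A, B, r). ?f A * ?h B) (al z, er z, z \<inter> R))"
      by (simp add: c)
    also have "\<dots> = (\<Sum>x\<in>(\<lambda>z. (al z, er z, z \<inter> R)) ` Pow W. (\<lambda>(A, B, r). ?f A * ?h B) x)"
      using sum.reindex[OF inj, of "\<lambda>(A, B, r). ?f A * ?h B"] by (simp only: o_def)
    \<comment> \<open>The encoded colourings are distinct triples with nonnegative weights; summing
      over all triples instead makes the sum factorise.\<close>
    also have "\<dots> \<le> (\<Sum>x\<in>?S. (\<lambda>(A, B, r). ?f A * ?h B) x)"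
    proof (rule sum_mono2)
      show "finite ?S" using V T R by auto
      show "(\<lambda>z. (al z, er z, z \<inter> R)) ` Pow W \<subseteq> ?S" using al er by auto
      fix x assume "x \<in> ?S - (\<lambda>z. (al z, er z, z \<inter> R)) ` Pow W"
      then obtain A B r where x: "x = (A, B, r)" "A \<subseteq> V \<times> T" by blast
      have "0 \<le> m (snd y)" if "y \<in> A" for y
        using subsetD[OF x(2) that] T(2) by (auto intro: less_imp_le)
      then have "0 \<le> ?f A" by (intro prod_nonneg)
      then show "0 \<le> (\<lambda>(A, B, r). ?f A * ?h B) x" by (simp add: x)
    qed
    also have "\<dots> = (\<Sum>A\<in>Pow (V \<times> T). ?f A) * ((\<Sum>B\<in>Pow (V \<times> {..<n}). ?h B) * 2 ^ card R)"
      using R(1) by (simp add: sum.cartesian_product[symmetric] sum_distrib_left[symmetric] sum_distrib_right[symmetric] card_Pow mult_ac)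
    finally have sum: "(\<Sum>z\<in>Pow W. exp (- c z))
      \<le> (\<Sum>A\<in>Pow (V \<times> T). ?f A) * ((\<Sum>B\<in>Pow (V \<times> {..<n}). ?h B) * 2 ^ card R)" .
    have f: "(\<Sum>A\<in>Pow (V \<times> T). ?f A) \<le> exp (card V)"
    proof -
      have "(\<Sum>A\<in>Pow (V \<times> T). ?f A) \<le> exp (\<Sum>x\<in>V \<times> T. m (snd x))"
      proof -
        have fin: "finite (V \<times> T)" using V T by simp
        have "0 \<le> m (snd x)" if "x \<in> V \<times> T" for x
          using that T(2) by (auto intro: less_imp_le)
        then show ?thesis unfolding sum_Pow_prod[OF fin] by (rule prod_one_plus_le_exp[OF fin])
      qed
      also have "(\<Sum>x\<in>V \<times> T. m (snd x)) = (\<Sum>v\<in>V. \<Sum>t\<in>T. m t)"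
        by (simp only: sum.cartesian_product case_prod_unfold)
      also have "\<dots> = card V * (\<Sum>t\<in>T. m t)" by (simp only: sum_constant)
      also have "exp \<dots> \<le> exp (card V)" using T(3) by (simp add: mult_left_le)
      finally show ?thesis .
    qed
    have h: "(\<Sum>B\<in>Pow (V \<times> {..<n}). ?h B) \<le> exp (card V)"
    proof -
      have "(\<Sum>B\<in>Pow (V \<times> {..<n}). ?h B) \<le> exp (\<Sum>b\<in>V \<times> {..<n}. 1 / real n)"
      proof -
        have fin: "finite (V \<times> {..<n})" using V by simp
        show ?thesis unfolding sum_Pow_prod[OF fin] by (rule prod_one_plus_le_exp[OF fin]) simp
      qed
      also have "(\<Sum>b\<in>V \<times> {..<n}. 1 / real n) = card V" using n by (simp add: card_cartesian_product)
      finally show ?thesis .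
    qed
    note sum
    also have "(\<Sum>A\<in>Pow (V \<times> T). ?f A) * ((\<Sum>B\<in>Pow (V \<times> {..<n}). ?h B) * 2 ^ card R)
      \<le> exp (card V) * (exp (card V) * 2 ^ card R)"
      by (intro mult_mono f h order_refl) (auto intro!: mult_nonneg_nonneg sum_nonneg prod_nonneg)
    also have "\<dots> = exp (2 * card V) * 2 ^ card R" by (simp flip: exp_add)
    finally show ?thesis .
  qed

  have "2 ^ card W * exp (- (card V * (K + 1))) \<le> exp (2 * card V) * 2 ^ card R"
    using order_trans[OF sum_exp_minus_ge[OF _ avg] upper] W by (simp add: card_Pow)
  then have "2 ^ (n * card V) * exp (- (card V * (K + 1))) \<le> exp (2 * card V)"
    unfolding R(2) power_add by (simp add: mult_ac)
  then have "2 ^ (n * card V) * exp (- (card V * (K + 1))) * exp (card V * (K + 1)) \<le> exp (2 * card V) * exp (card V * (K + 1))"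
    by (intro mult_right_mono) auto
  then have "2 ^ (n * card V) \<le> exp (2 * card V + card V * (K + 1))"
    by (simp add: mult.assoc exp_minus exp_add)
  then have "ln (2 ^ (n * card V)) \<le> ln (exp (2 * card V + card V * (K + 1)))"
    by (subst ln_le_cancel_iff) auto
  then have "card V * (n * ln 2) \<le> card V * (K + 3)"
    by (simp add: ln_realpow algebra_simps)
  then show ?thesis using V by (simp add: card_gt_0_iff)
qed

lemma itinerary_in_sets:
  assumes "finite F" "finite T" "\<And>t. t \<in> T \<Longrightarrow> C t \<in> sets coins"
  shows "{x. itinerary F T C x \<in> P} \<in> sets coins"
proof -
  have *: "{x. itinerary F T C x = S} \<in> sets coins" if "S \<subseteq> F \<times> T" for S
  proof -
    have "{x \<in> space coins. \<forall>y\<in>F \<times> T. (act (- fst y) x \<in> C (snd y)) = (y \<in> S)} \<in> sets coins"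
    proof (rule sets.sets_Collect_finite_All)
      fix y assume y: "y \<in> F \<times> T"
      then have "act (- fst y) -` C (snd y) \<in> sets coins"
        using assms by (auto intro: act_vimage_sets)
      then have "(if y \<in> S then act (- fst y) -` C (snd y) else space coins - act (- fst y) -` C (snd y)) \<in> sets coins"
        using sets.compl_sets[of "act (- fst y) -` C (snd y)" coins] by (cases "y \<in> S") simp_all
      also have "(if y \<in> S then act (- fst y) -` C (snd y) else space coins - act (- fst y) -` C (snd y))
        = {x \<in> space coins. (act (- fst y) x \<in> C (snd y)) = (y \<in> S)}"
        by auto
      finally show "{x \<in> space coins. (act (- fst y) x \<in> C (snd y)) = (y \<in> S)} \<in> sets coins" .
    next
      show "finite (F \<times> T)" using assms by simp
    qed
    moreover have "{x \<in> space coins. \<forall>y\<in>F \<times> T. (act (- fst y) x \<in> C (snd y)) = (y \<in> S)} = {x. itinerary F T C x = S}"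
      using that by (auto simp: itinerary_def)
    ultimately show ?thesis by simp
  qed
  have sub: "itinerary F T C x \<subseteq> F \<times> T" for x by (auto simp: itinerary_def)
  have "{x. itinerary F T C x \<in> P} = (\<Union>S\<in>Pow (F \<times> T) \<inter> P. {x. itinerary F T C x = S})"
    using sub by blast
  also have "\<dots> \<in> sets coins"
    using assms * by (intro sets.finite_UN) auto
  finally show ?thesis .
qed

text \<open>The members of \<open>\<A>\<close> are arbitrary measurable sets, while a finite model
  only sees finitely determined ones. A finite part \<open>T\<close> of \<open>\<A>\<close> is
  therefore replaced by nearby sets \<open>C\<close>, and for this \<open>model_bound\<close> keeps
  the weights \<open>m\<close> apart from the sets \<open>C\<close>. The replacement costs one more
  unit, which gives \<open>H + 4\<close> in all.\<close>

lemma no_finite_entropy: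
  fixes \<A> :: "'g config set set"
  assumes models: "\<And>E. finite E \<Longrightarrow> \<exists>(V :: 'v set) a p. free_model E V a p"
    and \<A>: "\<A> \<subseteq> sets coins" and pos: "\<And>A. A \<in> \<A> \<Longrightarrow> 0 < measure coins A"
    and le1: "\<And>T. finite T \<Longrightarrow> T \<subseteq> \<A> \<Longrightarrow> (\<Sum>A\<in>T. measure coins A) \<le> 1"
    and ent: "\<And>T. finite T \<Longrightarrow> T \<subseteq> \<A> \<Longrightarrow> (\<Sum>A\<in>T. - ln (measure coins A) * measure coins A) \<le> H"
    and gen: "\<And>j e. e > 0 \<Longrightarrow> \<exists>F T P. finite F \<and> finite T \<and> T \<subseteq> \<A> \<and>
       measure coins (sym_diff (bit j) {x. itinerary F T (\<lambda>A. A) x \<in> P}) < e"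
  shows False
proof -
  interpret prob_space "coins :: 'g config measure" by (rule prob_space_coins)
  obtain n0 :: nat where n0: "(H + 4) / ln 2 < n0" using reals_Archimedean2 by blast
  define n where "n = Suc n0"
  have "(H + 4) / ln 2 < n" using n0 by (simp add: n_def)
  then have n: "n \<ge> 1" "H + 4 < n * ln 2" by (simp_all add: n_def pos_divide_less_eq)
  \<comment> \<open>Half of the error \<open>1 / n ^ 2\<close> allowed per bit; the other half pays
    for the approximation of the classes. Over \<open>n\<close> bits at price \<open>ln n\<close>
    the total is at most \<open>ln n / n\<close>.\<close>
  have n2: "0 < 1 / (2 * real n ^ 2)" using n by simp
  obtain Fj Tj Pj where j: "\<And>j. finite (Fj j)" "\<And>j. finite (Tj j)" "\<And>j. Tj j \<subseteq> \<A>"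
    "\<And>j. measure coins (sym_diff (bit j) {x. itinerary (Fj j) (Tj j) (\<lambda>A. A) x \<in> Pj j}) < 1 / (2 * real n ^ 2)"
    using gen[OF n2] by metis
  define F where "F = (\<Union>j<n. Fj j)"
  define T where "T = (\<Union>j<n. Tj j)"
  \<comment> \<open>All bits share one \<open>F\<close> and one \<open>T\<close>; the decoder of bit
    \<open>j\<close> forgets the part of the name that it does not use.\<close>
  define P where "P j = {S. S \<inter> (Fj j \<times> Tj j) \<in> Pj j}" for j
  have F: "finite F" and T: "finite T" "T \<subseteq> \<A>" using j by (auto simp: F_def T_def)
  have TM: "A \<in> sets coins" if "A \<in> T" for A using that T \<A> by blast
  have it: "{x. itinerary (Fj j) (Tj j) C x \<in> Pj j} = {x. itinerary F T C x \<in> P j}" if "j < n" for j C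
  proof -
    have "itinerary F T C x \<inter> (Fj j \<times> Tj j) = itinerary (Fj j) (Tj j) C x" for x
      using that by (auto simp: itinerary_def F_def T_def)
    then show ?thesis by (simp add: P_def)
  qed
  define \<kappa> where "\<kappa> = (\<Sum>A\<in>T. - ln (measure coins A))"
  have \<kappa>0: "0 \<le> - ln (measure coins A)" if "A \<in> T" for A
    using pos[of A] that T prob_le_1[of A] by (auto simp: ln_le_zero_iff)
  have \<kappa>: "0 \<le> \<kappa>" unfolding \<kappa>_def by (intro sum_nonneg \<kappa>0)
  \<comment> \<open>The first summand keeps the \<open>card F * card T\<close> replacements inside a
    decoder below \<open>1 / (2 * n ^ 2)\<close>, the second keeps the additional cost
    \<open>\<kappa> / N\<close> of the names at most \<open>1\<close>; the \<open>+ 1\<close> makes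
    \<open>N\<close> positive.\<close>
  define N where "N = 2 * real n ^ 2 * (card F * card T + 1) + \<kappa>"
  have N: "0 < N" "2 * real n ^ 2 * (card F * card T) \<le> N" "\<kappa> \<le> N"
  proof -
    have "0 < 2 * real n ^ 2 * real (card F * card T + 1)"
      using n by (intro mult_pos_pos zero_less_power) (simp_all del: of_nat_add of_nat_mult)
    then show "0 < N" "\<kappa> \<le> N" using \<kappa> by (simp_all add: N_def)
    show "2 * real n ^ 2 * (card F * card T) \<le> N" using \<kappa> by (simp add: N_def distrib_left)
  qed
  have "\<exists>J C. finite J \<and> determined_by J C \<and> measure coins (sym_diff A C) < 1 / N" if "A \<in> T" for A
  proof -
    have "0 < 1 / N" using N(1) by simp
    from coins_approx[OF TM[OF that] this] show ?thesis by metis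
  qed
  then obtain J C where C: "\<And>A. A \<in> T \<Longrightarrow> finite (J A)" "\<And>A. A \<in> T \<Longrightarrow> determined_by (J A) (C A)"
    "\<And>A. A \<in> T \<Longrightarrow> measure coins (sym_diff A (C A)) < 1 / N"
    by metis
  have CM: "C A \<in> sets coins" if "A \<in> T" for A using C(1,2) that by (blast intro: determined_by_in_sets)
  define JJ where "JJ = (\<Union>A\<in>T. J A)"
  have JJ: "finite JJ" using C T by (auto simp: JJ_def)
  define E0 where "E0 = (\<lambda>i. fst (the i)) ` JJ"
  \<comment> \<open>\<open>E0\<close> holds the group elements read by the sets \<open>C A\<close>,
    and the translates by \<open>F\<close> those read by the decoders.\<close>
  define E where "E = insert 0 (E0 \<union> (\<Union>g\<in>F. (+) g ` E0))"
  define L where "L = n + Suc (Max (insert 0 ((\<lambda>i. snd (the i)) ` JJ)))"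
  have E: "finite E" "0 \<in> E" using JJ F by (auto simp: E_def E0_def)
  have L: "n \<le> L" by (simp add: L_def)
  have JE: "h \<in> E0" "k < L" if "Some (h, k) \<in> JJ" for h k
  proof -
    show "h \<in> E0" using that unfolding E0_def by force
    have "k \<in> insert 0 ((\<lambda>i. snd (the i)) ` JJ)" using that by force
    then have "k \<le> Max (insert 0 ((\<lambda>i. snd (the i)) ` JJ))" using JJ by (intro Max_ge) auto
    then show "k < L" by (simp add: L_def)
  qed
  let ?J = "insert None (Some ` (E \<times> {..<L}))"
  have detC: "determined_by ?J (C A)" if "A \<in> T" for A
  proof (rule determined_by_mono[OF C(2)[OF that]])
    show "J A \<subseteq> ?J"
    proof
      fix i assume "i \<in> J A"
      then have "i \<in> JJ" using that by (auto simp: JJ_def)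
      then show "i \<in> ?J" using JE by (cases i) (auto simp: E_def)
    qed
  qed
  let ?D = "\<lambda>j. {x. itinerary F T C x \<in> P j}"
  have detD: "determined_by ?J (?D j)" for j
  proof -
    have "itinerary F T C x = itinerary F T C y" if xy: "\<forall>i\<in>?J. x i = y i" for x y
    proof -
      have "act (- g) x \<in> C A \<longleftrightarrow> act (- g) y \<in> C A" if "g \<in> F" "A \<in> T" for g A
      proof (rule determined_byD[OF C(2)[OF \<open>A \<in> T\<close>]])
        fix i assume "i \<in> J A"
        then have i: "i \<in> JJ" using that by (auto simp: JJ_def)
        show "act (- g) x i = act (- g) y i"
        proof (cases i)
          case None
          then show ?thesis using xy by (simp add: act_None)
        next
          case (Some hk)
          obtain h k where hk: "hk = (h, k)" by (cases hk)
          have "Some (g + h, k) \<in> ?J" using JE[of h k] i \<open>g \<in> F\<close> by (auto simp: Some hk E_def)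
          then have "x (Some (g + h, k)) = y (Some (g + h, k))" using xy by blast
          then show ?thesis by (simp add: act_Some Some hk)
        qed
      qed
      then show ?thesis by (auto simp: itinerary_def)
    qed
    then show ?thesis unfolding determined_by_def by (metis mem_Collect_eq)
  qed
  have err: "measure coins (sym_diff (bit j) (?D j)) \<le> 1 / real n ^ 2" if "j < n" for j
  proof -
    let ?B = "{x. itinerary F T (\<lambda>A. A) x \<in> P j}"
    let ?X = "\<lambda>y. act (- fst y) -` (sym_diff (snd y) (C (snd y)))"
    have XM: "?X y \<in> sets coins" if "y \<in> F \<times> T" for y
      using that TM CM by (auto intro!: act_vimage_sets)
    have bitM: "bit j \<in> sets coins"
      by (rule determined_by_in_sets[of "{Some (0, j)}"]) (auto simp: determined_by_def)
    have D0M: "?B \<in> sets coins" using F T TM by (intro itinerary_in_sets) auto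
    have DM: "?D j \<in> sets coins" using F T CM by (intro itinerary_in_sets) auto
    have UM: "(\<Union>y\<in>F \<times> T. ?X y) \<in> sets coins" using F T XM by (intro sets.finite_UN) auto
    have "sym_diff ?B (?D j) \<subseteq> (\<Union>y\<in>F \<times> T. ?X y)"
    proof
      fix x assume "x \<in> sym_diff ?B (?D j)"
      then have "itinerary F T (\<lambda>A. A) x \<noteq> itinerary F T C x" by auto
      then obtain g A where "g \<in> F" "A \<in> T" "(act (- g) x \<in> A) \<noteq> (act (- g) x \<in> C A)"
        by (auto simp: itinerary_def)
      then show "x \<in> (\<Union>y\<in>F \<times> T. ?X y)" by (intro UN_I[of "(g, A)"]) auto
    qed
    then have "sym_diff (bit j) (?D j) \<subseteq> sym_diff (bit j) ?B \<union> (\<Union>y\<in>F \<times> T. ?X y)" by blast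
    then have "prob (sym_diff (bit j) (?D j)) \<le> prob (sym_diff (bit j) ?B \<union> (\<Union>y\<in>F \<times> T. ?X y))"
      using bitM D0M UM by (intro finite_measure_mono) auto
    also have "\<dots> \<le> prob (sym_diff (bit j) ?B) + prob (\<Union>y\<in>F \<times> T. ?X y)"
      using bitM D0M UM by (intro measure_Un_le) auto
    also have "prob (\<Union>y\<in>F \<times> T. ?X y) \<le> (\<Sum>y\<in>F \<times> T. prob (?X y))"
      using F T XM by (intro measure_UNION_le) auto
    also have "\<dots> \<le> (\<Sum>y\<in>F \<times> T. 1 / N)"
    proof (rule sum_mono)
      fix y assume y: "y \<in> F \<times> T"
      then have "sym_diff (snd y) (C (snd y)) \<in> sets coins" using TM CM by auto
      from measure_act_vimage[OF this, of "- fst y"]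
      show "prob (?X y) \<le> 1 / N" using C(3)[of "snd y"] y by auto
    qed
    also have "\<dots> = card F * card T / N" by (simp add: card_cartesian_product)
    also have "\<dots> \<le> 1 / (2 * real n ^ 2)" using N n by (simp add: field_simps)
    also have "prob (sym_diff (bit j) ?B) \<le> 1 / (2 * real n ^ 2)"
      using j(4)[of j] it[OF that] by (simp add: less_imp_le)
    finally show ?thesis by simp
  qed
  obtain V :: "'v set" and a p where model: "free_model (uminus ` E) V a p"
    using models[of "uminus ` E"] E by blast
  have "n * ln 2 \<le> (H + 1) + 3"
  proof (rule model_bound[OF model E n(1) L, where T = T and F = F and C = C and P = P and m = "measure coins"])
    show "finite T" by (rule T)
    show "0 < measure coins t" if "t \<in> T" for t using that pos T by blast
    show "(\<Sum>t\<in>T. measure coins t) \<le> 1" by (rule le1[OF T])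
    show "determined_by ?J (C t)" if "t \<in> T" for t by (rule detC[OF that])
    show "determined_by ?J (?D j)" if "j < n" for j by (rule detD)
    have "prob (C t) \<le> prob t + 1 / N" if "t \<in> T" for t
    proof -
      have "prob (C t) \<le> prob (t \<union> sym_diff t (C t))"
        using TM CM that by (intro finite_measure_mono) auto
      also have "\<dots> \<le> prob t + prob (sym_diff t (C t))"
        using TM CM that by (intro measure_Un_le) auto
      finally show ?thesis using C(3)[OF that] by linarith
    qed
    then have "(\<Sum>t\<in>T. - ln (prob t) * prob (C t)) \<le> (\<Sum>t\<in>T. - ln (prob t) * (prob t + 1 / N))"
      by (intro sum_mono mult_left_mono \<kappa>0) auto
    also have "\<dots> = (\<Sum>t\<in>T. - ln (prob t) * prob t) + \<kappa> * (1 / N)"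
      by (simp only: distrib_left sum.distrib \<kappa>_def sum_distrib_right)
    also have "\<dots> \<le> H + 1"
      using ent[OF T] N by (intro add_mono) (auto simp: field_simps)
    finally show "(\<Sum>t\<in>T. - ln (prob t) * prob (C t)) \<le> H + 1" .
    have "(\<Sum>j<n. prob (sym_diff (bit j) (?D j))) \<le> (\<Sum>j<n. 1 / real n ^ 2)"
      by (intro sum_mono err) simp
    also have "\<dots> = 1 / n" using n by (simp add: power2_eq_square)
    finally have "ln n * (\<Sum>j<n. prob (sym_diff (bit j) (?D j))) \<le> ln n * (1 / n)"
      using n by (intro mult_left_mono) auto
    also have "\<dots> \<le> n * (1 / n)"
      using n ln_le_minus_one[of "real n"] by (intro mult_right_mono) auto
    also have "\<dots> = 1" using n by simp
    finally show "ln n * (\<Sum>j<n. prob (sym_diff (bit j) (?D j))) \<le> 1" .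
  qed
  then show False using n(2) by simp
qed

end

section \<open>A spectral gap for affine maps of the discrete torus\<close>

definition unity :: "nat \<Rightarrow> int \<Rightarrow> complex" where
  "unity m k = cis (2 * pi * real_of_int k / real m)"

lemma unity_add: "unity m (j + k) = unity m j * unity m k"
  by (simp add: unity_def cis_mult add_divide_distrib distrib_left)

lemma unity_0 [simp]: "unity m 0 = 1"
  by (simp add: unity_def)

lemma cnj_unity: "cnj (unity m k) = unity m (- k)"
  by (simp add: unity_def cis_cnj)

lemma unity_power: "unity m k ^ n = unity m (int n * k)"
  by (induction n) (simp_all add: distrib_right unity_add)

lemma unity_eq_1_iff:
  assumes "m > 0"
  shows "unity m k = 1 \<longleftrightarrow> int m dvd k"
proof
  assume "unity m k = 1"
  then have "cos (2 * pi * real_of_int k / real m) = 1"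
    by (simp add: unity_def complex_eq_iff)
  then obtain n :: int where "2 * pi * real_of_int k / real m = real_of_int n * 2 * pi"
    by (auto simp: cos_one_2pi_int)
  then have "real_of_int k = real_of_int n * real m" using assms by (simp add: field_simps)
  then have "k = n * int m" by (metis of_int_eq_iff of_int_mult of_int_of_nat_eq)
  then show "int m dvd k" by simp
next
  assume "int m dvd k"
  then obtain n where "k = int m * n" by blast
  then have "2 * pi * real_of_int k / real m = 2 * pi * real_of_int n" using assms by simp
  then show "unity m k = 1" by (simp add: unity_def)
qed

lemma unity_periodic:
  assumes "m > 0" "j mod int m = k mod int m"
  shows "unity m j = unity m k"
proof -
  have "unity m j = unity m (j - k) * unity m k" by (simp flip: unity_add)
  also have "unity m (j - k) = 1" using assms by (simp add: unity_eq_1_iff mod_eq_dvd_iff)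
  finally show ?thesis by simp
qed

lemma sum_unity:
  assumes "m > 0"
  shows "(\<Sum>a\<in>{0..<int m}. unity m (a * k)) = (if int m dvd k then of_nat m else 0)"
proof -
  have "(\<Sum>a\<in>{0..<int m}. unity m (a * k)) = (\<Sum>a<m. unity m k ^ a)"
    by (rule sum.reindex_bij_witness[of _ int nat]) (auto simp: unity_power)
  also have "\<dots> = (if int m dvd k then of_nat m else 0)"
  proof (cases "int m dvd k")
    case True
    then have "unity m k = 1" using unity_eq_1_iff[OF assms] by simp
    then show ?thesis using True by simp
  next
    case False
    then have "unity m k \<noteq> 1" using unity_eq_1_iff[OF assms] by simp
    moreover have "unity m k ^ m = 1" using unity_eq_1_iff[OF assms] by (simp add: unity_power)
    ultimately show ?thesis using False by (simp add: sum_gp_strict)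
  qed
  finally show ?thesis .
qed

lemma parseval:
  fixes g :: "int \<Rightarrow> complex"
  assumes "m > 0"
  shows "(\<Sum>b\<in>{0..<int m}. (cmod (\<Sum>y\<in>{0..<int m}. g y * unity m (b * y)))\<^sup>2)
    = m * (\<Sum>y\<in>{0..<int m}. (cmod (g y))\<^sup>2)"
proof -
  let ?Z = "{0..<int m}"
  have "complex_of_real (\<Sum>b\<in>?Z. (cmod (\<Sum>y\<in>?Z. g y * unity m (b * y)))\<^sup>2)
    = (\<Sum>b\<in>?Z. \<Sum>y\<in>?Z. \<Sum>z\<in>?Z. g y * cnj (g z) * unity m (b * (y - z)))"
  proof -
    have "complex_of_real ((cmod (\<Sum>y\<in>?Z. g y * unity m (b * y)))\<^sup>2)
      = (\<Sum>y\<in>?Z. \<Sum>z\<in>?Z. g y * cnj (g z) * unity m (b * (y - z)))" for b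
    proof -
      have *: "unity m (b * (y - z)) = unity m (b * y) * cnj (unity m (b * z))" for y z
        by (simp add: cnj_unity right_diff_distrib flip: unity_add)
      show ?thesis
        unfolding complex_norm_square cnj_sum sum_product * complex_cnj_mult
        by (intro sum.cong refl) (simp only: mult_ac)
    qed
    then show ?thesis by (simp only: of_real_sum)
  qed
  also have "\<dots> = (\<Sum>y\<in>?Z. \<Sum>z\<in>?Z. \<Sum>b\<in>?Z. g y * cnj (g z) * unity m (b * (y - z)))"
    by (subst sum.swap) (intro sum.cong refl sum.swap)
  also have "\<dots> = (\<Sum>y\<in>?Z. \<Sum>z\<in>?Z. if y = z then of_nat m * (g y * cnj (g y)) else 0)"
  proof (rule sum.cong[OF refl], rule sum.cong[OF refl])
    fix y z assume yz: "y \<in> ?Z" "z \<in> ?Z"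
    have "int m dvd y - z \<longleftrightarrow> y = z"
    proof
      assume "int m dvd y - z"
      then have "y mod int m = z mod int m" by (simp add: mod_eq_dvd_iff)
      then show "y = z" using yz by simp
    qed simp
    then show "(\<Sum>b\<in>?Z. g y * cnj (g z) * unity m (b * (y - z))) = (if y = z then of_nat m * (g y * cnj (g y)) else 0)"
      using sum_unity[OF assms, of "y - z"] by (simp flip: sum_distrib_left)
  qed
  also have "\<dots> = (\<Sum>y\<in>?Z. of_nat m * (g y * cnj (g y)))"
    by simp
  also have "\<dots> = complex_of_real (m * (\<Sum>y\<in>?Z. (cmod (g y))\<^sup>2))"
    by (simp only: complex_norm_square sum_distrib_left of_real_mult of_real_sum of_real_of_nat_eq)
  finally show ?thesis using of_real_eq_iff by blast
qed

definition fourier :: "nat \<Rightarrow> (int \<Rightarrow> int \<Rightarrow> complex) \<Rightarrow> int \<Rightarrow> int \<Rightarrow> complex" where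
  "fourier m g a b = (\<Sum>x\<in>{0..<int m}. \<Sum>y\<in>{0..<int m}. g x y * unity m (a * x + b * y))"

text \<open>Functions on the torus are kept as functions of integers, so that shears and shifts need
  no reduction; sums run over the fundamental domain.\<close>

definition periodic :: "nat \<Rightarrow> (int \<Rightarrow> int \<Rightarrow> 'b) \<Rightarrow> bool" where
  "periodic m g \<longleftrightarrow> (\<forall>x y. g (x mod int m) y = g x y \<and> g x (y mod int m) = g x y)"

lemma parseval2:
  assumes "m > 0"
  shows "(\<Sum>a\<in>{0..<int m}. \<Sum>b\<in>{0..<int m}. (cmod (fourier m g a b))\<^sup>2)
    = real m ^ 2 * (\<Sum>x\<in>{0..<int m}. \<Sum>y\<in>{0..<int m}. (cmod (g x y))\<^sup>2)"
proof -
  let ?Z = "{0..<int m}"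
  have F: "fourier m g a b = (\<Sum>y\<in>?Z. (\<Sum>x\<in>?Z. g x y * unity m (a * x)) * unity m (b * y))" for a b
    unfolding fourier_def by (subst sum.swap) (simp add: unity_add sum_distrib_right mult.assoc)
  have "(\<Sum>a\<in>?Z. \<Sum>b\<in>?Z. (cmod (fourier m g a b))\<^sup>2)
    = (\<Sum>a\<in>?Z. m * (\<Sum>y\<in>?Z. (cmod (\<Sum>x\<in>?Z. g x y * unity m (a * x)))\<^sup>2))"
    unfolding F by (intro sum.cong refl parseval assms)
  also have "\<dots> = m * (\<Sum>y\<in>?Z. \<Sum>a\<in>?Z. (cmod (\<Sum>x\<in>?Z. g x y * unity m (a * x)))\<^sup>2)"
    by (subst sum.swap) (simp only: sum_distrib_left)
  also have "\<dots> = m * (\<Sum>y\<in>?Z. m * (\<Sum>x\<in>?Z. (cmod (g x y))\<^sup>2))"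
    by (simp only: parseval[OF assms])
  also have "\<dots> = real m ^ 2 * (\<Sum>x\<in>?Z. \<Sum>y\<in>?Z. (cmod (g x y))\<^sup>2)"
    by (subst sum.swap) (simp add: sum_distrib_left power2_eq_square mult.assoc)
  finally show ?thesis .
qed

lemma sum_shift_periodic:
  fixes g :: "int \<Rightarrow> 'b::comm_monoid_add"
  assumes "m > 0" "\<And>x. g (x mod int m) = g x"
  shows "(\<Sum>x\<in>{0..<int m}. g (x + c)) = (\<Sum>x\<in>{0..<int m}. g x)"
proof -
  have "(\<Sum>x\<in>{0..<int m}. g (x + c)) = (\<Sum>x\<in>{0..<int m}. g ((x + c) mod int m))"
    by (simp add: assms(2))
  also have "\<dots> = (\<Sum>x\<in>{0..<int m}. g x)"
    by (rule sum.reindex_bij_witness[of _ "\<lambda>x. (x - c) mod int m" "\<lambda>x. (x + c) mod int m"])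
       (use assms(1) in \<open>auto simp: mod_simps\<close>)
  finally show ?thesis .
qed

lemma unity_mod:
  assumes "m > 0"
  shows "unity m (a * (x mod int m) + t) = unity m (a * x + t)" "unity m (t + a * (x mod int m)) = unity m (t + a * x)"
    "unity m ((x mod int m) * a + t) = unity m (x * a + t)" "unity m (t + (x mod int m) * a) = unity m (t + x * a)"
proof -
  have dvd: "int m dvd x mod int m - x" by (simp flip: mod_eq_dvd_iff)
  have 1: "(a * (x mod int m) + t) mod int m = (a * x + t) mod int m"
    unfolding mod_eq_dvd_iff using dvd_mult[OF dvd, of a] by (simp add: algebra_simps)
  show "unity m (a * (x mod int m) + t) = unity m (a * x + t)" "unity m (t + a * (x mod int m)) = unity m (t + a * x)"
    "unity m ((x mod int m) * a + t) = unity m (x * a + t)" "unity m (t + (x mod int m) * a) = unity m (t + x * a)"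
    using unity_periodic[OF assms 1] by (simp_all only: mult.commute add.commute)
qed

lemma fourier_periodic: "m > 0 \<Longrightarrow> periodic m (fourier m g)"
  by (simp add: periodic_def fourier_def unity_mod)

text \<open>For fixed \<open>y\<close> the substitution shifts the sum over \<open>x\<close>. One
  formula covers translations (\<open>c = 0\<close>), which become phases, and shears
  (\<open>d = 0\<close>), which become dual shears of the frequencies.\<close>

lemma fourier_shear1:
  assumes "m > 0" "periodic m g"
  shows "fourier m (\<lambda>x y. g (x + c * y + d) y) a b = unity m (- a * d) * fourier m g a (b - c * a)"
proof -
  let ?Z = "{0..<int m}"
  have "fourier m (\<lambda>x y. g (x + c * y + d) y) a b
    = (\<Sum>y\<in>?Z. \<Sum>x\<in>?Z. (\<lambda>x. g x y * (unity m (- a * d) * unity m (a * x + (b - c * a) * y))) (x + (c * y + d)))"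
    unfolding fourier_def by (subst sum.swap) (simp add: algebra_simps flip: unity_add)
  also have "\<dots> = (\<Sum>y\<in>?Z. \<Sum>x\<in>?Z. g x y * (unity m (- a * d) * unity m (a * x + (b - c * a) * y)))"
    using assms by (intro sum.cong refl sum_shift_periodic) (auto simp: unity_mod periodic_def)
  also have "\<dots> = unity m (- a * d) * fourier m g a (b - c * a)"
    unfolding fourier_def by (subst sum.swap) (simp add: sum_distrib_left mult_ac)
  finally show ?thesis .
qed

lemma fourier_shear2:
  assumes "m > 0" "periodic m g"
  shows "fourier m (\<lambda>x y. g x (y + c * x + d)) a b = unity m (- b * d) * fourier m g (a - c * b) b"
proof -
  let ?Z = "{0..<int m}"
  have "fourier m (\<lambda>x y. g x (y + c * x + d)) a b
    = (\<Sum>x\<in>?Z. \<Sum>y\<in>?Z. (\<lambda>y. g x y * (unity m (- b * d) * unity m ((a - c * b) * x + b * y))) (y + (c * x + d)))"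
    unfolding fourier_def by (simp add: algebra_simps flip: unity_add)
  also have "\<dots> = (\<Sum>x\<in>?Z. \<Sum>y\<in>?Z. g x y * (unity m (- b * d) * unity m ((a - c * b) * x + b * y)))"
    using assms by (intro sum.cong refl sum_shift_periodic) (auto simp: unity_mod periodic_def)
  also have "\<dots> = unity m (- b * d) * fourier m g (a - c * b) b"
    unfolding fourier_def by (simp add: sum_distrib_left mult_ac)
  finally show ?thesis .
qed

text \<open>From \<open>2 s t \<le> s\<^sup>2 / 2 + 2 t\<^sup>2\<close>. What matters is a leading
  factor below 2: it has to lose against the doubling of mass in
  \<open>shear_doubles\<close>.\<close>

lemma norm_sq_le_perturb:
  fixes x y :: complex
  shows "(cmod x)\<^sup>2 \<le> 3/2 * (cmod y)\<^sup>2 + 3 * (cmod (x - y))\<^sup>2"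
proof -
  have "(cmod x)\<^sup>2 \<le> (cmod y + cmod (x - y))\<^sup>2"
    using norm_triangle_ineq[of y "x - y"] by (intro power_mono) auto
  moreover have "0 \<le> (cmod y - 2 * cmod (x - y))\<^sup>2" by simp
  ultimately show ?thesis by (simp add: power2_eq_square algebra_simps)
qed

text \<open>
  In the coordinates \<open>\<alpha>, \<beta>\<close> the map \<open>t\<close> acts near the origin as the shear
  \<open>(\<alpha>, \<beta>) \<mapsto> (\<alpha>, \<beta> - 2\<alpha>)\<close>. It and its inverse send the sector \<open>\<bar>\<beta>\<bar> < \<bar>\<alpha>\<bar>\<close> to disjoint
  parts of the sector \<open>\<bar>\<alpha>\<bar> < \<bar>\<beta>\<bar>\<close>.
\<close>

lemma shear_doubles:
  fixes \<nu> :: "'x \<Rightarrow> real" and \<alpha> \<beta> :: "'x \<Rightarrow> int" and m :: int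
  assumes X: "finite X" and t: "bij_betw t X X" and \<nu>: "\<And>p. p \<in> X \<Longrightarrow> 0 \<le> \<nu> p"
    and quasi: "\<And>A. A \<subseteq> X \<Longrightarrow> sum \<nu> A \<le> 3/2 * sum \<nu> (t ` A) + c"
      "\<And>A. A \<subseteq> X \<Longrightarrow> sum \<nu> (t ` A) \<le> 3/2 * sum \<nu> A + c"
  defines "P \<equiv> {p \<in> X. 3 * \<bar>\<alpha> p\<bar> < m \<and> 3 * \<bar>\<beta> p\<bar> < m \<and> \<bar>\<beta> p\<bar> < \<bar>\<alpha> p\<bar>}"
  assumes fwd: "\<And>p. p \<in> P \<Longrightarrow> \<alpha> (t p) = \<alpha> p \<and> \<beta> (t p) = \<beta> p - 2 * \<alpha> p"
    and bwd: "\<And>p. p \<in> X \<Longrightarrow> t p \<in> P \<Longrightarrow> \<alpha> p = \<alpha> (t p) \<and> \<beta> p = \<beta> (t p) + 2 * \<alpha> (t p)"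
  shows "2 * sum \<nu> P \<le> 3/2 * sum \<nu> {p \<in> X. \<bar>\<alpha> p\<bar> < \<bar>\<beta> p\<bar>} + 2 * c"
proof -
  have PX: "P \<subseteq> X" by (auto simp: P_def)
  let ?Q = "{p \<in> X. \<bar>\<alpha> p\<bar> < \<bar>\<beta> p\<bar>}"
  let ?A = "t ` P" and ?B = "{p \<in> X. t p \<in> P}"
  have tX: "t p \<in> X" if "p \<in> X" for p using t that by (auto simp: bij_betw_def)
  have P: "\<bar>\<beta> p\<bar> < \<bar>\<alpha> p\<bar>" if "p \<in> P" for p using that by (simp add: P_def)
  have tB: "t ` ?B = P" using t PX by (auto simp: bij_betw_def)
  \<comment> \<open>The sign of \<open>\<alpha> * \<beta>\<close> is what separates the image from
    the preimage of the sector.\<close>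
  have A: "p \<in> ?Q \<and> \<alpha> p * \<beta> p < 0" if "p \<in> ?A" for p
  proof -
    from that obtain q where q: "q \<in> P" "p = t q" by blast
    then have eq: "\<alpha> p = \<alpha> q" "\<beta> p = \<beta> q - 2 * \<alpha> q" using fwd by auto
    have lt: "\<bar>\<beta> q\<bar> < \<bar>\<alpha> q\<bar>" using P q by blast
    then have "\<alpha> p * \<beta> p < 0" unfolding eq
      by (cases "\<alpha> q > 0") (auto simp: mult_less_0_iff)
    moreover have "p \<in> X" using q PX tX by blast
    ultimately show ?thesis using lt eq by auto
  qed
  have B: "p \<in> ?Q \<and> \<alpha> p * \<beta> p > 0" if "p \<in> ?B" for p
  proof -
    have eq: "\<alpha> p = \<alpha> (t p)" "\<beta> p = \<beta> (t p) + 2 * \<alpha> (t p)" using that bwd by auto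
    have lt: "\<bar>\<beta> (t p)\<bar> < \<bar>\<alpha> (t p)\<bar>" using P that by blast
    then have "\<alpha> p * \<beta> p > 0" unfolding eq
      by (cases "\<alpha> (t p) > 0") (auto simp: zero_less_mult_iff)
    then show ?thesis using lt eq that by auto
  qed
  have "sum \<nu> ?A + sum \<nu> ?B = sum \<nu> (?A \<union> ?B)"
    using X PX A B by (intro sum.union_disjoint[symmetric]) (auto intro: finite_subset dest: finite_subset, fastforce)
  also have "\<dots> \<le> sum \<nu> ?Q"
    using X A B \<nu> by (intro sum_mono2) auto
  finally have "sum \<nu> ?A + sum \<nu> ?B \<le> sum \<nu> ?Q" .
  moreover have "sum \<nu> P \<le> 3/2 * sum \<nu> ?A + c" using quasi(1)[OF PX] .
  moreover have "sum \<nu> P \<le> 3/2 * sum \<nu> ?B + c" using quasi(2)[of ?B] tB by auto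
  ultimately show ?thesis by linarith
qed

text \<open>\<open>S\<close> lists the linear parts of the vertices, which the shears permute by
  \<open>\<rho>1\<close> and \<open>\<rho>2\<close> while they move the torus. Summing the Fourier
  mass over \<open>S\<close> removes these permutations and leaves one measure on the frequencies of
  a single torus. The translations bound its mass far from \<open>(m / 2, 0)\<close>; the shears
  compare the two sectors near that point.\<close>

lemma no_odd_model:
  fixes m :: nat and S :: "'s set" and f :: "int \<Rightarrow> int \<Rightarrow> 's \<Rightarrow> real" and \<delta> :: real
  defines "Z \<equiv> {0..<int m}"
  defines "N \<equiv> real m ^ 2 * card S"
  assumes m: "odd m" and S: "finite S" "S \<noteq> {}"
    and \<rho>: "bij_betw \<rho>1 S S" "bij_betw \<rho>2 S S"
    and f: "\<And>q. q \<in> S \<Longrightarrow> periodic m (\<lambda>x y. f x y q)" "\<And>x y q. \<bar>f x y q\<bar> = 1"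
    and h1: "(\<Sum>q\<in>S. \<Sum>x\<in>Z. \<Sum>y\<in>Z. (f (x + 1) y q + f x y q)\<^sup>2) \<le> \<delta> * N"
    and h2: "(\<Sum>q\<in>S. \<Sum>x\<in>Z. \<Sum>y\<in>Z. (f x (y + 1) q - f x y q)\<^sup>2) \<le> \<delta> * N"
    and h3: "(\<Sum>q\<in>S. \<Sum>x\<in>Z. \<Sum>y\<in>Z. (f (x + 2 * y) y (\<rho>1 q) - f x y q)\<^sup>2) \<le> \<delta> * N"
    and h4: "(\<Sum>q\<in>S. \<Sum>x\<in>Z. \<Sum>y\<in>Z. (f x (y + 2 * x) (\<rho>2 q) - f x y q)\<^sup>2) \<le> \<delta> * N"
  shows "1 / 40 \<le> \<delta>"
proof -
  have m0: "m > 0" using m by (rule odd_pos)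
  define F where "F q = fourier m (\<lambda>x y. complex_of_real (f x y q))" for q
  define \<nu> where "\<nu> p = (\<Sum>q\<in>S. (cmod (F q (fst p) (snd p)))\<^sup>2)" for p
  define tot where "tot = real m ^ 2 * N"
  have tot: "0 < tot" using S m0 by (simp add: tot_def N_def card_gt_0_iff)
  have per: "periodic m (\<lambda>x y. complex_of_real (f x y q))" if "q \<in> S" for q
    using f(1)[OF that] by (simp add: periodic_def)
  have pars: "(\<Sum>p\<in>Z \<times> Z. \<Sum>q\<in>S. (cmod (fourier m (\<lambda>x y. complex_of_real (g q x y)) (fst p) (snd p)))\<^sup>2)
      = real m ^ 2 * (\<Sum>q\<in>S. \<Sum>x\<in>Z. \<Sum>y\<in>Z. (g q x y)\<^sup>2)" for g :: "'s \<Rightarrow> int \<Rightarrow> int \<Rightarrow> real"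
  proof -
    have "(\<Sum>p\<in>Z \<times> Z. \<Sum>q\<in>S. (cmod (fourier m (\<lambda>x y. complex_of_real (g q x y)) (fst p) (snd p)))\<^sup>2)
      = (\<Sum>q\<in>S. \<Sum>a\<in>Z. \<Sum>b\<in>Z. (cmod (fourier m (\<lambda>x y. complex_of_real (g q x y)) a b))\<^sup>2)"
      by (subst sum.swap) (simp only: sum.cartesian_product case_prod_unfold)
    also have "\<dots> = (\<Sum>q\<in>S. real m ^ 2 * (\<Sum>x\<in>Z. \<Sum>y\<in>Z. (cmod (complex_of_real (g q x y)))\<^sup>2))"
      unfolding Z_def by (intro sum.cong refl parseval2 m0)
    finally show ?thesis by (simp add: sum_distrib_left)
  qed
  have lin: "fourier m (\<lambda>x y. complex_of_real (u x y + s * v x y)) a b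
      = fourier m (\<lambda>x y. complex_of_real (u x y)) a b + s * fourier m (\<lambda>x y. complex_of_real (v x y)) a b"
    for u v :: "int \<Rightarrow> int \<Rightarrow> real" and s :: real and a b
    by (simp add: fourier_def distrib_right sum.distrib sum_distrib_left mult.assoc)
  have total: "sum \<nu> (Z \<times> Z) = tot"
  proof -
    have "sum \<nu> (Z \<times> Z) = real m ^ 2 * (\<Sum>q\<in>S. \<Sum>x\<in>Z. \<Sum>y\<in>Z. (f x y q)\<^sup>2)"
      unfolding \<nu>_def F_def by (rule pars)
    also have "(\<Sum>q\<in>S. \<Sum>x\<in>Z. \<Sum>y\<in>Z. (f x y q)\<^sup>2) = (\<Sum>q\<in>S. \<Sum>x\<in>Z. \<Sum>y\<in>Z. 1)"
      using f(2) by (intro sum.cong refl) (metis one_power2 power2_abs)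
    also have "\<dots> = N" by (simp add: Z_def N_def power2_eq_square)
    finally show ?thesis by (simp add: tot_def)
  qed
  have \<nu>0: "0 \<le> \<nu> p" for p by (simp add: \<nu>_def sum_nonneg)
  have per_\<nu>: "\<nu> (a mod int m, b) = \<nu> (a, b)" "\<nu> (a, b mod int m) = \<nu> (a, b)" for a b
    using fourier_periodic[OF m0] by (simp_all add: \<nu>_def F_def periodic_def)

  have e1: "(\<Sum>p\<in>Z \<times> Z. (cmod (unity m (- fst p) + 1))\<^sup>2 * \<nu> p) \<le> \<delta> * tot"
  proof -
    have eq: "fourier m (\<lambda>x y. complex_of_real (f (x + 1) y q + 1 * f x y q)) a b = (unity m (- a) + 1) * F q a b"
      if "q \<in> S" for q a b
      using fourier_shear1[OF m0 per[OF that], of 0 1 a b]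
      unfolding lin F_def by (simp add: distrib_right)
    have "(\<Sum>p\<in>Z \<times> Z. (cmod (unity m (- fst p) + 1))\<^sup>2 * \<nu> p)
      = (\<Sum>p\<in>Z \<times> Z. \<Sum>q\<in>S. (cmod (fourier m (\<lambda>x y. complex_of_real (f (x + 1) y q + 1 * f x y q)) (fst p) (snd p)))\<^sup>2)"
      unfolding \<nu>_def sum_distrib_left
      by (intro sum.cong refl) (simp only: eq norm_mult power_mult_distrib)
    also have "\<dots> \<le> real m ^ 2 * (\<delta> * N)"
      unfolding pars using h1 by (intro mult_left_mono) auto
    finally show ?thesis by (simp add: tot_def mult_ac)
  qed
  have e2: "(\<Sum>p\<in>Z \<times> Z. (cmod (unity m (- snd p) - 1))\<^sup>2 * \<nu> p) \<le> \<delta> * tot"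
  proof -
    have eq: "fourier m (\<lambda>x y. complex_of_real (f x (y + 1) q + (- 1) * f x y q)) a b = (unity m (- b) - 1) * F q a b"
      if "q \<in> S" for q a b
      using fourier_shear2[OF m0 per[OF that], of 0 1 a b]
      unfolding lin F_def by (simp add: left_diff_distrib)
    have "(\<Sum>p\<in>Z \<times> Z. (cmod (unity m (- snd p) - 1))\<^sup>2 * \<nu> p)
      = (\<Sum>p\<in>Z \<times> Z. \<Sum>q\<in>S. (cmod (fourier m (\<lambda>x y. complex_of_real (f x (y + 1) q + (- 1) * f x y q)) (fst p) (snd p)))\<^sup>2)"
      unfolding \<nu>_def sum_distrib_left
      by (intro sum.cong refl) (simp only: eq norm_mult power_mult_distrib)
    also have "\<dots> \<le> real m ^ 2 * (\<delta> * N)"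
      unfolding pars using h2 by (intro mult_left_mono) auto
    finally show ?thesis by (simp add: tot_def mult_ac)
  qed

  \<comment> \<open>\<open>r\<close> is the integral shear and \<open>t\<close> its reduction to the
    fundamental domain; \<open>\<nu>\<close> is periodic and does not tell them apart. Reindexing
    along \<open>\<rho>\<close> turns the coefficients of \<open>\<rho> q\<close> back into the full
    mass.\<close>
  have quasi: "sum \<nu> A \<le> 3/2 * sum \<nu> (t ` A) + 3 * \<delta> * tot" "sum \<nu> (t ` A) \<le> 3/2 * sum \<nu> A + 3 * \<delta> * tot"
    if A: "A \<subseteq> Z \<times> Z" and inj: "inj_on t (Z \<times> Z)" and \<rho>: "bij_betw \<rho> S S"
      and t: "\<And>p. \<nu> (t p) = \<nu> (r p)"
      and d: "(\<Sum>p\<in>Z \<times> Z. \<Sum>q\<in>S. (cmod (F (\<rho> q) (fst (r p)) (snd (r p)) - F q (fst p) (snd p)))\<^sup>2) \<le> \<delta> * tot"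
    for A t \<rho> r
  proof -
    have fin: "finite A" using A by (rule finite_subset) (simp add: Z_def)
    let ?x = "\<lambda>p q. F (\<rho> q) (fst (r p)) (snd (r p))" and ?y = "\<lambda>p q. F q (fst p) (snd p)"
    have "(\<Sum>p\<in>A. \<Sum>q\<in>S. (cmod (?x p q - ?y p q))\<^sup>2) \<le> (\<Sum>p\<in>Z \<times> Z. \<Sum>q\<in>S. (cmod (?x p q - ?y p q))\<^sup>2)"
      using A by (intro sum_mono2) (auto simp: Z_def intro!: sum_nonneg)
    with d have d': "(\<Sum>p\<in>A. \<Sum>q\<in>S. (cmod (?x p q - ?y p q))\<^sup>2) \<le> \<delta> * tot" by linarith
    have x: "sum \<nu> (t ` A) = (\<Sum>p\<in>A. \<Sum>q\<in>S. (cmod (?x p q))\<^sup>2)"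
    proof -
      have "sum \<nu> (t ` A) = (\<Sum>p\<in>A. \<nu> (r p))"
        using inj_on_subset[OF inj A] by (subst sum.reindex) (auto simp: t)
      also have "\<dots> = (\<Sum>p\<in>A. \<Sum>q\<in>S. (cmod (?x p q))\<^sup>2)"
      proof (rule sum.cong[OF refl])
        show "\<nu> (r p) = (\<Sum>q\<in>S. (cmod (?x p q))\<^sup>2)" for p
          unfolding \<nu>_def
          by (rule sum.reindex_bij_betw[OF \<rho>, of "\<lambda>q. (cmod (F q (fst (r p)) (snd (r p))))\<^sup>2", symmetric])
      qed
      finally show ?thesis .
    qed
    have y: "sum \<nu> A = (\<Sum>p\<in>A. \<Sum>q\<in>S. (cmod (?y p q))\<^sup>2)" by (simp add: \<nu>_def)
    have "sum \<nu> A \<le> (\<Sum>p\<in>A. \<Sum>q\<in>S. 3/2 * (cmod (?x p q))\<^sup>2 + 3 * (cmod (?x p q - ?y p q))\<^sup>2)"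
      unfolding y using norm_sq_le_perturb by (intro sum_mono) (metis norm_minus_commute)
    then show "sum \<nu> A \<le> 3/2 * sum \<nu> (t ` A) + 3 * \<delta> * tot"
      using d' unfolding x sum.distrib sum_distrib_left[symmetric] by linarith
    have "sum \<nu> (t ` A) \<le> (\<Sum>p\<in>A. \<Sum>q\<in>S. 3/2 * (cmod (?y p q))\<^sup>2 + 3 * (cmod (?x p q - ?y p q))\<^sup>2)"
      unfolding x using norm_sq_le_perturb by (intro sum_mono)
    then show "sum \<nu> (t ` A) \<le> 3/2 * sum \<nu> A + 3 * \<delta> * tot"
      using d' unfolding y sum.distrib sum_distrib_left[symmetric] by linarith
  qed

  define t1 where "t1 p = (fst p, (snd p - 2 * fst p) mod int m)" for p :: "int \<times> int"
  define t2 where "t2 p = ((fst p - 2 * snd p) mod int m, snd p)" for p :: "int \<times> int"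
  have inj_mod: "a = b" if "a \<in> Z" "b \<in> Z" "(a - c) mod int m = (b - c) mod int m" for a b c
  proof -
    have "a mod int m = b mod int m" using that(3) by (metis diff_add_cancel mod_add_left_eq)
    then show ?thesis using that by (simp add: Z_def)
  qed
  have t1: "bij_betw t1 (Z \<times> Z) (Z \<times> Z)" and t2: "bij_betw t2 (Z \<times> Z) (Z \<times> Z)"
  proof -
    have "inj_on t1 (Z \<times> Z)" "inj_on t2 (Z \<times> Z)"
      by (auto intro!: inj_onI simp: t1_def t2_def dest: inj_mod)
    moreover have "t1 ` (Z \<times> Z) \<subseteq> Z \<times> Z" "t2 ` (Z \<times> Z) \<subseteq> Z \<times> Z"
      using m0 by (auto simp: t1_def t2_def Z_def)
    ultimately show "bij_betw t1 (Z \<times> Z) (Z \<times> Z)" "bij_betw t2 (Z \<times> Z) (Z \<times> Z)"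
      unfolding bij_betw_def by (simp_all add: endo_inj_surj Z_def)
  qed
  have \<nu>t1: "\<nu> (t1 p) = \<nu> (fst p, snd p - 2 * fst p)" and \<nu>t2: "\<nu> (t2 p) = \<nu> (fst p - 2 * snd p, snd p)" for p
    by (simp_all add: t1_def t2_def per_\<nu>)
  have d3: "(\<Sum>p\<in>Z \<times> Z. \<Sum>q\<in>S. (cmod (F (\<rho>1 q) (fst p) (snd p - 2 * fst p) - F q (fst p) (snd p)))\<^sup>2) \<le> \<delta> * tot"
  proof -
    have eq: "fourier m (\<lambda>x y. complex_of_real (f (x + 2 * y) y (\<rho>1 q) + (- 1) * f x y q)) a b = F (\<rho>1 q) a (b - 2 * a) - F q a b"
      if "q \<in> S" for q a b
    proof -
      have "\<rho>1 q \<in> S" using \<rho>(1) that by (auto simp: bij_betw_def)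
      from fourier_shear1[OF m0 per[OF this], of 2 0 a b] show ?thesis
        unfolding lin F_def by simp
    qed
    have "(\<Sum>p\<in>Z \<times> Z. \<Sum>q\<in>S. (cmod (F (\<rho>1 q) (fst p) (snd p - 2 * fst p) - F q (fst p) (snd p)))\<^sup>2)
      = (\<Sum>p\<in>Z \<times> Z. \<Sum>q\<in>S. (cmod (fourier m (\<lambda>x y. complex_of_real (f (x + 2 * y) y (\<rho>1 q) + (- 1) * f x y q)) (fst p) (snd p)))\<^sup>2)"
      by (intro sum.cong refl) (simp only: eq)
    also have "\<dots> \<le> real m ^ 2 * (\<delta> * N)"
      unfolding pars using h3 by (intro mult_left_mono) auto
    finally show ?thesis by (simp add: tot_def mult_ac)
  qed
  have d4: "(\<Sum>p\<in>Z \<times> Z. \<Sum>q\<in>S. (cmod (F (\<rho>2 q) (fst p - 2 * snd p) (snd p) - F q (fst p) (snd p)))\<^sup>2) \<le> \<delta> * tot"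
  proof -
    have eq: "fourier m (\<lambda>x y. complex_of_real (f x (y + 2 * x) (\<rho>2 q) + (- 1) * f x y q)) a b = F (\<rho>2 q) (a - 2 * b) b - F q a b"
      if "q \<in> S" for q a b
    proof -
      have "\<rho>2 q \<in> S" using \<rho>(2) that by (auto simp: bij_betw_def)
      from fourier_shear2[OF m0 per[OF this], of 2 0 a b] show ?thesis
        unfolding lin F_def by simp
    qed
    have "(\<Sum>p\<in>Z \<times> Z. \<Sum>q\<in>S. (cmod (F (\<rho>2 q) (fst p - 2 * snd p) (snd p) - F q (fst p) (snd p)))\<^sup>2)
      = (\<Sum>p\<in>Z \<times> Z. \<Sum>q\<in>S. (cmod (fourier m (\<lambda>x y. complex_of_real (f x (y + 2 * x) (\<rho>2 q) + (- 1) * f x y q)) (fst p) (snd p)))\<^sup>2)"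
      by (intro sum.cong refl) (simp only: eq)
    also have "\<dots> \<le> real m ^ 2 * (\<delta> * N)"
      unfolding pars using h4 by (intro mult_left_mono) auto
    finally show ?thesis by (simp add: tot_def mult_ac)
  qed

  text \<open>
    Twice the offset of a frequency from \<open>(m/2, 0)\<close>: the first coordinate is odd and the second even,
    so the two never have the same absolute value.
  \<close>
  define \<alpha> where "\<alpha> p = 2 * fst p - int m" for p :: "int \<times> int"
  define \<beta> where "\<beta> p = (if 2 * snd p < int m then 2 * snd p else 2 * snd p - 2 * int m)" for p :: "int \<times> int"
  have \<alpha>: "odd (\<alpha> p)" and \<beta>: "even (\<beta> p)" for p using m by (auto simp: \<alpha>_def \<beta>_def)
  have neq: "\<bar>\<alpha> p\<bar> \<noteq> \<bar>\<beta> p\<bar>" for p using \<alpha>[of p] \<beta>[of p] by (metis dvd_abs_iff)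
  have \<alpha>_range: "- int m \<le> \<alpha> p" "\<alpha> p < int m" if "p \<in> Z \<times> Z" for p
    using that by (auto simp: \<alpha>_def Z_def)
  have \<beta>_range: "- int m \<le> \<beta> p" "\<beta> p < int m" if "p \<in> Z \<times> Z" for p
    using that by (auto simp: \<beta>_def Z_def)
  \<comment> \<open>Turns a congruence modulo \<open>2 * m\<close> between doubled offsets into an
    equality, as long as the shear does not wrap around.\<close>
  have uniq: "s = t" if "- int m \<le> s" "s < int m" "\<bar>t\<bar> < int m" "2 * int m dvd s - t" for s t :: int
  proof -
    have "\<bar>s - t\<bar> < 2 * int m" using that by linarith
    then show ?thesis using that(4) by (metis dvd_imp_le_int eq_iff_diff_eq_0 not_less abs_of_nat abs_mult abs_numeral)
  qed
  have dvd_\<beta>: "2 * int m dvd \<beta> p - 2 * snd p" for p by (simp add: \<beta>_def)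
  have dvd_mod: "2 * int m dvd 2 * (x mod int m) - 2 * x" for x
  proof -
    have "x mod int m - x = - (int m * (x div int m))"
      using mult_div_mod_eq[of "int m" x] by linarith
    then have "2 * (x mod int m) - 2 * x = 2 * int m * (- (x div int m))"
      by (simp flip: right_diff_distrib)
    then show ?thesis by (metis dvd_triv_left)
  qed
  have \<beta>_t1: "2 * int m dvd \<beta> (t1 p) - (\<beta> p - 2 * \<alpha> p)" for p
  proof -
    have "\<beta> (t1 p) - (\<beta> p - 2 * \<alpha> p) = (\<beta> (t1 p) - 2 * snd (t1 p)) + (2 * ((snd p - 2 * fst p) mod int m) - 2 * (snd p - 2 * fst p))
       - (\<beta> p - 2 * snd p) - 2 * int m"
      by (simp add: t1_def \<alpha>_def algebra_simps)
    then show ?thesis by (simp only:) (intro dvd_diff dvd_add dvd_\<beta> dvd_mod dvd_refl)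
  qed
  have \<alpha>_t2: "2 * int m dvd \<alpha> (t2 p) - (\<alpha> p - 2 * \<beta> p)" for p
  proof -
    have "\<alpha> (t2 p) - (\<alpha> p - 2 * \<beta> p) = (2 * ((fst p - 2 * snd p) mod int m) - 2 * (fst p - 2 * snd p)) + 2 * (\<beta> p - 2 * snd p)"
      by (simp add: t2_def \<alpha>_def algebra_simps)
    then show ?thesis by (simp only:) (intro dvd_add dvd_mult dvd_\<beta> dvd_mod)
  qed
  have \<alpha>_t1: "\<alpha> (t1 p) = \<alpha> p" and \<beta>_t2: "\<beta> (t2 p) = \<beta> p" for p
    by (simp_all add: \<alpha>_def \<beta>_def t1_def t2_def)

  \<comment> \<open>The bound by a third of \<open>m\<close> keeps both
    \<open>\<bar>\<beta> - 2\<alpha>\<bar>\<close> and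
    \<open>\<bar>\<beta> + 2\<alpha>\<bar>\<close> below \<open>m\<close>, so neither the shear nor
    its inverse wraps around.\<close>
  let ?P = "{p \<in> Z \<times> Z. 3 * \<bar>\<alpha> p\<bar> < int m \<and> 3 * \<bar>\<beta> p\<bar> < int m \<and> \<bar>\<beta> p\<bar> < \<bar>\<alpha> p\<bar>}"
  let ?Q = "{p \<in> Z \<times> Z. 3 * \<bar>\<beta> p\<bar> < int m \<and> 3 * \<bar>\<alpha> p\<bar> < int m \<and> \<bar>\<alpha> p\<bar> < \<bar>\<beta> p\<bar>}"
  let ?P' = "{p \<in> Z \<times> Z. \<bar>\<beta> p\<bar> < \<bar>\<alpha> p\<bar>}" and ?Q' = "{p \<in> Z \<times> Z. \<bar>\<alpha> p\<bar> < \<bar>\<beta> p\<bar>}"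
  have finZ: "finite (Z \<times> Z)" by (simp add: Z_def)
  have t1X: "t1 p \<in> Z \<times> Z" and t2X: "t2 p \<in> Z \<times> Z" if "p \<in> Z \<times> Z" for p
    using t1 t2 that unfolding bij_betw_def by blast+
  have P: "2 * sum \<nu> ?P \<le> 3/2 * sum \<nu> ?Q' + 2 * (3 * \<delta> * tot)"
  proof (rule shear_doubles[OF finZ t1 \<nu>0])
    show "sum \<nu> A \<le> 3/2 * sum \<nu> (t1 ` A) + 3 * \<delta> * tot" "sum \<nu> (t1 ` A) \<le> 3/2 * sum \<nu> A + 3 * \<delta> * tot"
      if "A \<subseteq> Z \<times> Z" for A
      using quasi[OF that bij_betw_imp_inj_on[OF t1] \<rho>(1) \<nu>t1] d3 by simp_all
    show "\<alpha> (t1 p) = \<alpha> p \<and> \<beta> (t1 p) = \<beta> p - 2 * \<alpha> p" if "p \<in> ?P" for p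
      using that \<beta>_range[OF t1X] \<alpha>_t1[of p] by (auto intro!: uniq \<beta>_t1)
    show "\<alpha> p = \<alpha> (t1 p) \<and> \<beta> p = \<beta> (t1 p) + 2 * \<alpha> (t1 p)" if "p \<in> Z \<times> Z" "t1 p \<in> ?P" for p
    proof -
      have "2 * int m dvd \<beta> p - (\<beta> (t1 p) + 2 * \<alpha> (t1 p))"
        using \<beta>_t1[of p] \<alpha>_t1[of p] by (subst dvd_minus_iff[symmetric]) (simp add: algebra_simps)
      then show ?thesis using that \<beta>_range[OF that(1)] \<alpha>_t1[of p] by (auto intro!: uniq)
    qed
  qed
  have Q: "2 * sum \<nu> ?Q \<le> 3/2 * sum \<nu> ?P' + 2 * (3 * \<delta> * tot)"
  proof (rule shear_doubles[OF finZ t2 \<nu>0])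
    show "sum \<nu> A \<le> 3/2 * sum \<nu> (t2 ` A) + 3 * \<delta> * tot" "sum \<nu> (t2 ` A) \<le> 3/2 * sum \<nu> A + 3 * \<delta> * tot"
      if "A \<subseteq> Z \<times> Z" for A
      using quasi[OF that bij_betw_imp_inj_on[OF t2] \<rho>(2) \<nu>t2] d4 by simp_all
    show "\<beta> (t2 p) = \<beta> p \<and> \<alpha> (t2 p) = \<alpha> p - 2 * \<beta> p" if "p \<in> ?Q" for p
      using that \<alpha>_range[OF t2X] \<beta>_t2[of p] by (auto intro!: uniq \<alpha>_t2)
    show "\<beta> p = \<beta> (t2 p) \<and> \<alpha> p = \<alpha> (t2 p) + 2 * \<beta> (t2 p)" if "p \<in> Z \<times> Z" "t2 p \<in> ?Q" for p
    proof -
      have "2 * int m dvd \<alpha> p - (\<alpha> (t2 p) + 2 * \<beta> (t2 p))"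
        using \<alpha>_t2[of p] \<beta>_t2[of p] by (subst dvd_minus_iff[symmetric]) (simp add: algebra_simps)
      then show ?thesis using that \<alpha>_range[OF that(1)] \<beta>_t2[of p] by (auto intro!: uniq)
    qed
  qed

  let ?A = "{p \<in> Z \<times> Z. \<not> 3 * \<bar>\<alpha> p\<bar> < int m}" and ?B = "{p \<in> Z \<times> Z. \<not> 3 * \<bar>\<beta> p\<bar> < int m}"
  \<comment> \<open>An offset of at least a third of \<open>m\<close> is an angle of at least
    \<open>pi / 3\<close>, whose chord has length at least \<open>1\<close>. Such frequencies pay at
    least their own mass in the defect of a translation.\<close>
  have far: "1 \<le> (cmod (unity m k - s))\<^sup>2"
    if s: "s = 1 \<or> s = - 1" and c: "unity m k = s * cis (pi * real_of_int c / m)" and "int m \<le> 3 * \<bar>c\<bar>" "\<bar>c\<bar> \<le> int m"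
    for k c s
  proof -
    have "pi * real_of_int m \<le> pi * real_of_int (3 * \<bar>c\<bar>)" "pi * real_of_int \<bar>c\<bar> \<le> pi * real_of_int m"
      using that(3,4) by (intro mult_left_mono of_int_le_iff[THEN iffD2]; simp)+
    then have "pi / 3 \<le> \<bar>pi * real_of_int c / m\<bar>" "\<bar>pi * real_of_int c / m\<bar> \<le> pi"
      using m0 by (simp_all add: abs_mult field_simps)
    then have "cos \<bar>pi * real_of_int c / m\<bar> \<le> cos (pi / 3)"
      by (intro cos_monotone_0_pi_le) auto
    then have cos: "cos (pi * real_of_int c / m) \<le> 1/2" by (simp only: cos_abs_real cos_60)
    let ?\<theta> = "pi * real_of_int c / m"
    have "unity m k - s = s * (cis ?\<theta> - 1)" unfolding c by (simp add: algebra_simps)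
    then have "(cmod (unity m k - s))\<^sup>2 = (cmod (cis ?\<theta> - 1))\<^sup>2" using s by (auto simp: norm_mult norm_minus_commute)
    also have "\<dots> = (cos ?\<theta> - 1)\<^sup>2 + (sin ?\<theta>)\<^sup>2" by (simp add: cmod_power2)
    also have "\<dots> = 2 - 2 * cos ?\<theta>"
      using sin_cos_squared_add2[of ?\<theta>] by (simp add: power2_eq_square algebra_simps)
    finally show ?thesis using cos by simp
  qed
  have bound: "sum \<nu> X \<le> \<delta> * tot"
    if "X \<subseteq> Z \<times> Z" "(\<Sum>p\<in>Z \<times> Z. (cmod (w p))\<^sup>2 * \<nu> p) \<le> \<delta> * tot" "\<And>p. p \<in> X \<Longrightarrow> 1 \<le> (cmod (w p))\<^sup>2" for X and w :: "int \<times> int \<Rightarrow> complex"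
  proof -
    have "sum \<nu> X \<le> (\<Sum>p\<in>X. (cmod (w p))\<^sup>2 * \<nu> p)"
      using mult_right_mono[OF that(3) \<nu>0] by (intro sum_mono) simp
    also have "\<dots> \<le> (\<Sum>p\<in>Z \<times> Z. (cmod (w p))\<^sup>2 * \<nu> p)"
      using finZ that(1) \<nu>0 by (intro sum_mono2) auto
    finally show ?thesis using that(2) by linarith
  qed
  have A: "sum \<nu> ?A \<le> \<delta> * tot"
  proof (rule bound[OF _ e1])
    fix p assume p: "p \<in> ?A"
    have "unity m (- fst p) = (- 1) * cis (pi * real_of_int (- \<alpha> p) / m)"
    proof -
      have "2 * pi * real_of_int (- fst p) / real m = - pi + pi * real_of_int (- \<alpha> p) / m"
        using m0 by (simp add: \<alpha>_def field_simps)
      moreover have "cis (- pi) = - 1" by (simp add: complex_eq_iff)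
      ultimately show ?thesis by (simp only: unity_def cis_mult[symmetric])
    qed
    from far[OF _ this] show "1 \<le> (cmod (unity m (- fst p) + 1))\<^sup>2"
      using p \<alpha>_range[of p] by (simp add: abs_le_iff)
  qed auto
  have B: "sum \<nu> ?B \<le> \<delta> * tot"
  proof (rule bound[OF _ e2])
    fix p assume p: "p \<in> ?B"
    have "unity m (- snd p) = 1 * cis (pi * real_of_int (- \<beta> p) / m)"
    proof -
      from dvd_\<beta>[of p] obtain k where k: "\<beta> p - 2 * snd p = 2 * int m * k" by (elim dvdE)
      from \<beta>[of p] obtain b where b: "\<beta> p = 2 * b" by (elim evenE)
      have "- snd p - (- b) = int m * k" using k b by simp
      then have "unity m (- snd p) = unity m (- b)"
        using unity_periodic[OF m0, of "- snd p" "- b"] by (simp add: mod_eq_dvd_iff)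
      then show ?thesis by (simp add: unity_def b mult_ac)
    qed
    from far[OF _ this] show "1 \<le> (cmod (unity m (- snd p) - 1))\<^sup>2"
      using p \<beta>_range[of p] by (simp add: abs_le_iff)
  qed auto
  have sub: "sum \<nu> X \<le> sum \<nu> Y + sum \<nu> ?A + sum \<nu> ?B"
    if "X \<subseteq> Y \<union> ?A \<union> ?B" "Y \<subseteq> Z \<times> Z" for X Y
  proof -
    have fin: "finite Y" "finite ?A" "finite ?B" using that finZ by (auto intro: finite_subset)
    have sum_Un: "sum \<nu> (C \<union> D) \<le> sum \<nu> C + sum \<nu> D" if "finite C" "finite D" for C D
      using sum.union_inter[OF that, of \<nu>] sum_nonneg[of "C \<inter> D" \<nu>] \<nu>0 by simp
    have "sum \<nu> X \<le> sum \<nu> (Y \<union> ?A \<union> ?B)" using that fin \<nu>0 by (intro sum_mono2) auto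
    also have "\<dots> \<le> sum \<nu> (Y \<union> ?A) + sum \<nu> ?B" using fin by (intro sum_Un) auto
    also have "sum \<nu> (Y \<union> ?A) \<le> sum \<nu> Y + sum \<nu> ?A" using fin by (intro sum_Un) auto
    finally show ?thesis by simp
  qed
  have "sum \<nu> ?P' \<le> sum \<nu> ?P + sum \<nu> ?A + sum \<nu> ?B" by (rule sub) auto
  moreover have "sum \<nu> ?Q' \<le> sum \<nu> ?Q + sum \<nu> ?A + sum \<nu> ?B" by (rule sub) auto
  moreover have "sum \<nu> ?P' + sum \<nu> ?Q' = tot"
  proof -
    have "sum \<nu> ?P' + sum \<nu> ?Q' = sum \<nu> (?P' \<union> ?Q')"
      using finZ by (intro sum.union_disjoint[symmetric]) auto
    also have "?P' \<union> ?Q' = Z \<times> Z" using neq by (auto simp: neq_iff)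
    finally show ?thesis using total by simp
  qed
  \<comment> \<open>Adding \<open>P\<close> and \<open>Q\<close> and restoring the discarded mass
    gives \<open>2 * (tot - 4 * \<delta> * tot) \<le> 3/2 * tot + 12 * \<delta> * tot\<close>, the
    origin of the constant \<open>40\<close>.\<close>
  ultimately have "tot \<le> 40 * \<delta> * tot" using P Q A B by linarith
  then show ?thesis using tot by simp
qed

section \<open>The group \<open>\<int>\<^sup>2 \<rtimes> \<Gamma>(2)\<close> and its congruence quotients\<close>

type_synonym affine = "int \<times> int \<times> int \<times> int \<times> int \<times> int"

text \<open>The tuple \<open>(x, y, a, b, c, d)\<close> stands for the map \<open>(u, v) \<mapsto> (a u + b v + x, c u + d v + y)\<close>.\<close>

fun comp :: "affine \<Rightarrow> affine \<Rightarrow> affine" where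
  "comp (x, y, a, b, c, d) (x', y', a', b', c', d') =
     (x + a * x' + b * y', y + c * x' + d * y',
      a * a' + b * c', a * b' + b * d', c * a' + d * c', c * b' + d * d')"

fun det :: "affine \<Rightarrow> int" where
  "det (x, y, a, b, c, d) = a * d - b * c"

fun reduce :: "int \<Rightarrow> affine \<Rightarrow> affine" where
  "reduce m (x, y, a, b, c, d) = (x mod m, y mod m, a mod m, b mod m, c mod m, d mod m)"

lemma comp_assoc: "comp (comp p q) r = comp p (comp q r)"
  by (cases p; cases q; cases r) (simp add: algebra_simps)

lemma comp_one: "comp (0, 0, 1, 0, 0, 1) p = p" "comp p (0, 0, 1, 0, 0, 1) = p"
  by (cases p; simp)+

lemma det_comp: "det (comp p q) = det p * det q"
  by (cases p; cases q) (simp add: algebra_simps)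

lemma reduce_eq_iff:
  "reduce m (x, y, a, b, c, d) = reduce m (x', y', a', b', c', d') \<longleftrightarrow>
     m dvd x - x' \<and> m dvd y - y' \<and> m dvd a - a' \<and> m dvd b - b' \<and> m dvd c - c' \<and> m dvd d - d'"
  by (simp add: mod_eq_dvd_iff)

text \<open>Only the right factor is reduced: it is the vertex of the quotient, whereas the group
  element stays integral.\<close>

lemma reduce_comp: "reduce m (comp p (reduce m q)) = reduce m (comp p q)"
proof (cases p; cases q)
  fix x y a b c d x' y' a' b' c' d'
  assume pq: "p = (x, y, a, b, c, d)" "q = (x', y', a', b', c', d')"
  have *: "m dvd (s * (u mod m) + t * (v mod m)) - (s * u + t * v)" for s t u v
  proof -
    have "m dvd u mod m - u" "m dvd v mod m - v" by (simp_all flip: mod_eq_dvd_iff)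
    then have "m dvd s * (u mod m - u) + t * (v mod m - v)" by simp
    then show ?thesis by (simp add: algebra_simps)
  qed
  show ?thesis
    using *[of a x' b y'] *[of c x' d y'] *[of a a' b c'] *[of a b' b d'] *[of c a' d c'] *[of c b' d d']
    unfolding pq by (simp only: reduce.simps(1)[of _ x'] comp.simps reduce_eq_iff) (simp add: algebra_simps)
qed

lemma det_reduce: "det (reduce m p) mod m = det p mod m"
proof (cases p)
  case (fields x y a b c d)
  show ?thesis unfolding fields by (simp add: mod_diff_eq[symmetric, of "a * d"] mod_mult_eq) (metis mod_diff_eq mod_mult_eq)
qed

text \<open>\<open>SL(2, \<int>/m)\<close> in terms of residues; \<open>1 mod m\<close> covers
  \<open>m = 1\<close>.\<close>

definition linear_parts :: "int \<Rightarrow> (int \<times> int \<times> int \<times> int) set" where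
  "linear_parts m = {(a, b, c, d). {a, b, c, d} \<subseteq> {0..<m} \<and> (a * d - b * c) mod m = 1 mod m}"

text \<open>All of \<open>(\<int>/m)\<^sup>2 \<rtimes> SL(2, \<int>/m)\<close>. For even
  \<open>m\<close> the matrices of \<open>\<Gamma>(2)\<close> reach only a proper subgroup, so the
  left action on this set has several orbits; the models do not have to be transitive.\<close>

definition quotient :: "int \<Rightarrow> affine set" where
  "quotient m = {0..<m} \<times> {0..<m} \<times> linear_parts m"

lemma quotient_iff: "p \<in> quotient m \<longleftrightarrow> (m > 0 \<and> reduce m p = p \<and> det p mod m = 1 mod m)"
proof (cases p)
  case (fields x y a b c d)
  have *: "z mod m = z \<longleftrightarrow> 0 \<le> z \<and> z < m" if "m > 0" for z
    using that by (metis mod_pos_pos_trivial pos_mod_bound pos_mod_sign)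
  show ?thesis
  proof (cases "m > 0")
    case True
    show ?thesis unfolding fields by (auto simp: quotient_def linear_parts_def *[OF True])
  qed (auto simp: quotient_def fields)
qed

lemma finite_linear_parts: "finite (linear_parts m)"
proof -
  have "linear_parts m \<subseteq> {0..<m} \<times> {0..<m} \<times> {0..<m} \<times> {0..<m}" by (auto simp: linear_parts_def)
  then show ?thesis by (rule finite_subset) simp
qed

lemma finite_quotient: "finite (quotient m)"
  by (simp add: quotient_def finite_linear_parts)

lemma linear_parts_nonempty:
  assumes "m > 1" shows "(1, 0, 0, 1) \<in> linear_parts m"
  using assms by (simp add: linear_parts_def)

lemma card_quotient: "card (quotient m) = nat m ^ 2 * card (linear_parts m)"
  by (simp add: quotient_def card_cartesian_product power2_eq_square)

lemma card_quotient_ge: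
  assumes "m > 1" shows "nat m \<le> card (quotient m)"
proof -
  have "1 \<le> card (linear_parts m)"
    using linear_parts_nonempty[OF assms] finite_linear_parts by (simp add: Suc_le_eq card_gt_0_iff) auto
  then have "nat m ^ 2 \<le> card (quotient m)" by (simp add: card_quotient)
  moreover have "nat m \<le> nat m ^ 2" by (rule self_le_power) (use assms in auto)
  ultimately show ?thesis by linarith
qed

text \<open>The parities of \<open>a\<close> and \<open>b\<close> make the first coordinate additive
  modulo 2 under \<open>comp\<close>, which is the homomorphism \<open>parity\<close>.\<close>

typedef aff = "{p :: affine. det p = 1 \<and> (case p of (x, y, a, b, c, d) \<Rightarrow> odd a \<and> even b \<and> even c \<and> odd d)}"
  by (rule exI[of _ "(0, 0, 1, 0, 0, 1)"]) simp

setup_lifting type_definition_aff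

instantiation aff :: group_add
begin

lift_definition zero_aff :: aff is "(0, 0, 1, 0, 0, 1)" by simp
lift_definition plus_aff :: "aff \<Rightarrow> aff \<Rightarrow> aff" is comp
  by (auto simp: det_comp)
text \<open>The matrix is the adjugate, the inverse in determinant \<open>1\<close>, and the
  translation is its negative applied to \<open>(x, y)\<close>.\<close>

lift_definition uminus_aff :: "aff \<Rightarrow> aff" is
  "\<lambda>(x, y, a, b, c, d). (b * y - d * x, c * x - a * y, d, - b, - c, a)"
  by (auto simp: algebra_simps)
definition minus_aff :: "aff \<Rightarrow> aff \<Rightarrow> aff" where
  "minus_aff g h = g + - h"

instance
proof
  fix g h k :: aff
  show "g + h + k = g + (h + k)" by transfer (rule comp_assoc)
  show "0 + g = g" by transfer (rule comp_one)
  show "g + 0 = g" by transfer (rule comp_one)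
  show "- g + g = 0" by transfer (auto simp: algebra_simps)
  show "g + - h = g - h" by (simp add: minus_aff_def)
qed

end

instance aff :: countable
  by (rule countable_classI[of "to_nat \<circ> Rep_aff"]) (simp add: Rep_aff_inject)

definition parity :: "aff \<Rightarrow> bool" where
  "parity g = odd (fst (Rep_aff g))"

lemma Rep_aff_iff:
  "Rep_aff g = (x, y, a, b, c, d) \<Longrightarrow> a * d - b * c = 1 \<and> odd a \<and> even b \<and> even c \<and> odd d"
  using Rep_aff[of g] by auto

lemma odd_fst_comp: "odd (fst (comp (Rep_aff g) p)) \<longleftrightarrow> parity g \<noteq> odd (fst p)"
proof (cases "Rep_aff g"; cases p)
  fix x y a b c d x' y' a' b' c' d'
  assume *: "Rep_aff g = (x, y, a, b, c, d)" "p = (x', y', a', b', c', d')"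
  show ?thesis using Rep_aff_iff[OF *(1)] by (simp add: parity_def *)
qed

interpretation aff: twisted_shift parity
  by unfold_locales (simp add: odd_fst_comp[folded plus_aff.rep_eq] parity_def plus_aff.rep_eq odd_fst_comp)

section \<open>The action on the congruence quotients\<close>

definition qact :: "int \<Rightarrow> aff \<Rightarrow> affine \<Rightarrow> affine" where
  "qact m g p = reduce m (comp (Rep_aff g) p)"

lemma reduce_reduce [simp]: "reduce m (reduce m p) = reduce m p"
  by (cases p) simp

lemma qact_0: "p \<in> quotient m \<Longrightarrow> qact m 0 p = p"
  by (simp add: qact_def zero_aff.rep_eq comp_one quotient_iff)

lemma qact_add: "qact m (g + h) p = qact m g (qact m h p)"
  by (simp add: qact_def plus_aff.rep_eq reduce_comp comp_assoc)

lemma qact_in_quotient: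
  assumes "p \<in> quotient m" shows "qact m g p \<in> quotient m"
proof -
  have "det (Rep_aff g) = 1" using Rep_aff[of g] by auto
  then show ?thesis
    using assms det_reduce[of m "comp (Rep_aff g) p"] by (simp add: quotient_iff qact_def det_comp)
qed

fun height :: "affine \<Rightarrow> int" where
  "height (x, y, a, b, c, d) = \<bar>x\<bar> + \<bar>y\<bar> + \<bar>a\<bar> + \<bar>b\<bar> + \<bar>c\<bar> + \<bar>d\<bar>"

text \<open>The matrix of \<open>p\<close> has determinant \<open>1\<close> modulo \<open>m\<close>,
  so multiplying by its adjugate cancels \<open>p\<close> and leaves \<open>g\<close> and
  \<open>h\<close> congruent entry by entry. The height bound makes congruent entries equal.\<close>

lemma qact_free:
  assumes p: "p \<in> quotient m" and eq: "qact m g p = qact m h p"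
    and ht: "height (Rep_aff g) + height (Rep_aff h) < m"
  shows "g = h"
proof -
  obtain x y a b c d where g: "Rep_aff g = (x, y, a, b, c, d)" by (cases "Rep_aff g")
  obtain x' y' a' b' c' d' where h: "Rep_aff h = (x', y', a', b', c', d')" by (cases "Rep_aff h")
  obtain u v q r s t where uv: "p = (u, v, q, r, s, t)" by (cases p)
  have "m dvd (q * t - r * s) - 1" using p by (simp add: quotient_iff uv flip: mod_eq_dvd_iff)
  then have dvd_cancel: "m dvd z" if "m dvd z * (q * t - r * s)" for z
  proof -
    have "m dvd z * (q * t - r * s) - z * ((q * t - r * s) - 1)"
      using that dvd_mult[OF \<open>m dvd (q * t - r * s) - 1\<close>] by (rule dvd_diff)
    then show ?thesis by (simp add: algebra_simps)
  qed
  have d: "m dvd x + a * u + b * v - (x' + a' * u + b' * v)" "m dvd y + c * u + d * v - (y' + c' * u + d' * v)"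
    "m dvd a * q + b * s - (a' * q + b' * s)" "m dvd a * r + b * t - (a' * r + b' * t)"
    "m dvd c * q + d * s - (c' * q + d' * s)" "m dvd c * r + d * t - (c' * r + d' * t)"
    using eq unfolding qact_def g h uv comp.simps reduce_eq_iff by blast+
  have lin: "m dvd z - z' \<and> m dvd w - w'"
    if "m dvd z * q + w * s - (z' * q + w' * s)" "m dvd z * r + w * t - (z' * r + w' * t)" for z w z' w'
  proof -
    have "m dvd t * (z * q + w * s - (z' * q + w' * s)) - s * (z * r + w * t - (z' * r + w' * t))"
      "m dvd q * (z * r + w * t - (z' * r + w' * t)) - r * (z * q + w * s - (z' * q + w' * s))"
      using that by (auto intro: dvd_diff dvd_mult)
    then have "m dvd (z - z') * (q * t - r * s)" "m dvd (w - w') * (q * t - r * s)"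
      by (simp_all add: algebra_simps)
    then show ?thesis using dvd_cancel by blast
  qed
  have ab: "m dvd a - a'" "m dvd b - b'" and cd: "m dvd c - c'" "m dvd d - d'"
    using lin[OF d(3,4)] lin[OF d(5,6)] by auto
  have "m dvd (x + a * u + b * v - (x' + a' * u + b' * v)) - (a - a') * u - (b - b') * v"
    "m dvd (y + c * u + d * v - (y' + c' * u + d' * v)) - (c - c') * u - (d - d') * v"
    using d(1,2) ab cd by (auto intro!: dvd_diff dvd_mult2)
  then have xy: "m dvd x - x'" "m dvd y - y'" by (simp_all add: algebra_simps)
  have small: "z = z'" if "m dvd z - z'" "\<bar>z\<bar> \<le> height (Rep_aff g)" "\<bar>z'\<bar> \<le> height (Rep_aff h)" for z z'
  proof -
    have "\<bar>z - z'\<bar> < m" using that ht by linarith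
    then show ?thesis using that(1) zdvd_not_zless[of "\<bar>z - z'\<bar>" m] by auto
  qed
  have "x = x'" "y = y'" "a = a'" "b = b'" "c = c'" "d = d'"
    using xy ab cd by (auto intro!: small simp: g h)
  then show ?thesis by (simp add: g h flip: Rep_aff_inject)
qed

lemma aff_models:
  assumes "finite E"
  shows "\<exists>(V :: affine set) a p. aff.free_model E V a p"
proof -
  define K where "K = 1 + 2 * Max (insert 0 ((\<lambda>g. height (Rep_aff g)) ` E))"
  have ht: "height (Rep_aff g) \<le> (K - 1) div 2" if "g \<in> E" for g
    using that assms by (simp add: K_def)
  have "0 \<le> Max (insert 0 ((\<lambda>g. height (Rep_aff g)) ` E))" using assms by (intro Max_ge) auto
  then have K: "K > 0" by (simp add: K_def)
  \<comment> \<open>Even, so that the parity of the first coordinate survives reduction, and larger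
    than the sum of any two heights in \<open>E\<close>, so that \<open>qact_free\<close>
    applies.\<close>
  let ?m = "2 * K"
  have "aff.free_model E (quotient ?m) (qact ?m) (\<lambda>p. odd (fst p))"
    unfolding aff.free_model_def
  proof (intro conjI ballI allI)
    show "finite (quotient ?m)" by (rule finite_quotient)
    show "quotient ?m \<noteq> {}" using linear_parts_nonempty[of ?m] K by (auto simp: quotient_def)
    fix p assume p: "p \<in> quotient ?m"
    show "qact ?m 0 p = p" by (rule qact_0[OF p])
    show "inj_on (\<lambda>g. qact ?m g p) E"
    proof (rule inj_onI)
      fix g h assume gh: "g \<in> E" "h \<in> E" "qact ?m g p = qact ?m h p"
      show "g = h" using ht[OF gh(1)] ht[OF gh(2)] K by (intro qact_free[OF p gh(3)]) linarith
    qed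
    fix g
    show "qact ?m g p \<in> quotient ?m" by (rule qact_in_quotient[OF p])
    show "qact ?m (g + h) p = qact ?m g (qact ?m h p)" for h by (rule qact_add)
    have "odd (fst (reduce ?m q)) \<longleftrightarrow> odd (fst q)" for q
      by (cases q) (simp add: dvd_mod_iff)
    then show "odd (fst (qact ?m g p)) \<longleftrightarrow> odd (fst p) \<noteq> parity g"
      unfolding qact_def using odd_fst_comp[of g p] by auto
  qed
  then show ?thesis by blast
qed

section \<open>Generators, displacement, and the defect on odd quotients\<close>

lift_definition tr :: "int \<Rightarrow> int \<Rightarrow> aff" is "\<lambda>x y. (x, y, 1, 0, 0, 1)" by simp
lift_definition upper :: aff is "(0, 0, 1, 2, 0, 1)" by simp
lift_definition lower :: aff is "(0, 0, 1, 0, 2, 1)" by simp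

lemma fst_tr_add: "fst (Rep_aff (tr x y + h)) = x + fst (Rep_aff h)"
  by (cases "Rep_aff h") (simp add: plus_aff.rep_eq tr.rep_eq)

lemma parity_tr: "parity (tr x y) = odd x"
  by (simp add: parity_def tr.rep_eq)

lemma aff_displace:
  assumes "finite E" shows "\<exists>g. \<not> parity g \<and> (\<forall>h\<in>E. g + h \<notin> E)"
proof -
  define K where "K = Max (insert 0 ((\<lambda>h. \<bar>fst (Rep_aff h)\<bar>) ` E))"
  have K: "\<bar>fst (Rep_aff h)\<bar> \<le> K" if "h \<in> E" for h
    using that assms by (simp add: K_def)
  have K0: "0 \<le> K" using assms by (simp add: K_def)
  \<comment> \<open>First coordinates of \<open>E\<close> lie between \<open>- K\<close> and
    \<open>K\<close>. A translation by \<open>2 * K + 2\<close> leaves this window and has even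
    first coordinate.\<close>
  have "tr (2 * K + 2) 0 + h \<notin> E" if "h \<in> E" for h
  proof
    assume "tr (2 * K + 2) 0 + h \<in> E"
    from K[OF this] K[OF that] K0 show False by (simp add: fst_tr_add)
  qed
  then show ?thesis by (intro exI[of _ "tr (2 * K + 2) 0"]) (simp add: parity_tr)
qed

text \<open>With \<open>W\<close> encoded by signs, each vertex at which \<open>W\<close> fails to
  follow \<open>parity s\<close> contributes \<open>2 ^ 2 = 4\<close> to the squared defect. A share
  of at most \<open>1 / 200\<close> for all four generators would allow
  \<open>\<delta> = 4 / 200 = 1 / 50\<close> in \<open>no_odd_model\<close>, below the
  \<open>1 / 40\<close> required there.\<close>

lemma odd_quotient_defect:
  fixes m :: nat and W :: "affine set"
  assumes m: "odd m" "m > 1"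
  shows "\<exists>s\<in>{tr 1 0, tr 0 1, upper, lower}. real (card (quotient m)) / 200
     < card {p \<in> quotient m. (qact m s p \<in> W) \<noteq> ((p \<in> W) \<noteq> parity s)}"
proof (rule ccontr)
  define bad where "bad s = {p \<in> quotient m. (qact m s p \<in> W) \<noteq> ((p \<in> W) \<noteq> parity s)}" for s
  assume "\<not> ?thesis"
  then have small: "card (bad s) \<le> real (card (quotient m)) / 200" if "s \<in> {tr 1 0, tr 0 1, upper, lower}" for s
    using that by (auto simp: bad_def not_less)
  let ?S = "linear_parts m" and ?Z = "{0..<int m}"
  define f :: "int \<Rightarrow> int \<Rightarrow> int \<times> int \<times> int \<times> int \<Rightarrow> real"
    where "f x y q = (if (x mod int m, y mod int m, q) \<in> W then 1 else - 1)" for x y q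
  have m0: "int m > 0" using m by simp
  have fq: "f x y q = (if (x, y, q) \<in> W then 1 else - 1)" if "(x, y, q) \<in> quotient m" for x y q
    using that by (simp add: f_def quotient_def)
  have sum: "(\<Sum>q\<in>?S. \<Sum>x\<in>?Z. \<Sum>y\<in>?Z. (g x y q + (if parity s then 1 else - 1) * f x y q)\<^sup>2)
      \<le> 1 / 50 * (real m ^ 2 * card ?S)"
    if s: "s \<in> {tr 1 0, tr 0 1, upper, lower}"
      and g: "\<And>x y q. (x, y, q) \<in> quotient m \<Longrightarrow> g x y q = (if qact m s (x, y, q) \<in> W then 1 else - 1)" for s g
  proof -
    have "(\<Sum>q\<in>?S. \<Sum>x\<in>?Z. \<Sum>y\<in>?Z. (g x y q + (if parity s then 1 else - 1) * f x y q)\<^sup>2)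
      = (\<Sum>x\<in>?Z. \<Sum>y\<in>?Z. \<Sum>q\<in>?S. (g x y q + (if parity s then 1 else - 1) * f x y q)\<^sup>2)"
      by (subst sum.swap) (intro sum.cong refl sum.swap)
    also have "\<dots> = (\<Sum>(x, y, q)\<in>quotient m. (g x y q + (if parity s then 1 else - 1) * f x y q)\<^sup>2)"
      unfolding quotient_def by (simp only: sum.cartesian_product)
    also have "\<dots> = (\<Sum>p\<in>quotient m. if p \<in> bad s then 4 else 0)"
    proof (rule sum.cong[OF refl])
      fix p assume p: "p \<in> quotient m"
      obtain x y q where xyq: "p = (x, y, q)" by (cases p)
      show "(case p of (x, y, q) \<Rightarrow> (g x y q + (if parity s then 1 else - 1) * f x y q)\<^sup>2) = (if p \<in> bad s then 4 else 0)"
        using p fq[of x y q] g[of x y q] by (simp add: xyq bad_def)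
    qed
    also have "\<dots> = 4 * card (bad s)"
      by (simp add: bad_def finite_quotient flip: sum.inter_filter)
    also have "\<dots> \<le> card (quotient m) / 50" using small[OF s] by simp
    also have "card (quotient m) = real m ^ 2 * card ?S" by (simp add: card_quotient)
    finally show ?thesis by simp
  qed
  define \<rho>1 where "\<rho>1 = (\<lambda>(a, b, c, d). ((a + 2 * c) mod int m, (b + 2 * d) mod int m, c :: int, d :: int))"
  define \<rho>2 where "\<rho>2 = (\<lambda>(a, b, c, d). (a :: int, b :: int, (c + 2 * a) mod int m, (d + 2 * b) mod int m))"
  have W_mod: "qact m upper (x, y, q) = ((x + 2 * y) mod int m, y, \<rho>1 q)"
    "qact m lower (x, y, q) = (x, (y + 2 * x) mod int m, \<rho>2 q)"
    "qact m (tr 1 0) (x, y, q) = ((x + 1) mod int m, y, q)" "qact m (tr 0 1) (x, y, q) = (x, (y + 1) mod int m, q)"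
    if "(x, y, q) \<in> quotient m" for x y q
    using that by (auto simp: qact_def upper.rep_eq lower.rep_eq tr.rep_eq \<rho>1_def \<rho>2_def quotient_def linear_parts_def add.commute)
  have in_S: "(0, 0, q) \<in> quotient m \<longleftrightarrow> q \<in> ?S" for q using m0 by (auto simp: quotient_def)
  \<comment> \<open>On vertices with translation part zero the linear generators act through the
    linear part alone, so \<open>\<rho>\<close> inherits bijectivity from the action on the
    quotient.\<close>
  have perm: "bij_betw \<rho> ?S ?S" if \<rho>: "\<And>q. q \<in> ?S \<Longrightarrow> qact m g (0, 0, q) = (0, 0, \<rho> q)" for \<rho> g
  proof -
    have "\<rho> ` ?S \<subseteq> ?S"
    proof
      fix r assume "r \<in> \<rho> ` ?S"
      then obtain q where q: "q \<in> ?S" "r = \<rho> q" by blast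
      then have "qact m g (0, 0, q) \<in> quotient m" using in_S by (intro qact_in_quotient) simp
      then show "r \<in> ?S" using in_S by (simp add: \<rho>[OF q(1)] q(2))
    qed
    moreover have "inj_on \<rho> ?S"
    proof (rule inj_onI)
      fix q r assume qr: "q \<in> ?S" "r \<in> ?S" "\<rho> q = \<rho> r"
      then have "qact m g (0, 0, q) = qact m g (0, 0, r)" by (simp add: \<rho>)
      then have "qact m (- g) (qact m g (0, 0, q)) = qact m (- g) (qact m g (0, 0, r))" by simp
      then show "q = r" using qr in_S by (simp add: qact_0 flip: qact_add)
    qed
    ultimately show ?thesis unfolding bij_betw_def by (simp add: endo_inj_surj finite_linear_parts)
  qed
  have "1 / 40 \<le> (1 / 50 :: real)"
  proof (rule no_odd_model[OF m(1) finite_linear_parts, of "int m" \<rho>1 \<rho>2 f])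
    show "?S \<noteq> {}" using linear_parts_nonempty[of "int m"] m by auto
    show "bij_betw \<rho>1 ?S ?S"
      using W_mod(1)[of 0 0] in_S by (intro perm[of upper]) simp
    show "bij_betw \<rho>2 ?S ?S"
      using W_mod(2)[of 0 0] in_S by (intro perm[of lower]) simp
    show "periodic m (\<lambda>x y. f x y q)" for q by (simp add: periodic_def f_def)
    show "\<bar>f x y q\<bar> = 1" for x y q by (simp add: f_def)
    have par: "parity (tr 1 0)" "\<not> parity (tr 0 1)" "\<not> parity upper" "\<not> parity lower"
      by (simp_all add: parity_def tr.rep_eq upper.rep_eq lower.rep_eq)
    have mod_id: "x mod int m = x" "y mod int m = y" if "(x, y, q) \<in> quotient m" for x y q
      using that by (auto simp: quotient_def)
    show "(\<Sum>q\<in>?S. \<Sum>x\<in>?Z. \<Sum>y\<in>?Z. (f (x + 1) y q + f x y q)\<^sup>2) \<le> 1 / 50 * (real m ^ 2 * card ?S)"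
      using sum[of "tr 1 0" "\<lambda>x y q. f (x + 1) y q"] par by (simp add: f_def W_mod mod_id)
    show "(\<Sum>q\<in>?S. \<Sum>x\<in>?Z. \<Sum>y\<in>?Z. (f x (y + 1) q - f x y q)\<^sup>2) \<le> 1 / 50 * (real m ^ 2 * card ?S)"
      using sum[of "tr 0 1" "\<lambda>x y q. f x (y + 1) q"] par by (simp add: f_def W_mod mod_id)
    show "(\<Sum>q\<in>?S. \<Sum>x\<in>?Z. \<Sum>y\<in>?Z. (f (x + 2 * y) y (\<rho>1 q) - f x y q)\<^sup>2) \<le> 1 / 50 * (real m ^ 2 * card ?S)"
      using sum[of upper "\<lambda>x y q. f (x + 2 * y) y (\<rho>1 q)"] par by (simp add: f_def W_mod mod_id)
    show "(\<Sum>q\<in>?S. \<Sum>x\<in>?Z. \<Sum>y\<in>?Z. (f x (y + 2 * x) (\<rho>2 q) - f x y q)\<^sup>2) \<le> 1 / 50 * (real m ^ 2 * card ?S)"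
      using sum[of lower "\<lambda>x y q. f x (y + 2 * x) (\<rho>2 q)"] par by (simp add: f_def W_mod mod_id)
  qed
  then show False by simp
qed

section \<open>Sofic approximations without models\<close>

lemma hom_Union:
  assumes h: "h \<in> boolean_homs \<Omega> \<A> D" and alg: "Sigma_Algebra.algebra \<Omega> \<A>"
    and "finite \<B>" "\<B> \<subseteq> \<A>"
  shows "h (\<Union>\<B>) = (\<Union>B\<in>\<B>. h B)"
  using assms(3,4)
proof (induction rule: finite_induct)
  case empty
  then show ?case using h by (simp add: boolean_homs_def)
next
  case (insert B \<B>)
  interpret Sigma_Algebra.algebra \<Omega> \<A> by (rule alg)
  have "\<Union>\<B> \<in> \<A>" using insert by auto
  then show ?case using insert h by (simp add: boolean_homs_def)
qed

text \<open>The hull is the intersection of all algebras that contain \<open>\<A>\<close>;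
  \<open>Pow \<Omega>\<close> is one of them and keeps the intersection inside
  \<open>Pow \<Omega>\<close>.\<close>

lemma algebra_generated_algebra:
  assumes "\<A> \<subseteq> Pow \<Omega>"
  shows "Sigma_Algebra.algebra \<Omega> (generated_algebra \<Omega> \<A>)" "\<A> \<subseteq> generated_algebra \<Omega> \<A>"
proof -
  let ?S = "{T. Sigma_Algebra.algebra \<Omega> T \<and> \<A> \<subseteq> T}"
  have eq: "generated_algebra \<Omega> \<A> = \<Inter>?S" by (simp add: generated_algebra_def hull_def)
  have "Pow \<Omega> \<in> ?S" using assms by (simp add: algebra_Pow)
  then have sub: "\<Inter>?S \<subseteq> Pow \<Omega>" by (rule Inter_lower)
  show "Sigma_Algebra.algebra \<Omega> (generated_algebra \<Omega> \<A>)"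
    unfolding eq
  proof (intro algebra_iff_Un[THEN iffD2] conjI ballI InterI)
    show "\<Inter>?S \<subseteq> Pow \<Omega>" by (rule sub)
    fix T assume T: "T \<in> ?S"
    then have T': "{} \<in> T" "\<forall>a\<in>T. \<Omega> - a \<in> T" "\<forall>a\<in>T. \<forall>b\<in>T. a \<union> b \<in> T"
      by (auto simp: algebra_iff_Un)
    show "{} \<in> T" by (rule T')
    show "\<Omega> - a \<in> T" if "a \<in> \<Inter>?S" for a using InterD[OF that T] T'(2) by simp
    show "a \<union> b \<in> T" if "a \<in> \<Inter>?S" "b \<in> \<Inter>?S" for a b
      using InterD[OF that(1) T] InterD[OF that(2) T] T'(3) by simp
  qed
  show "\<A> \<subseteq> generated_algebra \<Omega> \<A>" unfolding eq by (intro Inter_greatest) simp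
qed

text \<open>A homomorphism \<open>h\<close> would produce the set \<open>W = h S\<close>. As
  \<open>S\<close> is a union of classes of \<open>\<alpha>\<close>, the almost equivariance of
  \<open>h\<close>, summed over these classes, keeps the number of points where \<open>W\<close>
  fails to follow \<open>par\<close> under \<open>\<sigma> s\<close> strictly below
  \<open>\<delta> * d\<close>, against \<open>defect\<close>.\<close>

lemma Hom_mu_empty:
  fixes M :: "'a measure" and \<phi> :: "'g \<Rightarrow> 'a \<Rightarrow> 'a" and par :: "'g \<Rightarrow> bool" and \<sigma> :: "'g \<Rightarrow> nat \<Rightarrow> nat" and \<delta> :: real
  assumes \<alpha>: "partition_on (space M) \<alpha>" "finite \<alpha>" and S: "S \<subseteq> space M"
    and split: "\<And>A. A \<in> \<alpha> \<Longrightarrow> A \<subseteq> S \<or> A \<inter> S = {}"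
    and F: "finite F" "u \<in> F" "\<And>x. x \<in> space M \<Longrightarrow> \<phi> u x = x"
    and \<phi>: "\<And>s. s \<in> F \<Longrightarrow> bij_betw (\<phi> s) (space M) (space M)"
      "\<And>s. s \<in> F \<Longrightarrow> \<phi> s ` S = (if par s then space M - S else S)"
    and \<sigma>: "\<And>s. s \<in> F \<Longrightarrow> \<sigma> s permutes {1..d}" and d: "d > 0"
    and defect: "\<And>W. W \<subseteq> {1..d} \<Longrightarrow>
      \<exists>s\<in>F. \<delta> * d \<le> card {k \<in> {1..d}. (\<sigma> s k \<in> W) \<noteq> ((k \<in> W) \<noteq> par s)}"
  shows "Hom_mu M \<phi> \<alpha> F \<delta> d \<sigma> = {}"
proof (rule ccontr)
  assume "Hom_mu M \<phi> \<alpha> F \<delta> d \<sigma> \<noteq> {}"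
  then obtain h where h: "h \<in> Hom_mu M \<phi> \<alpha> F \<delta> d \<sigma>" by blast
  let ?\<Omega> = "space M" and ?D = "{1..d}"
  let ?P = "(\<lambda>s. (\<lambda>A. \<phi> s ` A) ` \<alpha>) ` F"
  let ?J = "join_translates \<phi> \<alpha> F" and ?\<A> = "generated_algebra ?\<Omega> (join_translates \<phi> \<alpha> F)"
  have \<alpha>\<Omega>: "A \<subseteq> ?\<Omega>" if "A \<in> \<alpha>" for A using \<alpha>(1) that by (auto simp: partition_on_def)
  have part: "partition_on ?\<Omega> p" if p: "p \<in> ?P" for p
  proof -
    obtain s where s: "s \<in> F" "p = (\<lambda>A. \<phi> s ` A) ` \<alpha>" using p by blast
    have inj: "inj_on (\<phi> s) ?\<Omega>" and surj: "\<phi> s ` ?\<Omega> = ?\<Omega>"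
      using \<phi>(1)[OF s(1)] by (auto simp: bij_betw_def)
    have "{} \<notin> (`) (\<phi> s) ` \<alpha>" using partition_onD3[OF \<alpha>(1)] by auto
    then show ?thesis
      using partition_on_inj_image[OF \<alpha>(1) inj] by (simp add: s(2) surj)
  qed
  have ne: "?P \<noteq> {}" using F by blast
  have J: "partition_on ?\<Omega> ?J"
    unfolding join_translates_def using part ne by (rule partition_on_common_refinement)
  have finJ: "finite ?J"
    unfolding join_translates_def using F \<alpha> by (intro finite_common_refinement) auto
  have "?J \<subseteq> Pow ?\<Omega>" using J by (auto simp: partition_on_def)
  note alg = algebra_generated_algebra[OF this]
  interpret Sigma_Algebra.algebra ?\<Omega> ?\<A> by (rule alg)
  have in_alg: "\<phi> s ` A \<in> ?\<A>" if s: "s \<in> F" and A: "A \<in> \<alpha>" for s A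
  proof -
    let ?p = "(\<lambda>A. \<phi> s ` A) ` \<alpha>"
    have ref: "refines ?\<Omega> ?J ?p"
      unfolding join_translates_def using part s by (intro refines_common_refinement) auto
    have p: "partition_on ?\<Omega> ?p" using part s by auto
    have "\<phi> s ` A = \<Union>{R \<in> ?J. R \<subseteq> \<phi> s ` A}"
    proof (intro equalityI subsetI)
      fix x assume x: "x \<in> \<phi> s ` A"
      then have "x \<in> ?\<Omega>" using p A by (auto simp: partition_on_def)
      then obtain R where R: "R \<in> ?J" "x \<in> R" using J by (auto simp: partition_on_def)
      then obtain B where B: "B \<in> ?p" "R \<subseteq> B" using ref unfolding refines_def by meson
      have "B = \<phi> s ` A"
      proof (rule ccontr)
        assume "B \<noteq> \<phi> s ` A"
        moreover have "\<phi> s ` A \<in> ?p" using A by (rule imageI)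
        ultimately have "B \<inter> \<phi> s ` A = {}" using disjointD[OF partition_onD2[OF p] B(1)] by blast
        then show False using B(2) R(2) x by blast
      qed
      then show "x \<in> \<Union>{R \<in> ?J. R \<subseteq> \<phi> s ` A}" using R B by blast
    qed blast
    moreover have "\<Union>{R \<in> ?J. R \<subseteq> \<phi> s ` A} \<in> ?\<A>"
      using finJ alg(2) by (intro finite_Union) auto
    ultimately show ?thesis by simp
  qed
  \<comment> \<open>\<open>u\<close> acts as the identity, so the classes of \<open>\<alpha>\<close>
    themselves lie in the algebra and \<open>h S\<close> is meaningful.\<close>
  have u: "\<phi> u ` A = A" if "A \<in> \<alpha>" for A
    using F(3) \<alpha>\<Omega>[OF that] by (force simp: subset_eq image_iff)
  have \<alpha>_alg: "\<alpha> \<subseteq> ?\<A>" using in_alg[OF F(2)] u by auto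
  let ?\<alpha>0 = "{A \<in> \<alpha>. A \<subseteq> S}"
  have S_eq: "S = \<Union>?\<alpha>0"
  proof (intro equalityI subsetI)
    fix x assume x: "x \<in> S"
    then obtain A where "A \<in> \<alpha>" "x \<in> A" using S \<alpha>(1) by (auto simp: partition_on_def)
    then show "x \<in> \<Union>?\<alpha>0" using split x by blast
  qed blast
  have fin0: "finite ?\<alpha>0" using \<alpha> by simp
  have hom: "h \<in> boolean_homs ?\<Omega> ?\<A> ?D" using h by (simp add: Hom_mu_def)
  have S_alg: "S \<in> ?\<A>"
    by (subst S_eq) (use \<alpha>_alg fin0 in \<open>intro finite_Union; auto\<close>)
  define W where "W = h S"
  have W: "W \<subseteq> ?D" using hom S_alg by (auto simp: W_def boolean_homs_def)
  have hS: "W = (\<Union>A\<in>?\<alpha>0. h A)"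
    unfolding W_def using hom_Union[OF hom alg(1) fin0] \<alpha>_alg S_eq by auto
  have h_trans: "h (\<phi> s ` S) = (if par s then ?D - W else W)" if "s \<in> F" for s
    using \<phi>(2)[OF that] hom S_alg by (simp add: W_def boolean_homs_def)
  obtain s where s: "s \<in> F" and bad: "\<delta> * d \<le> card {k \<in> ?D. (\<sigma> s k \<in> W) \<noteq> ((k \<in> W) \<noteq> par s)}"
    using defect[OF W] by blast
  have perm: "\<sigma> s permutes ?D" using \<sigma>[OF s] .
  have "h (\<phi> s ` S) = h (\<Union>((`) (\<phi> s) ` ?\<alpha>0))" by (subst S_eq) (simp add: image_Union)
  also have "\<dots> = (\<Union>B\<in>(`) (\<phi> s) ` ?\<alpha>0. h B)"
    using fin0 in_alg[OF s] by (intro hom_Union[OF hom alg(1)]) auto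
  finally have h_sS: "h (\<phi> s ` S) = (\<Union>A\<in>?\<alpha>0. h (\<phi> s ` A))" by simp
  \<comment> \<open>The points counted by \<open>defect\<close> sit at the source of
    \<open>\<sigma> s\<close>, the symmetric differences in \<open>Hom_mu\<close> at its target; the
    permutation matches them.\<close>
  have bad_eq: "\<sigma> s ` {k \<in> ?D. (\<sigma> s k \<in> W) \<noteq> ((k \<in> W) \<noteq> par s)} = sym_diff (\<sigma> s ` W) (h (\<phi> s ` S))"
  proof -
    have inj: "inj (\<sigma> s)" using permutes_inj[OF perm] .
    have sW: "l \<in> \<sigma> s ` W \<longleftrightarrow> k \<in> W" if "l = \<sigma> s k" for k l
      using inj that by (simp add: inj_image_mem_iff)
    have D: "\<sigma> s k \<in> ?D \<longleftrightarrow> k \<in> ?D" for k using permutes_in_image[OF perm] .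
    have surj: "\<exists>k. l = \<sigma> s k" for l using permutes_surj[OF perm] by (metis surjD)
    have "l \<in> \<sigma> s ` {k \<in> ?D. (\<sigma> s k \<in> W) \<noteq> ((k \<in> W) \<noteq> par s)} \<longleftrightarrow> l \<in> sym_diff (\<sigma> s ` W) (h (\<phi> s ` S))" for l
    proof -
      obtain k where k: "l = \<sigma> s k" using surj by blast
      have "l \<in> \<sigma> s ` {k \<in> ?D. (\<sigma> s k \<in> W) \<noteq> ((k \<in> W) \<noteq> par s)} \<longleftrightarrow> k \<in> ?D \<and> (\<sigma> s k \<in> W) \<noteq> ((k \<in> W) \<noteq> par s)"
        unfolding k using inj by (simp add: inj_image_mem_iff)
      also have "\<dots> \<longleftrightarrow> l \<in> sym_diff (\<sigma> s ` W) (h (\<phi> s ` S))"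
      proof -
        have "k \<in> W \<Longrightarrow> k \<in> ?D" "l \<in> W \<Longrightarrow> l \<in> ?D" "l \<in> ?D \<longleftrightarrow> k \<in> ?D" using W D[of k] k by blast+
        then show ?thesis
          unfolding h_trans[OF s] Un_iff Diff_iff sW[OF k] k[symmetric]
          by (cases "par s"; cases "k \<in> W"; cases "l \<in> W"; simp)
      qed
      finally show ?thesis .
    qed
    then show ?thesis by blast
  qed
  have hD: "h B \<subseteq> ?D" if "B \<in> ?\<A>" for B using hom that by (auto simp: boolean_homs_def)
  let ?X = "\<lambda>A. sym_diff (\<sigma> s ` h A) (h (\<phi> s ` A))"
  have finX: "finite (?X A)" if "A \<in> \<alpha>" for A
    using hD[of A] hD[OF in_alg[OF s that]] \<alpha>_alg that
    by (meson finite_Diff finite_UnI finite_atLeastAtMost finite_imageI finite_subset subsetD)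
  have "card {k \<in> ?D. (\<sigma> s k \<in> W) \<noteq> ((k \<in> W) \<noteq> par s)} = card (sym_diff (\<sigma> s ` W) (h (\<phi> s ` S)))"
    unfolding bad_eq[symmetric] using permutes_inj[OF perm] by (intro card_image[symmetric]) (auto intro: inj_on_subset)
  also have "\<dots> \<le> card (\<Union>A\<in>?\<alpha>0. ?X A)"
  proof (rule card_mono)
    show "finite (\<Union>A\<in>?\<alpha>0. ?X A)" using fin0 finX by auto
    show "sym_diff (\<sigma> s ` W) (h (\<phi> s ` S)) \<subseteq> (\<Union>A\<in>?\<alpha>0. ?X A)"
      unfolding hS h_sS by blast
  qed
  also have "\<dots> \<le> (\<Sum>A\<in>?\<alpha>0. card (?X A))" by (rule card_UN_le[OF fin0])
  also have "\<dots> \<le> (\<Sum>A\<in>\<alpha>. card (?X A))" using \<alpha> by (intro sum_mono2) auto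
  finally have "real (card {k \<in> ?D. (\<sigma> s k \<in> W) \<noteq> ((k \<in> W) \<noteq> par s)}) \<le> (\<Sum>A\<in>\<alpha>. real (card (?X A)))"
    by (simp only: of_nat_le_iff flip: of_nat_sum)
  with bad have "\<delta> * d \<le> (\<Sum>A\<in>\<alpha>. real (card (?X A)))" by (rule order_trans)
  then have "\<delta> \<le> (\<Sum>A\<in>\<alpha>. real (card (?X A)) / real d)"
    using d by (simp add: pos_le_divide_eq flip: sum_divide_distrib)
  moreover have "(\<Sum>A\<in>\<alpha>. real (card (?X A)) / real d) < \<delta>" using h s by (simp add: Hom_mu_def)
  ultimately show False by simp
qed

text \<open>The infimum over \<open>\<alpha>\<close> may refine any \<open>\<xi>\<close> by the
  fixed set \<open>S\<close>, so one obstructed two-set partition settles every term of the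
  supremum: with the given \<open>F\<close> and \<open>\<delta>\<close> no homomorphism is left for
  any \<open>i\<close>.\<close>

lemma sofic_entropy_minus_infinity:
  fixes M :: "'a measure" and \<phi> :: "'g \<Rightarrow> 'a \<Rightarrow> 'a" and par :: "'g \<Rightarrow> bool" and \<sigma> :: "nat \<Rightarrow> 'g \<Rightarrow> nat \<Rightarrow> nat" and \<delta> :: real
  assumes S: "S \<in> sets M"
    and F: "finite F" "F \<subseteq> carrier G" "\<one>\<^bsub>G\<^esub> \<in> F" "\<And>x. x \<in> space M \<Longrightarrow> \<phi> \<one>\<^bsub>G\<^esub> x = x"
    and \<phi>: "\<And>s. s \<in> F \<Longrightarrow> bij_betw (\<phi> s) (space M) (space M)"
      "\<And>s. s \<in> F \<Longrightarrow> \<phi> s ` S = (if par s then space M - S else S)"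
    and \<sigma>: "\<And>i s. s \<in> F \<Longrightarrow> \<sigma> i s permutes {1..d i}" and d: "\<And>i. d i > 0" and \<delta>: "\<delta> > 0"
    and defect: "\<And>i W. W \<subseteq> {1..d i} \<Longrightarrow>
      \<exists>s\<in>F. \<delta> * d i \<le> card {k \<in> {1..d i}. (\<sigma> i s k \<in> W) \<noteq> ((k \<in> W) \<noteq> par s)}"
  shows "sofic_entropy G M \<phi> d \<sigma> = - \<infinity>"
proof -
  let ?v = "\<lambda>\<xi> \<alpha> F \<delta>. limsup (\<lambda>i. ereal (1 / real (d i)) * log_count (num_restrictions (Hom_mu M \<phi> \<alpha> F \<delta> (d i) (\<sigma> i)) \<xi>))"
  let ?A = "\<lambda>\<xi>. {\<alpha>. measurable_partition M \<alpha> \<and> finite \<alpha> \<and> refines (space M) \<alpha> \<xi>}"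
  let ?F = "{F. finite F \<and> F \<subseteq> carrier G \<and> \<one>\<^bsub>G\<^esub> \<in> F}"
  have "(INF \<alpha>\<in>?A \<xi>. INF F\<in>?F. INF \<delta>\<in>{0<..}. ?v \<xi> \<alpha> F \<delta>) \<le> - \<infinity>"
    if \<xi>: "measurable_partition M \<xi>" "finite \<xi>" for \<xi>
  proof -
    \<comment> \<open>The common refinement of \<open>\<xi>\<close> with \<open>S\<close> and its
      complement, without the empty intersections, which a partition must not contain.\<close>
    define \<alpha> where "\<alpha> = (\<lambda>(X, Y). X \<inter> Y) ` (\<xi> \<times> {S, space M - S}) - {{}}"
    have S\<Omega>: "S \<subseteq> space M" using S by (rule sets.sets_into_space)
    have \<xi>': "partition_on (space M) \<xi>" "\<xi> \<subseteq> sets M" using \<xi> by (auto simp: measurable_partition_def)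
    have part: "partition_on (space M) \<alpha>"
    proof (rule partition_onI)
      show "\<Union>\<alpha> = space M"
      proof (intro equalityI subsetI)
        fix x assume x: "x \<in> space M"
        then obtain X where X: "X \<in> \<xi>" "x \<in> X" using partition_onD1[OF \<xi>'(1)] by blast
        define Y where "Y = (if x \<in> S then S else space M - S)"
        have "x \<in> X \<inter> Y" using x X by (simp add: Y_def)
        moreover have "X \<inter> Y \<in> (\<lambda>(X, Y). X \<inter> Y) ` (\<xi> \<times> {S, space M - S})"
          using X by (intro image_eqI[of _ _ "(X, Y)"]) (auto simp: Y_def)
        ultimately show "x \<in> \<Union>\<alpha>" unfolding \<alpha>_def by (intro UnionI[of "X \<inter> Y"]) auto
      qed (use partition_onD1[OF \<xi>'(1)] in \<open>auto simp: \<alpha>_def\<close>)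
      fix p q assume "p \<in> \<alpha>" "q \<in> \<alpha>" "p \<noteq> q"
      then obtain X Y X' Y' where XY: "p = X \<inter> Y" "q = X' \<inter> Y'" "X \<in> \<xi>" "X' \<in> \<xi>"
        "Y \<in> {S, space M - S}" "Y' \<in> {S, space M - S}" by (auto simp: \<alpha>_def)
      show "disjnt p q"
      proof (cases "X = X'")
        case True
        then have "Y \<noteq> Y'" using \<open>p \<noteq> q\<close> XY by blast
        then show ?thesis using XY by (auto simp: disjnt_def)
      next
        case False
        then have "X \<inter> X' = {}" using partition_onD2[OF \<xi>'(1)] XY by (auto simp: disjoint_def)
        then show ?thesis using XY by (auto simp: disjnt_def)
      qed
    qed (simp add: \<alpha>_def)
    have fin: "finite \<alpha>" using \<xi>(2) by (simp add: \<alpha>_def)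
    have "\<alpha> \<subseteq> sets M" using \<xi>'(2) S by (auto simp: \<alpha>_def)
    moreover have "refines (space M) \<alpha> \<xi>"
      unfolding refines_def using part \<xi>'(1) by (auto simp: \<alpha>_def)
    ultimately have \<alpha>: "\<alpha> \<in> ?A \<xi>" using part fin by (simp add: measurable_partition_def)
    have "Hom_mu M \<phi> \<alpha> F \<delta> (d i) (\<sigma> i) = {}" for i
      by (rule Hom_mu_empty[OF part fin S\<Omega> _ F(1,3,4) \<phi> \<sigma> d defect]) (auto simp: \<alpha>_def)
    then have "ereal (1 / real (d i)) * log_count (num_restrictions (Hom_mu M \<phi> \<alpha> F \<delta> (d i) (\<sigma> i)) \<xi>) = - \<infinity>" for i
      using d[of i] by (simp add: num_restrictions_def log_count_def)
    then have "?v \<xi> \<alpha> F \<delta> = - \<infinity>" by (simp only: Limsup_const[OF sequentially_bot])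
    moreover have "(INF \<alpha>\<in>?A \<xi>. INF F\<in>?F. INF \<delta>\<in>{0<..}. ?v \<xi> \<alpha> F \<delta>) \<le> ?v \<xi> \<alpha> F \<delta>"
      by (rule INF_lower2[OF \<alpha>], rule INF_lower2[of F], use F in simp, rule INF_lower) (use \<delta> in simp)
    ultimately show ?thesis by simp
  qed
  then have "sofic_entropy G M \<phi> d \<sigma> \<le> - \<infinity>"
    unfolding sofic_entropy_def by (intro SUP_least) auto
  then show ?thesis by simp
qed

section \<open>Realisation on the real line\<close>

text \<open>Only the values of \<open>y\<close> on \<open>J\<close> matter; demanding finite support
  leaves countably many pairs of \<open>J\<close> and \<open>y\<close>.\<close>

definition basic_cylinders :: "('i \<Rightarrow> bool) set set" where
  "basic_cylinders = {C. \<exists>J y. finite J \<and> finite {i. y i} \<and> C = {x. \<forall>i\<in>J. x i = y i}}"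

lemma countable_basic_cylinders: "countable (basic_cylinders :: ('i::countable \<Rightarrow> bool) set set)"
proof -
  let ?B = "basic_cylinders :: ('i \<Rightarrow> bool) set set"
  let ?c = "\<lambda>(J, K). {x :: 'i \<Rightarrow> bool. \<forall>i\<in>J. x i = (i \<in> K)}"
  have eq: "?B = ?c ` ({J. finite J} \<times> {K. finite K})"
  proof (intro equalityI subsetI)
    fix C assume "C \<in> ?B"
    then obtain J y where "finite J" "finite {i. y i}" "C = {x :: 'i \<Rightarrow> bool. \<forall>i\<in>J. x i = y i}" by (auto simp: basic_cylinders_def)
    then show "C \<in> ?c ` ({J. finite J} \<times> {K. finite K})" by (intro image_eqI[of _ _ "(J, {i. y i})"]) auto
  next
    fix C assume "C \<in> ?c ` ({J. finite J} \<times> {K. finite K})"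
    then obtain J K where "finite J" "finite K" "C = {x :: 'i \<Rightarrow> bool. \<forall>i\<in>J. x i = (i \<in> K)}"
      by (elim imageE SigmaE) simp
    then show "C \<in> ?B" unfolding basic_cylinders_def by (intro CollectI exI[of _ J] exI[of _ "\<lambda>i. i \<in> K"]) auto
  qed
  have "countable ({J :: 'i set. finite J} \<times> {K :: 'i set. finite K})"
    using countable_Collect_finite by (intro countable_SIGMA) auto
  then show ?thesis unfolding eq by (rule countable_image)
qed

lemma openin_coins_iff:
  fixes U :: "('i \<Rightarrow> bool) set"
  shows "openin (product_topology (\<lambda>_. discrete_topology UNIV) UNIV) U \<longleftrightarrow>
    (\<forall>x\<in>U. \<exists>C\<in>basic_cylinders. x \<in> C \<and> C \<subseteq> U)"
proof -
  let ?B = "basic_cylinders :: ('i \<Rightarrow> bool) set set"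
  show "openin (product_topology (\<lambda>_. discrete_topology UNIV) UNIV) U \<longleftrightarrow> (\<forall>x\<in>U. \<exists>C\<in>?B. x \<in> C \<and> C \<subseteq> U)"
    unfolding openin_product_topology_alt
  proof (intro ball_cong refl iffI)
    fix x assume x: "x \<in> U"
    assume "\<exists>V. finite {i \<in> UNIV. V i \<noteq> topspace (discrete_topology UNIV)} \<and>
      (\<forall>i\<in>UNIV. openin (discrete_topology UNIV) (V i)) \<and> x \<in> Pi\<^sub>E UNIV V \<and> Pi\<^sub>E UNIV V \<subseteq> U"
    then obtain V where V: "finite {i. V i \<noteq> UNIV}" "x \<in> Pi\<^sub>E UNIV V" "Pi\<^sub>E UNIV V \<subseteq> U" by auto
    let ?J = "{i. V i \<noteq> UNIV}"
    let ?C = "{z. \<forall>i\<in>?J. z i = (i \<in> ?J \<and> x i)}"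
    have sub: "?C \<subseteq> Pi\<^sub>E UNIV V"
    proof
      fix z assume z: "z \<in> ?C"
      have "z i \<in> V i" for i using V(2) z by (cases "i \<in> ?J") auto
      then show "z \<in> Pi\<^sub>E UNIV V" by auto
    qed
    have CB: "?C \<in> ?B" unfolding basic_cylinders_def using V(1)
      by (intro CollectI exI[of _ ?J] exI[of _ "\<lambda>i. i \<in> ?J \<and> x i"]) (auto intro: finite_subset)
    show "\<exists>C\<in>?B. x \<in> C \<and> C \<subseteq> U"
    proof (rule bexI[OF _ CB], rule conjI)
      show "x \<in> ?C" by simp
      show "?C \<subseteq> U" using sub V(3) by (rule order_trans)
    qed
  next
    fix x assume x: "x \<in> U" "\<exists>C\<in>?B. x \<in> C \<and> C \<subseteq> U"
    then obtain J y where J: "finite J" "\<forall>i\<in>J. x i = y i" "{x. \<forall>i\<in>J. x i = y i} \<subseteq> U"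
      unfolding basic_cylinders_def by auto
    define V where "V i = (if i \<in> J then {y i} else UNIV)" for i
    have "{i. V i \<noteq> UNIV} \<subseteq> J" by (auto simp: V_def)
    then have fin: "finite {i. V i \<noteq> UNIV}" using J(1) by (rule finite_subset)
    have x: "x \<in> Pi\<^sub>E UNIV V" using J(2) by (auto simp: V_def)
    have sub: "Pi\<^sub>E UNIV V \<subseteq> {x. \<forall>i\<in>J. x i = y i}"
    proof
      fix z assume "z \<in> Pi\<^sub>E UNIV V"
      then have "z i \<in> V i" for i by auto
      moreover have "V i = {y i}" if "i \<in> J" for i using that by (simp add: V_def)
      ultimately have "z i = y i" if "i \<in> J" for i using that by blast
      then show "z \<in> {x. \<forall>i\<in>J. x i = y i}" by simp
    qed
    show "\<exists>V. finite {i \<in> UNIV. V i \<noteq> topspace (discrete_topology UNIV)} \<and>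
      (\<forall>i\<in>UNIV. openin (discrete_topology UNIV) (V i)) \<and> x \<in> Pi\<^sub>E UNIV V \<and> Pi\<^sub>E UNIV V \<subseteq> U"
    proof (intro exI[of _ V] conjI)
      show "Pi\<^sub>E UNIV V \<subseteq> U" using sub J(3) by (rule order_trans)
    qed (use fin x in simp_all)
  qed
qed

text \<open>\<open>standard_borel\<close> asks for some Polish topology on the space with the right
  Borel sets. The product topology is carried over to \<open>range e\<close>, where it is unrelated
  to any topology of the target type.\<close>

lemma standard_borel_coins:
  fixes e :: "('i::countable \<Rightarrow> bool) \<Rightarrow> 'r"
  assumes e: "inj e"
  shows "standard_borel (embed_measure coins e)"
proof -
  let ?T0 = "product_topology (\<lambda>_::'i. discrete_topology (UNIV :: bool set)) UNIV"
  let ?B = "basic_cylinders :: ('i \<Rightarrow> bool) set set"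
  define T where "T = pullback_topology (range e) (inv' e) ?T0"
  have top0: "topspace ?T0 = UNIV" by simp
  have openB: "openin ?T0 C" if "C \<in> ?B" for C 
  proof (rule iffD2[OF openin_coins_iff], rule ballI)
    fix x assume x: "x \<in> C"
    show "\<exists>D\<in>?B. x \<in> D \<and> D \<subseteq> C" by (rule bexI[of _ C]) (simp_all add: x that)
  qed
  have BM: "C \<in> sets coins" if "C \<in> ?B" for C
  proof -
    from that obtain J y where "finite J" "C = {x. \<forall>i\<in>J. x i = y i}" unfolding basic_cylinders_def by auto
    then show ?thesis by (simp add: cylinder_in_sets)
  qed
  have openM: "U \<in> sets coins" if U: "openin ?T0 U" for U
  proof -
    have eq: "\<Union>{C \<in> ?B. C \<subseteq> U} = U"
    proof (intro equalityI subsetI)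
      fix x assume "x \<in> U"
      from bspec[OF iffD1[OF openin_coins_iff U] this]
      obtain C where "C \<in> ?B" "x \<in> C" "C \<subseteq> U" by (elim bexE conjE)
      then show "x \<in> \<Union>{C \<in> ?B. C \<subseteq> U}" by (intro UnionI[of C]) simp_all
    next
      fix x assume "x \<in> \<Union>{C \<in> ?B. C \<subseteq> U}"
      then show "x \<in> U" by (elim UnionE CollectE conjE) (rule subsetD)
    qed
    have cnt: "countable {C \<in> ?B. C \<subseteq> U}" using countable_basic_cylinders by (rule countable_subset[rotated]) simp
    have "\<Union>{C \<in> ?B. C \<subseteq> U} \<in> sets coins"
      by (intro sets.countable_Union cnt subsetI BM) simp
    then show ?thesis by (simp only: eq)
  qed
  have sets0: "sets coins = sigma_sets UNIV {U. openin ?T0 U}"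
  proof (rule equalityI)
    have "{x. x i} \<in> ?B" for i
      unfolding basic_cylinders_def by (intro CollectI exI[of _ "{i}"] exI[of _ "\<lambda>j. j = i"]) auto
    then show "sets coins \<subseteq> sigma_sets UNIV {U. openin ?T0 U}"
      unfolding sets_coins using openB by (intro sigma_sets_mono) (auto intro!: sigma_sets.Basic)
    have "{U. openin ?T0 U} \<subseteq> sets coins" using openM by (intro subsetI) simp
    from sets.sigma_sets_subset[OF this] show "sigma_sets UNIV {U. openin ?T0 U} \<subseteq> sets coins" by simp
  qed
  have inv_e: "inv' e -` A \<inter> range e = e ` A" for A
    using e by (auto simp: inv_f_f)
  have openT: "openin T S \<longleftrightarrow> (\<exists>U. openin ?T0 U \<and> S = e ` U)" for S
    unfolding T_def openin_pullback_topology inv_e ..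
  have topT: "topspace T = range e"
    unfolding T_def topspace_pullback_topology top0 by auto
  have "homeomorphic_maps ?T0 T e (inv' e)"
    unfolding homeomorphic_maps_def
  proof (intro conjI ballI)
    show "continuous_map ?T0 T e"
      unfolding continuous_map_alt
    proof (intro conjI allI impI)
      show "openin ?T0 (e -` S \<inter> topspace ?T0)" if "openin T S" for S
        using that e unfolding openT top0 by (auto simp: inj_vimage_image_eq)
    qed (auto simp: topT)
    show "continuous_map T ?T0 (inv' e)"
      unfolding continuous_map_alt
    proof (intro conjI allI impI)
      show "openin T (inv' e -` S \<inter> topspace T)" if "openin ?T0 S" for S
        using that unfolding topT inv_e openT by blast
    qed auto
  qed (use e in \<open>auto simp: topT inv_f_f\<close>)
  then have hom: "?T0 homeomorphic_space T" unfolding homeomorphic_space_def by blast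
  have "completely_metrizable_space ?T0"
    by (simp add: completely_metrizable_space_product_topology completely_metrizable_space_discrete_topology)
  then have "completely_metrizable_space T" using homeomorphic_completely_metrizable_space[OF hom] by simp
  moreover have "second_countable ?T0"
    unfolding second_countable_def 
  proof (intro exI[of _ ?B] conjI ballI allI impI countable_basic_cylinders openB)
    fix U x assume "openin ?T0 U \<and> x \<in> U"
    then show "\<exists>V\<in>?B. x \<in> V \<and> V \<subseteq> U" using openin_coins_iff[of U] by simp
  qed
  then have "second_countable T" using homeomorphic_space_second_countability[OF hom] by simp
  moreover have "sets (embed_measure coins e) = sigma_sets (range e) {U. openin T U}"
  proof -
    have "sets (embed_measure coins e) = {inv' e -` A \<inter> range e |A. A \<in> sigma_sets UNIV {U. openin ?T0 U}}"
      unfolding sets_embed_measure[OF e] inv_e sets0 ..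
    also have "\<dots> = sigma_sets (range e) {inv' e -` A \<inter> range e |A. A \<in> {U. openin ?T0 U}}"
      by (rule sigma_sets_vimage_commute) simp
    also have "{inv' e -` A \<inter> range e |A. A \<in> {U. openin ?T0 U}} = {U. openin T U}"
      unfolding inv_e openT by auto
    finally show ?thesis .
  qed
  ultimately show ?thesis
    unfolding standard_borel_def by (intro exI[of _ T]) (simp add: topT space_embed_measure)
qed

lemma measure_embed_image:
  assumes "inj e" "A \<in> sets M" shows "measure (embed_measure M e) (e ` A) = measure M A"
  using emeasure_embed_measure_image[OF assms] by (simp add: measure_def)

section \<open>Transport of group and action to \<open>nat\<close> and the target of an
  injection\<close>

context twisted_shift
begin

text \<open>A copy of the group on the natural numbers, the carrier type of the final
  statement.\<close>

definition grp :: "nat monoid" where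
  "grp = \<lparr>carrier = range (to_nat :: 'g \<Rightarrow> nat),
     mult = (\<lambda>j k. to_nat (from_nat j + from_nat k :: 'g)), one = to_nat (0 :: 'g)\<rparr>"

lemma grp_simps:
  "carrier grp = range (to_nat :: 'g \<Rightarrow> nat)" "\<one>\<^bsub>grp\<^esub> = to_nat (0 :: 'g)"
  "to_nat g \<otimes>\<^bsub>grp\<^esub> to_nat h = to_nat (g + h :: 'g)"
  by (simp_all add: grp_def)

lemma group_grp: "group grp"
proof (rule groupI)
  fix x assume "x \<in> carrier grp"
  then obtain g :: 'g where "x = to_nat g" by (auto simp: grp_simps)
  then have "to_nat (- g) \<otimes>\<^bsub>grp\<^esub> x = \<one>\<^bsub>grp\<^esub>" by (simp add: grp_simps)
  then show "\<exists>y\<in>carrier grp. y \<otimes>\<^bsub>grp\<^esub> x = \<one>\<^bsub>grp\<^esub>" by (auto simp: grp_simps)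
qed (auto simp: grp_simps add.assoc)

text \<open>Restricted to \<open>range e\<close> because elements of \<open>BijGroup\<close> are
  extensional.\<close>

definition lift_act :: "('g config \<Rightarrow> 'r) \<Rightarrow> nat \<Rightarrow> 'r \<Rightarrow> 'r" where
  "lift_act e k = restrict (\<lambda>r. e (act (from_nat k) (inv' e r))) (range e)"

context
  fixes e :: "'g config \<Rightarrow> 'r"
  assumes e: "inj e"
begin

abbreviation "emb \<equiv> embed_measure (coins :: 'g config measure) e"

lemma lift_act_e [simp]: "lift_act e (to_nat g) (e x) = e (act g x)"
  using e by (simp add: lift_act_def)

lemma lift_act_image: "lift_act e (to_nat g) ` e ` A = e ` act g ` A"
  by (simp add: image_image)

lemma space_emb: "space emb = range e"
  by (simp add: space_embed_measure)

lemma sets_emb: "B \<in> sets emb \<longleftrightarrow> (\<exists>A\<in>sets coins. B = e ` A)"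
  by (auto simp: sets_embed_measure[OF e])

lemma prob_space_emb: "prob_space emb"
proof -
  interpret prob_space "coins :: 'g config measure" by (rule prob_space_coins)
  show ?thesis
  proof (rule prob_spaceI)
    have "emeasure emb (e ` space coins) = emeasure coins (space coins :: 'g config set)"
      by (rule emeasure_embed_measure_image[OF e]) (rule sets.top)
    then show "emeasure emb (space emb) = 1" by (simp add: space_emb emeasure_space_1[simplified])
  qed
qed

lemma bij_lift_act: "bij_betw (lift_act e (to_nat (g :: 'g))) (range e) (range e)"
proof (rule bij_betwI[where g = "lift_act e (to_nat (- g))"])
  show "lift_act e (to_nat g) \<in> range e \<rightarrow> range e" "lift_act e (to_nat (- g)) \<in> range e \<rightarrow> range e"
    by auto
qed auto

lemma lift_act_pmp: "pmp_action grp emb (lift_act e)"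
  unfolding pmp_action_def
proof (intro conjI ballI)
  show "prob_space emb" by (rule prob_space_emb)
  have Bij: "lift_act e k \<in> Bij (range e)" if "k \<in> carrier grp" for k
    using that bij_lift_act by (auto simp: Bij_def grp_simps lift_act_def)
  show "group_action grp (space emb) (lift_act e)"
    unfolding group_action_def group_hom_def group_hom_axioms_def space_emb
  proof (intro conjI homI)
    show "group grp" by (rule group_grp)
    show "group (BijGroup (range e))" by (rule group_BijGroup)
    show "lift_act e k \<in> carrier (BijGroup (range e))" if "k \<in> carrier grp" for k
      using Bij[OF that] by (simp add: BijGroup_def)
    fix j k assume jk: "j \<in> carrier grp" "k \<in> carrier grp"
    then obtain g h :: 'g where gh: "j = to_nat g" "k = to_nat h" by (auto simp: grp_simps)
    have "lift_act e (j \<otimes>\<^bsub>grp\<^esub> k) = compose (range e) (lift_act e j) (lift_act e k)"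
    proof (rule extensionalityI)
      fix r assume "r \<in> range e"
      then obtain x where "r = e x" by blast
      then show "lift_act e (j \<otimes>\<^bsub>grp\<^esub> k) r = compose (range e) (lift_act e j) (lift_act e k) r"
        by (simp add: gh grp_simps compose_def act_add)
    qed (auto simp: lift_act_def)
    then show "lift_act e (j \<otimes>\<^bsub>grp\<^esub> k) = lift_act e j \<otimes>\<^bsub>BijGroup (range e)\<^esub> lift_act e k"
      using Bij jk by (simp add: BijGroup_def)
  qed
  fix k assume "k \<in> carrier grp"
  then obtain g :: 'g where k: "k = to_nat g" by (auto simp: grp_simps)
  have vim: "lift_act e k -` (e ` A) \<inter> space emb = e ` (act g -` A)" for A
    unfolding space_emb k by (auto simp: inj_image_mem_iff[OF e] inj_eq[OF e])
  show meas: "lift_act e k \<in> emb \<rightarrow>\<^sub>M emb"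
  proof (rule measurableI)
    show "lift_act e k r \<in> space emb" if "r \<in> space emb" for r
      using that by (auto simp: space_emb k)
    show "lift_act e k -` B \<inter> space emb \<in> sets emb" if "B \<in> sets emb" for B
    proof -
      from that obtain A where "A \<in> sets coins" "B = e ` A" by (auto simp: sets_emb)
      then show ?thesis using vim[of A] in_sets_embed_measure[OF act_vimage_sets[of A g], of e] by simp
    qed
  qed
  show "distr emb emb (lift_act e k) = emb"
  proof (rule measure_eqI)
    fix B assume "B \<in> sets (distr emb emb (lift_act e k))"
    then obtain A where A: "A \<in> sets coins" "B = e ` A" by (auto simp: sets_emb)
    have "emeasure (distr emb emb (lift_act e k)) B = emeasure emb (e ` (act g -` A))"
      unfolding A(2) vim[symmetric] by (rule emeasure_distr[OF meas in_sets_embed_measure[OF A(1)]])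
    also have "\<dots> = emeasure coins (act g -` A)"
      by (rule emeasure_embed_measure_image[OF e act_vimage_sets[OF A(1)]])
    also have "\<dots> = emeasure (distr coins coins (act g)) A"
      using A(1) by (simp add: emeasure_distr)
    also have "\<dots> = emeasure emb B"
      using A by (simp add: distr_act emeasure_embed_measure_image[OF e])
    finally show "emeasure (distr emb emb (lift_act e k)) B = emeasure emb B" .
  qed simp
qed

lemma lift_act_free: "essentially_free grp emb (lift_act e)"
  unfolding essentially_free_def AE_embed_measure[OF e]
  using act_free
proof (rule AE_mp, intro AE_I2 impI)
  fix x :: "'g config" assume x: "\<forall>g. act g x = x \<longrightarrow> g = 0"
  have fixed: "lift_act e (to_nat g) (e x) = e x \<longleftrightarrow> g = 0" for g :: 'g
  proof
    assume "lift_act e (to_nat g) (e x) = e x"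
    then have "act g x = x" using injD[OF e, of "act g x" x] by simp
    then show "g = 0" using x by simp
  qed simp
  show "stabilizer grp (lift_act e) (e x) = {\<one>\<^bsub>grp\<^esub>}"
  proof (intro equalityI subsetI)
    fix k assume "k \<in> stabilizer grp (lift_act e) (e x)"
    then obtain g :: 'g where "k = to_nat g" "lift_act e (to_nat g) (e x) = e x"
      unfolding stabilizer_def grp_simps by blast
    then show "k \<in> {\<one>\<^bsub>grp\<^esub>}" using fixed[of g] by (simp add: grp_simps)
  next
    fix k assume "k \<in> {\<one>\<^bsub>grp\<^esub>}"
    then show "k \<in> stabilizer grp (lift_act e) (e x)"
      using fixed[of 0] by (simp add: stabilizer_def grp_simps)
  qed
qed

lemma lift_act_ergodic:
  assumes "\<exists>g. par g" "\<And>E. finite E \<Longrightarrow> \<exists>g. \<not> par g \<and> (\<forall>h\<in>E. g + h \<notin> E)"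
  shows "ergodic_action grp emb (lift_act e)"
  unfolding ergodic_action_def
proof (intro ballI impI)
  fix B assume B: "B \<in> sets emb" "\<forall>k\<in>carrier grp. lift_act e k ` B = B"
  then obtain A where A: "A \<in> sets coins" "B = e ` A" by (auto simp: sets_emb)
  have inv_A: "act g ` A = A" for g
  proof -
    have "e ` act g ` A = e ` A" using B(2) A(2) lift_act_image[of g A] by (auto simp: grp_simps)
    then show ?thesis using e by (simp add: inj_image_eq_iff)
  qed
  from act_ergodic[OF assms A(1) inv_A] have "measure coins A = 0 \<or> measure coins A = 1" .
  then show "measure emb B = 0 \<or> measure emb B = 1" by (simp add: A measure_embed_image[OF e])
qed

end

end

section \<open>Entropy of generating partitions\<close>

context twisted_shift
begin

text \<open>If the entropy were finite, the classes of positive measure in a countable subcollection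
  \<open>\<alpha>'\<close> would form an alphabet \<open>\<A>\<close> whose finite entropy sums stay
  below \<open>H\<close>. As \<open>\<alpha>\<close> generates, each \<open>bit j\<close> is
  approximated by sets read from finite names in this alphabet, which
  \<open>no_finite_entropy\<close> excludes.\<close>

lemma shannon_entropy_generating:
  fixes e :: "'g config \<Rightarrow> 'r"
  assumes e: "inj e"
    and models: "\<And>E. finite E \<Longrightarrow> \<exists>(V :: 'v set) a p. free_model E V a p"
    and \<alpha>: "generating_partition grp (embed_measure coins e) (lift_act e) \<alpha>"
  shows "shannon_entropy (embed_measure coins e) \<alpha> = \<infinity>"
proof (rule ccontr)
  let ?M = "embed_measure (coins :: 'g config measure) e"
  interpret M: prob_space ?M by (rule prob_space_emb[OF e])
  assume "shannon_entropy ?M \<alpha> \<noteq> \<infinity>"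
  then have "shannon_entropy ?M \<alpha> < \<infinity>" by (simp add: less_top)
  then obtain \<alpha>' where \<alpha>': "countable \<alpha>'" "\<alpha>' \<subseteq> \<alpha>" "measure ?M (\<Union>\<alpha>') = 1"
    and fin: "(\<Sum>\<^sub>\<infinity>A\<in>\<alpha>'. ennreal (- (measure ?M A * ln (measure ?M A)))) < \<infinity>"
    unfolding shannon_entropy_def INF_less_iff by blast
  define H where "H = enn2real (\<Sum>\<^sub>\<infinity>A\<in>\<alpha>'. ennreal (- (measure ?M A * ln (measure ?M A))))"
  have H0: "0 \<le> H" by (simp add: H_def)
  have H: "(\<Sum>\<^sub>\<infinity>A\<in>\<alpha>'. ennreal (- (measure ?M A * ln (measure ?M A)))) = ennreal H"
    unfolding H_def using fin by simp
  have part: "partition_on (space ?M) \<alpha>" and \<alpha>M: "\<alpha> \<subseteq> sets ?M"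
    using \<alpha> by (auto simp: generating_partition_def measurable_partition_def)
  have disj: "A \<inter> B = {}" if "A \<in> \<alpha>" "B \<in> \<alpha>" "A \<noteq> B" for A B
    using disjointD[OF partition_onD2[OF part] that] .
  define \<A> where "\<A> = {A \<in> sets coins. e ` A \<in> \<alpha>' \<and> 0 < measure ?M (e ` A)}"
  have meas: "measure ?M (e ` A) = measure coins A" if "A \<in> sets coins" for A
    by (rule measure_embed_image[OF e that])
  have inj_e: "inj_on ((`) e) T" for T :: "'g config set set"
    by (rule inj_onI) (simp add: inj_image_eq_iff[OF e])
  have null: "measure ?M A = 0" if A: "A \<in> \<alpha>" "\<not> (A \<in> \<alpha>' \<and> 0 < measure ?M A)" for A
  proof (cases "A \<in> \<alpha>'")
    case True
    then show ?thesis using A(2) measure_nonneg[of ?M A] by linarith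
  next
    case False
    have "A \<inter> \<Union>\<alpha>' = {}" using disj[OF A(1)] False \<alpha>'(2) by blast
    moreover have "\<Union>\<alpha>' \<in> sets ?M" using \<alpha>' \<alpha>M by (intro sets.countable_Union) auto
    ultimately have "measure ?M (A \<union> \<Union>\<alpha>') = measure ?M A + measure ?M (\<Union>\<alpha>')"
      using A(1) \<alpha>M by (intro M.finite_measure_Union) auto
    then show ?thesis using \<alpha>'(3) M.prob_le_1[of "A \<union> \<Union>\<alpha>'"] measure_nonneg[of ?M A] by linarith
  qed

  show False
  proof (rule no_finite_entropy[OF models, where \<A> = \<A> and H = H])
    show "finite E \<Longrightarrow> finite E" for E :: "'g set" .
    show "\<A> \<subseteq> sets coins" by (auto simp: \<A>_def)
    show "0 < measure coins A" if "A \<in> \<A>" for A using that meas[of A] by (simp add: \<A>_def)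
    show "(\<Sum>A\<in>T. measure coins A) \<le> 1" if T: "finite T" "T \<subseteq> \<A>" for T
    proof -
      have "(\<Sum>A\<in>T. measure coins A) = (\<Sum>A\<in>T. measure ?M (e ` A))"
        using T by (intro sum.cong) (auto simp: \<A>_def meas)
      also have "\<dots> = measure ?M (\<Union>A\<in>T. e ` A)"
      proof (rule M.finite_measure_finite_Union[symmetric])
        show "disjoint_family_on ((`) e) T"
          unfolding disjoint_family_on_def
        proof (intro ballI impI)
          fix A B assume AB: "A \<in> T" "B \<in> T" "A \<noteq> B"
          have "e ` A \<in> \<alpha>" "e ` B \<in> \<alpha>" using AB T(2) \<alpha>'(2) by (auto simp: \<A>_def)
          moreover have "e ` A \<noteq> e ` B" using AB(3) by (simp add: inj_image_eq_iff[OF e])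
          ultimately show "e ` A \<inter> e ` B = {}" by (rule disj)
        qed
        show "(`) e ` T \<subseteq> sets ?M" using T(2) \<alpha>'(2) \<alpha>M by (auto simp: \<A>_def)
      qed (rule T)
      also have "\<dots> \<le> 1" by (rule M.prob_le_1)
      finally show ?thesis .
    qed
    show "(\<Sum>A\<in>T. - ln (measure coins A) * measure coins A) \<le> H" if T: "finite T" "T \<subseteq> \<A>" for T
    proof -
      let ?h = "\<lambda>A. - (measure ?M A * ln (measure ?M A))"
      have h0: "0 \<le> ?h A" for A
      proof (cases "measure ?M A = 0")
        case False
        then have "0 < measure ?M A" using measure_nonneg[of ?M A] by linarith
        then have "ln (measure ?M A) \<le> 0" using M.prob_le_1[of A] by simp
        then show ?thesis using measure_nonneg[of ?M A] by (simp add: mult_nonneg_nonpos)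
      qed simp
      have "(\<Sum>A\<in>T. - ln (measure coins A) * measure coins A) = (\<Sum>A\<in>T. ?h (e ` A))"
        using T by (intro sum.cong) (auto simp: \<A>_def meas)
      also have "\<dots> = (\<Sum>B\<in>(`) e ` T. ?h B)"
        by (simp add: sum.reindex[OF inj_e])
      finally have eq: "(\<Sum>A\<in>T. - ln (measure coins A) * measure coins A) = (\<Sum>B\<in>(`) e ` T. ?h B)" .
      have "ennreal (\<Sum>B\<in>(`) e ` T. ?h B) = (\<Sum>B\<in>(`) e ` T. ennreal (?h B))"
        using h0 by (intro sum_ennreal[symmetric])
      also have "\<dots> \<le> (\<Sum>\<^sub>\<infinity>A\<in>\<alpha>'. ennreal (?h A))"
        unfolding nonneg_infsum_complete[OF zero_le]
        using T by (intro SUP_upper) (auto simp: \<A>_def)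
      also have "\<dots> = ennreal H" by (rule H)
      finally show ?thesis unfolding eq using H0 by (simp add: ennreal_le_iff)
    qed
    fix j and \<epsilon> :: real assume \<epsilon>: "\<epsilon> > 0"
    have bitM: "bit j \<in> sets coins"
      by (rule determined_by_in_sets[of "{Some (0, j)}"]) (auto simp: determined_by_def)
    have itM: "{x. itinerary F T (\<lambda>A. A) x \<in> P} \<in> sets coins" if "finite F" "finite T" "T \<subseteq> \<A>" for F T P
      using that by (intro itinerary_in_sets) (auto simp: \<A>_def)
    \<comment> \<open>The sets readable from a finite name. They are closed under unions because two
      names can be merged by uniting \<open>F\<close> with \<open>F'\<close> and \<open>T\<close>
      with \<open>T'\<close>.\<close>
    let ?C = "{e ` {x. itinerary F T (\<lambda>A. A) x \<in> P} | F T P. finite F \<and> finite T \<and> T \<subseteq> \<A>}"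
    let ?S = "{lift_act e k ` A | k A. k \<in> carrier grp \<and> A \<in> \<alpha>}"
    have "e ` bit j \<in> sets ?M" using bitM by (rule in_sets_embed_measure)
    then obtain B' where B': "B' \<in> sigma_sets (space ?M) ?S" "measure ?M (sym_diff (e ` bit j) B') = 0"
      using \<alpha> unfolding generating_partition_def translates_sigma_def by blast
    have S_form: "\<exists>g A0. A = lift_act e (to_nat (g :: 'g)) ` e ` A0 \<and> e ` A0 \<in> \<alpha> \<and> A0 \<in> sets coins" if A: "A \<in> ?S" for A
    proof -
      obtain k A1 where "A = lift_act e k ` A1" "k \<in> carrier grp" "A1 \<in> \<alpha>" using A by blast
      moreover then obtain g :: 'g where "k = to_nat g" by (auto simp: grp_simps)
      moreover obtain A0 where "A0 \<in> sets coins" "A1 = e ` A0" using \<open>A1 \<in> \<alpha>\<close> \<alpha>M sets_emb[OF e] by blast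
      ultimately show ?thesis by blast
    qed
    have trM: "lift_act e (to_nat (g :: 'g)) ` e ` A0 = e ` (act (- g) -` A0)" for g A0
      unfolding lift_act_image[OF e] act_image ..
    have SM: "?S \<subseteq> sets ?M"
    proof
      fix A assume "A \<in> ?S"
      from S_form[OF this] obtain g A0 where "A = lift_act e (to_nat (g :: 'g)) ` e ` A0" "A0 \<in> sets coins" by blast
      then show "A \<in> sets ?M" by (simp only: trM) (intro in_sets_embed_measure act_vimage_sets)
    qed
    have "\<exists>D\<in>?C. measure ?M (sym_diff B' D) < \<epsilon>"
    proof (rule sigma_sets_approx[OF M.finite_measure_axioms SM _ _ _ _ _ B'(1) \<epsilon>])
      show "?C \<subseteq> sets ?M" using itM by (auto intro: in_sets_embed_measure)
      show "space ?M - A \<in> ?C" if "A \<in> ?C" for A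
      proof -
        obtain F T P where FTP: "A = e ` {x. itinerary F T (\<lambda>A. A) x \<in> P}" "finite F" "finite T" "T \<subseteq> \<A>"
          using \<open>A \<in> ?C\<close> by blast
        have "space ?M - A = e ` {x. itinerary F T (\<lambda>A. A) x \<in> - P}"
          unfolding space_emb[OF e] FTP(1) image_set_diff[OF e, symmetric] by (rule arg_cong[where f = "(`) e"]) auto
        then show ?thesis using FTP by blast
      qed
      show "{} \<in> ?C"
      proof -
        have "{} = e ` {x. itinerary {} {} (\<lambda>A. A) x \<in> {}}" by simp
        then show ?thesis by (intro CollectI exI[of _ "{}"]) simp
      qed
      show "A \<union> B \<in> ?C" if "A \<in> ?C" "B \<in> ?C" for A B
      proof -
        obtain F T P where FTP: "A = e ` {x. itinerary F T (\<lambda>A. A) x \<in> P}" "finite F" "finite T" "T \<subseteq> \<A>"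
          using \<open>A \<in> ?C\<close> by blast
        obtain F' T' P' where FTP': "B = e ` {x. itinerary F' T' (\<lambda>A. A) x \<in> P'}" "finite F'" "finite T'" "T' \<subseteq> \<A>"
          using \<open>B \<in> ?C\<close> by blast
        let ?P = "{Q. Q \<inter> F \<times> T \<in> P \<or> Q \<inter> F' \<times> T' \<in> P'}"
        have "itinerary (F \<union> F') (T \<union> T') (\<lambda>A. A) x \<inter> F \<times> T = itinerary F T (\<lambda>A. A) x"
          "itinerary (F \<union> F') (T \<union> T') (\<lambda>A. A) x \<inter> F' \<times> T' = itinerary F' T' (\<lambda>A. A) x" for x
          by (auto simp: itinerary_def)
        then have "{x. itinerary (F \<union> F') (T \<union> T') (\<lambda>A. A) x \<in> ?P}
          = {x. itinerary F T (\<lambda>A. A) x \<in> P} \<union> {x. itinerary F' T' (\<lambda>A. A) x \<in> P'}" by simp blast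
        then have "A \<union> B = e ` {x. itinerary (F \<union> F') (T \<union> T') (\<lambda>A. A) x \<in> ?P}"
          unfolding FTP(1) FTP'(1) by (simp only: image_Un)
        then show ?thesis using FTP(2-4) FTP'(2-4)
          by (intro CollectI exI[of _ "F \<union> F'"] exI[of _ "T \<union> T'"] exI[of _ ?P] conjI) auto
      qed
      fix A and \<eta> :: real assume "A \<in> ?S" and \<eta>: "\<eta> > 0"
      from S_form[OF this(1)] obtain g A0 where A: "A = lift_act e (to_nat (g :: 'g)) ` e ` A0" "e ` A0 \<in> \<alpha>" "A0 \<in> sets coins" by blast
      show "\<exists>D\<in>?C. measure ?M (sym_diff A D) < \<eta>"
      proof (cases "A0 \<in> \<A>")
        case True
        have "{x. itinerary {g} {A0} (\<lambda>A. A) x \<in> {{(g, A0)}}} = act (- g) -` A0"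
          by (auto simp: itinerary_def)
        then have "A = e ` {x. itinerary {g} {A0} (\<lambda>A. A) x \<in> {{(g, A0)}}}" by (simp only: A(1) trM)
        then have "A \<in> ?C" using True by (intro CollectI exI[of _ "{g}"] exI[of _ "{A0}"] exI[of _ "{{(g, A0)}}"] conjI) auto
        then show ?thesis using \<eta> by (intro bexI[of _ A]) simp_all
      next
        \<comment> \<open>A class outside the alphabet is null, and so are its translates;
          \<open>{}\<close> approximates them.\<close>
        case False
        then have "measure ?M (e ` A0) = 0" using A by (intro null) (auto simp: \<A>_def)
        then have "measure coins (act (- g) -` A0) = 0" using A(3) by (simp add: measure_act_vimage meas)
        then have "measure ?M A = 0"
          using meas[OF act_vimage_sets[OF A(3)]] by (simp only: A(1) trM)
        moreover have "{} \<in> ?C"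
        proof -
          have "{} = e ` {x. itinerary {} {} (\<lambda>A. A) x \<in> {}}" by simp
          then show ?thesis by (intro CollectI exI[of _ "{}"]) simp
        qed
        ultimately show ?thesis using \<eta> by (intro bexI[of _ "{}"]) simp_all
      qed
    qed
    then obtain F T P where FTP: "finite F" "finite T" "T \<subseteq> \<A>"
      and close: "measure ?M (sym_diff B' (e ` {x. itinerary F T (\<lambda>A. A) x \<in> P})) < \<epsilon>" by blast
    let ?D = "{x. itinerary F T (\<lambda>A. A) x \<in> P}"
    have DM: "?D \<in> sets coins" by (rule itM[OF FTP])
    have eD: "e ` ?D \<in> sets ?M" and eb: "e ` bit j \<in> sets ?M"
      using DM bitM by (auto intro: in_sets_embed_measure)
    have B'M: "B' \<in> sets ?M" using B'(1) sets.sigma_sets_subset[OF SM] by blast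
    have "measure coins (sym_diff (bit j) ?D) = measure ?M (e ` sym_diff (bit j) ?D)"
      using DM bitM by (intro meas[symmetric]) auto
    also have "e ` sym_diff (bit j) ?D = sym_diff (e ` bit j) (e ` ?D)"
      by (simp only: image_Un image_set_diff[OF e])
    also have "measure ?M \<dots> \<le> measure ?M (sym_diff (e ` bit j) B' \<union> sym_diff B' (e ` ?D))"
      using eD eb B'M by (intro M.finite_measure_mono) blast+
    also have "\<dots> \<le> measure ?M (sym_diff (e ` bit j) B') + measure ?M (sym_diff B' (e ` ?D))"
      using eD eb B'M by (intro measure_Un_le) auto
    also have "\<dots> < \<epsilon>" using B'(2) close by simp
    finally show "\<exists>F T P. finite F \<and> finite T \<and> T \<subseteq> \<A> \<and> measure coins (sym_diff (bit j) {x. itinerary F T (\<lambda>A. A) x \<in> P}) < \<epsilon>"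
      using FTP by blast
  qed
qed

end

text \<open>Carries the result from \<open>Delta_star\<close> to \<open>Delta\<close>: a finite
  generating partition would have finite entropy.\<close>

lemma shannon_entropy_finite:
  assumes "prob_space M" "measurable_partition M \<alpha>" "finite \<alpha>"
  shows "shannon_entropy M \<alpha> \<noteq> \<infinity>"
proof -
  interpret prob_space M by fact
  have "\<Union>\<alpha> = space M" using assms(2) by (auto simp: measurable_partition_def partition_on_def)
  then have "shannon_entropy M \<alpha> \<le> (\<Sum>\<^sub>\<infinity>A\<in>\<alpha>. ennreal (- (measure M A * ln (measure M A))))"
    unfolding shannon_entropy_def using assms(3) prob_space
    by (intro INF_lower) (simp add: countable_finite)
  also have "\<dots> = (\<Sum>A\<in>\<alpha>. ennreal (- (measure M A * ln (measure M A))))" using assms(3) by simp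
  also have "\<dots> < \<infinity>" using assms(3) by (induction rule: finite_induct) simp_all
  finally show ?thesis by simp
qed

section \<open>The example\<close>

abbreviation vertices :: "nat \<Rightarrow> nat set" where
  "vertices m \<equiv> {1..card (quotient m)}"

definition enum :: "nat \<Rightarrow> nat \<Rightarrow> affine" where
  "enum m = (SOME f. bij_betw f (vertices m) (quotient m))"

lemma enum: "bij_betw (enum m) (vertices m) (quotient m)"
  unfolding enum_def using ex_bij_betw_nat_finite_1[OF finite_quotient] by (rule someI_ex)

lemma enum_in: "k \<in> vertices m \<Longrightarrow> enum m k \<in> quotient m"
  by (rule bspec[OF bij_betwE[OF enum]])

lemma enum_eq_iff:
  "j \<in> vertices m \<Longrightarrow> k \<in> vertices m \<Longrightarrow> enum m j = enum m k \<longleftrightarrow> j = k"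
  by (rule inj_on_eq_iff[OF bij_betw_imp_inj_on[OF enum]])

text \<open>The identity off the vertices, as \<open>permutes\<close> demands of a permutation of
  \<open>{1..d}\<close>.\<close>

definition perm :: "nat \<Rightarrow> aff \<Rightarrow> nat \<Rightarrow> nat" where
  "perm m g k = (if k \<in> vertices m
     then inv_into (vertices m) (enum m) (qact m g (enum m k)) else k)"

lemma perm:
  assumes "k \<in> vertices m"
  shows "perm m g k \<in> vertices m" "enum m (perm m g k) = qact m g (enum m k)"
proof -
  have "qact m g (enum m k) \<in> enum m ` vertices m"
    using qact_in_quotient[OF enum_in[OF assms]] by (simp only: bij_betw_imp_surj_on[OF enum])
  then show "perm m g k \<in> vertices m" "enum m (perm m g k) = qact m g (enum m k)"
    using assms by (simp_all only: perm_def if_True inv_into_into f_inv_into_f)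
qed

lemma perm_add:
  assumes "k \<in> vertices m"
  shows "perm m (g + h) k = perm m g (perm m h k)"
proof -
  have "enum m (perm m (g + h) k) = enum m (perm m g (perm m h k))"
    by (simp only: perm(2)[OF assms] perm(2)[OF perm(1)[OF assms]] qact_add)
  then show ?thesis by (simp only: enum_eq_iff[OF perm(1)[OF assms] perm(1)[OF perm(1)[OF assms]]])
qed

lemma perm_0:
  assumes "k \<in> vertices m"
  shows "perm m 0 k = k"
proof -
  have "enum m (perm m 0 k) = enum m k"
    by (simp only: perm(2)[OF assms] qact_0[OF enum_in[OF assms]])
  then show ?thesis by (simp only: enum_eq_iff[OF perm(1)[OF assms] assms])
qed

lemma perm_permutes: "perm m g permutes (vertices m)"
proof (rule bij_imp_permutes)
  show "bij_betw (perm m g) (vertices m) (vertices m)"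
  proof (rule bij_betwI[where g = "perm m (- g)"])
    show "perm m g \<in> vertices m \<rightarrow> vertices m"
      "perm m (- g) \<in> vertices m \<rightarrow> vertices m"
      using perm(1) by auto
    show "perm m (- g) (perm m g k) = k" "perm m g (perm m (- g) k) = k"
      if "k \<in> vertices m" for k
      using perm_add[OF that, of "- g" g] perm_add[OF that, of g "- g"] perm_0[OF that] by simp_all
  qed
qed (auto simp: perm_def)

lemma perm_defect:
  fixes m :: nat
  assumes m: "odd m" "m > 1" and W: "W \<subseteq> vertices m"
  shows "\<exists>s\<in>{tr 1 0, tr 0 1, upper, lower}. 1 / 200 * card (quotient m)
     \<le> card {k \<in> vertices m. (perm m s k \<in> W) \<noteq> ((k \<in> W) \<noteq> parity s)}"
proof -
  let ?D = "vertices m"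
  obtain s where s: "s \<in> {tr 1 0, tr 0 1, upper, lower}" "real (card (quotient m)) / 200
     < card {p \<in> quotient m. (qact m s p \<in> enum m ` W) \<noteq> ((p \<in> enum m ` W) \<noteq> parity s)}"
    using odd_quotient_defect[OF m] by blast
  have W_iff: "enum m k \<in> enum m ` W \<longleftrightarrow> k \<in> W" if "k \<in> ?D" for k
    by (rule inj_on_image_mem_iff[OF bij_betw_imp_inj_on[OF enum] that W])
  have "{p \<in> quotient m. (qact m s p \<in> enum m ` W) \<noteq> ((p \<in> enum m ` W) \<noteq> parity s)}
    = enum m ` {k \<in> ?D. (perm m s k \<in> W) \<noteq> ((k \<in> W) \<noteq> parity s)}" (is "?L = ?R")
  proof (intro equalityI subsetI)
    fix p assume p: "p \<in> ?L"
    then have "p \<in> quotient m" by simp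
    then have "p \<in> enum m ` ?D" by (simp only: bij_betw_imp_surj_on[OF enum])
    then obtain k where k: "k \<in> ?D" "p = enum m k" by (elim imageE)
    then have "(perm m s k \<in> W) \<noteq> ((k \<in> W) \<noteq> parity s)"
      using p W_iff[OF k(1)] W_iff[OF perm(1)[OF k(1)]] perm(2)[OF k(1)] by simp
    then show "p \<in> ?R" using k by blast
  next
    fix p assume "p \<in> ?R"
    then obtain k where k: "k \<in> ?D" "p = enum m k" "(perm m s k \<in> W) \<noteq> ((k \<in> W) \<noteq> parity s)" by blast
    then show "p \<in> ?L"
      using W_iff[OF k(1)] W_iff[OF perm(1)[OF k(1)]] perm(2)[OF k(1)] enum_in[OF k(1)] by simp
  qed
  moreover have "inj_on (enum m) {k \<in> ?D. (perm m s k \<in> W) \<noteq> ((k \<in> W) \<noteq> parity s)}"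
    by (rule inj_on_subset[OF bij_betw_imp_inj_on[OF enum]]) (rule Collect_restrict)
  ultimately have "card ?L = card {k \<in> ?D. (perm m s k \<in> W) \<noteq> ((k \<in> W) \<noteq> parity s)}"
    by (simp only: card_image)
  then show ?thesis using s by (intro bexI[OF _ s(1)]) linarith
qed

definition modulus :: "nat \<Rightarrow> nat" where
  "modulus i = 2 * i + 3"

lemma modulus: "odd (modulus i)" "modulus i > 1"
  by (simp_all add: modulus_def)

lemma card_quotient_pos: "card (quotient (modulus i)) > 0"
  using card_quotient_ge[of "int (modulus i)"] modulus(2)[of i] by simp

text \<open>\<open>perm\<close> is an exact action, so multiplicativity holds at every point for
  every \<open>i\<close>. Two distinct elements are separated at every point once the modulus
  exceeds the sum of their heights.\<close>

lemma perm_sofic: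
  "sofic_approximation aff.grp (\<lambda>i. card (quotient (modulus i))) (\<lambda>i k. perm (modulus i) (from_nat k))"
  unfolding sofic_approximation_def
proof (intro conjI allI ballI impI)
  let ?d = "\<lambda>i. card (quotient (modulus i))"
  show "filterlim ?d at_top sequentially"
  proof (rule filterlim_at_top_mono[OF filterlim_ident], rule always_eventually, rule allI)
    show "i \<le> ?d i" for i
      using card_quotient_ge[of "int (modulus i)"] modulus(2)[of i] by (simp add: modulus_def)
  qed
  show "(\<lambda>k. perm (modulus i) (from_nat k)) \<in> carrier aff.grp \<rightarrow> carrier (sym_group (?d i))" for i
    using perm_permutes by (auto simp: sym_group_carrier)
  fix j k assume "j \<in> carrier aff.grp" "k \<in> carrier aff.grp"
  then obtain g h :: aff where gh: "j = to_nat g" "k = to_nat h" by (auto simp: aff.grp_simps)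
  have "{l \<in> {1..?d i}. perm (modulus i) (g + h) l = perm (modulus i) g (perm (modulus i) h l)} = {1..?d i}" for i
    using perm_add by auto
  then have "real (card {l \<in> {1..?d i}. perm (modulus i) (g + h) l = perm (modulus i) g (perm (modulus i) h l)}) / real (?d i) = 1" for i
    using card_quotient_pos[of i] by (simp only: card_atLeastAtMost) simp
  then show "(\<lambda>i. real (card {l \<in> {1..?d i}. perm (modulus i) (from_nat (j \<otimes>\<^bsub>aff.grp\<^esub> k)) l
      = perm (modulus i) (from_nat j) (perm (modulus i) (from_nat k) l)}) / real (?d i)) \<longlonglongrightarrow> 1"
    by (simp only: gh aff.grp_simps from_nat_to_nat tendsto_const)
  assume "j \<noteq> k"
  then have ne: "g \<noteq> h" by (auto simp: gh)
  have "\<forall>\<^sub>F i in sequentially. nat (height (Rep_aff g) + height (Rep_aff h)) \<le> i"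
    by (rule eventually_ge_at_top)
  then have "\<forall>\<^sub>F i in sequentially.
    real (card {l \<in> {1..?d i}. perm (modulus i) g l \<noteq> perm (modulus i) h l}) / real (?d i) = 1"
  proof (rule eventually_mono)
    fix i assume i: "nat (height (Rep_aff g) + height (Rep_aff h)) \<le> i"
    have "perm (modulus i) g l \<noteq> perm (modulus i) h l" if l: "l \<in> {1..?d i}" for l
    proof
      assume "perm (modulus i) g l = perm (modulus i) h l"
      then have "qact (modulus i) g (enum (modulus i) l) = qact (modulus i) h (enum (modulus i) l)"
        using perm(2)[OF l] by metis
      moreover have "height (Rep_aff g) + height (Rep_aff h) < int (modulus i)"
        using i by (simp add: modulus_def nat_le_iff)
      ultimately show False using qact_free[OF enum_in[OF l]] ne by blast
    qed
    then have "{l \<in> {1..?d i}. perm (modulus i) g l \<noteq> perm (modulus i) h l} = {1..?d i}" by blast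
    then show "real (card {l \<in> {1..?d i}. perm (modulus i) g l \<noteq> perm (modulus i) h l}) / real (?d i) = 1"
      using card_quotient_pos[of i] by simp
  qed
  then have "(\<lambda>i. real (card {l \<in> {1..?d i}. perm (modulus i) g l \<noteq> perm (modulus i) h l}) / real (?d i)) \<longlonglongrightarrow> 1"
    by (rule tendsto_eventually)
  then show "(\<lambda>i. real (card {l \<in> {1..?d i}. perm (modulus i) (from_nat j) l \<noteq> perm (modulus i) (from_nat k) l}) / real (?d i)) \<longlonglongrightarrow> 1"
    by (simp add: gh)
qed

text \<open>The obstruction is the two-point factor: \<open>S\<close> is the half where the
  coordinate \<open>None\<close> is true. The element \<open>0\<close> joins the four generators
  because \<open>F\<close> has to contain the identity.\<close>

lemma aff_sofic_entropy:
  fixes e :: "aff config \<Rightarrow> 'r"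
  assumes e: "inj e"
  shows "sofic_entropy aff.grp (embed_measure coins e) (aff.lift_act e)
    (\<lambda>i. card (quotient (modulus i))) (\<lambda>i k. perm (modulus i) (from_nat k)) = - \<infinity>"
proof (rule sofic_entropy_minus_infinity[where S = "e ` {x. x None}" and \<delta> = "1 / 200"
      and F = "to_nat ` {0, tr 1 0, tr 0 1, upper, lower}" and par = "\<lambda>k. parity (from_nat k)"])
  let ?gens = "{0, tr 1 0, tr 0 1, upper, lower}"
  show "e ` {x. x None} \<in> sets (embed_measure coins e)"
    by (intro in_sets_embed_measure determined_by_in_sets[of "{None}"]) (auto simp: determined_by_def)
  show "to_nat ` ?gens \<subseteq> carrier aff.grp" "\<one>\<^bsub>aff.grp\<^esub> \<in> to_nat ` ?gens" by (auto simp: aff.grp_simps)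
  show "aff.lift_act e \<one>\<^bsub>aff.grp\<^esub> x = x" if "x \<in> space (embed_measure coins e)" for x
    using that by (auto simp: space_embed_measure aff.grp_simps aff.lift_act_e[OF e])
  show "bij_betw (aff.lift_act e s) (space (embed_measure coins e)) (space (embed_measure coins e))"
    if "s \<in> to_nat ` ?gens" for s
    using that aff.bij_lift_act[OF e] by (auto simp: space_embed_measure)
  show "aff.lift_act e s ` e ` {x. x None}
      = (if parity (from_nat s) then space (embed_measure coins e) - e ` {x. x None} else e ` {x. x None})"
    if "s \<in> to_nat ` ?gens" for s
  proof -
    from that obtain g where s: "s = to_nat (g :: aff)" by blast
    have "aff.act g ` {x. x None} = (if parity g then - {x. x None} else {x. x None})"
      unfolding aff.act_image by (auto simp: aff.act_None aff.par_minus)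
    then have "aff.lift_act e s ` e ` {x. x None} = (if parity g then e ` (- {x. x None}) else e ` {x. x None})"
      unfolding s aff.lift_act_image[OF e] by simp
    also have "e ` (- {x. x None}) = space (embed_measure coins e) - e ` {x. x None}"
      by (simp add: space_embed_measure Compl_eq_Diff_UNIV image_set_diff[OF e])
    finally show ?thesis by (simp add: s)
  qed
  show "perm (modulus i) (from_nat s) permutes (vertices (modulus i))" for i s
    by (rule perm_permutes)
  show "0 < card (quotient (modulus i))" for i by (rule card_quotient_pos)
  show "\<exists>s\<in>to_nat ` ?gens. 1 / 200 * real (card (quotient (modulus i)))
      \<le> card {k \<in> vertices (modulus i). (perm (modulus i) (from_nat s) k \<in> W) \<noteq> ((k \<in> W) \<noteq> parity (from_nat s))}"
    if W: "W \<subseteq> vertices (modulus i)" for i W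
  proof -
    obtain s where s: "s \<in> {tr 1 0, tr 0 1, upper, lower}"
      "1 / 200 * real (card (quotient (modulus i)))
      \<le> card {k \<in> vertices (modulus i). (perm (modulus i) s k \<in> W) \<noteq> ((k \<in> W) \<noteq> parity s)}"
      by (rule bexE[OF perm_defect[OF modulus W]])
    have "to_nat s \<in> to_nat ` ?gens" using s(1) by (intro imageI) simp
    then show ?thesis by (rule bexI[rotated]) (simp only: from_nat_to_nat s(2))
  qed
qed auto

theorem proposition1p3:
  shows "\<exists>(G :: nat monoid) (d :: nat \<Rightarrow> nat) (\<sigma> :: nat \<Rightarrow> nat \<Rightarrow> nat \<Rightarrow> nat)
           (M :: real measure) (\<phi> :: nat \<Rightarrow> real \<Rightarrow> real).
           sofic_group G \<and> sofic_approximation G d \<sigma> \<and>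
           standard_borel M \<and> pmp_action G M \<phi> \<and>
           essentially_free G M \<phi> \<and> ergodic_action G M \<phi> \<and>
           sofic_entropy G M \<phi> d \<sigma> = - \<infinity> \<and>
           Delta_star G M \<phi> = \<infinity> \<and> Delta G M \<phi> = \<infinity>"
proof -
  \<comment> \<open>Configurations are subsets of a countable set, so they inject into
    \<open>nat set\<close>, which has the cardinality of the reals.\<close>
  obtain f :: "nat set \<Rightarrow> real" where f: "inj f"
    using nat_sets_eqpoll_reals unfolding eqpoll_def by (auto simp: bij_betw_def)
  define e :: "aff config \<Rightarrow> real" where "e x = f (to_nat ` {i. x i})" for x
  have e: "inj e"
  proof (rule injI)
    fix x y assume "e x = e y"
    then have "to_nat ` {i. x i} = to_nat ` {i. y i}" using injD[OF f] by (simp add: e_def)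
    then have "{i. x i} = {i. y i}" by (simp only: inj_image_eq_iff[OF inj_to_nat])
    then show "x = y" by (simp add: set_eq_iff fun_eq_iff)
  qed
  let ?M = "embed_measure coins e"
  let ?\<phi> = "aff.lift_act e"
  let ?d = "\<lambda>i. card (quotient (modulus i))" and ?\<sigma> = "\<lambda>i k. perm (modulus i) (from_nat k)"
  have inf: "shannon_entropy ?M \<alpha> = \<infinity>" if "generating_partition aff.grp ?M ?\<phi> \<alpha>" for \<alpha>
    by (rule aff.shannon_entropy_generating[OF e aff_models that])
  have "sofic_group aff.grp"
    unfolding sofic_group_def using aff.group_grp perm_sofic by (auto simp: aff.grp_simps)
  moreover have "ergodic_action aff.grp ?M ?\<phi>"
    using aff_displace parity_tr[of 1 0] by (intro aff.lift_act_ergodic[OF e]) auto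
  moreover have "Delta_star aff.grp ?M ?\<phi> = \<infinity>"
    unfolding Delta_star_def using inf by (simp add: Inf_eqI)
  moreover have "Delta aff.grp ?M ?\<phi> = \<infinity>"
  proof -
    have "\<not> finite \<alpha>" if "generating_partition aff.grp ?M ?\<phi> \<alpha>" for \<alpha>
      using shannon_entropy_finite[OF aff.prob_space_emb[OF e], of \<alpha>] inf[OF that] that
      by (auto simp: generating_partition_def)
    then have none: "{\<alpha>. generating_partition aff.grp ?M ?\<phi> \<alpha> \<and> finite \<alpha>} = {}" by blast
    show ?thesis unfolding Delta_def none by (simp add: top_enat_def)
  qed
  ultimately show ?thesis
    using perm_sofic standard_borel_coins[OF e] aff.lift_act_pmp[OF e] aff.lift_act_free[OF e] aff_sofic_entropy[OF e]
    by (intro exI[of _ aff.grp] exI[of _ ?d] exI[of _ ?\<sigma>] exI[of _ ?M] exI[of _ ?\<phi>] conjI)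
qed

end
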